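(* Let $\mathcal A$ be an indexing collection of finite dimension on $\mathcal T$, with compatible metric $d_{\mathcal A}$ and reference measure $m$, and let $Y=\{Y_A:A\in\mathcal A\}$, $Y_A=\int_Af\,dX$, be the integral process of a locally $X$-integrable function $f$ with respect to a set-indexed Lévy process $X$ with cancelled drift, as in the context. Let $A\in\mathcal A$ and define, for all $\rho>0$, $$\mathcal F_{(A,\rho)}=\sigma\big(Y_A-Y_{A'}:\ A'\in\mathcal A,\ 0<d_{\mathcal A}(A,A')<\rho\big)\qquad\text{and}\qquad \mathcal F_{A+}=\bigcap_{\rho>0}\mathcal F_{(A,\rho)}.$$ If $m(\mathcal V(A,\rho))\to0$ as $\rho\to0$, then any event in $\mathcal F_{A+}$ has probability either $0$ or $1$.
   Context: Indexing collection. $\mathcal T$ is a non-empty set. $\mathcal A\subseteq\mathcal P(\mathcal T)$ is an indexing collection on $\mathcal T$ if: (1) $\varnothing\in\mathcal A$, and $\mathcal A$ and $\mathcal A\setminus\{\varnothing\}$ are closed under countable intersections; (2) there is an increasing sequence of finite subcollections $\mathcal A_n\subseteq\mathcal A$ ($n\in\mathbb N$), each closed under intersections, such that with $g_n(A)=\bigcap\{A'\in\mathcal A_n\cup\{\mathcal T\}:A\subseteq A'\}$ one has $A=\bigcap_n g_n(A)$ for all $A\in\mathcal A$; (3) (SHAPE) if $A,A_1,\dots,A_n\in\mathcal A$ and $A\subseteq\bigcup_{i\le n}A_i$ then $A\subseteq A_j$ for some $j$; (4) (TIP) the map $t\mapsto A(t)=\bigcap_nA_n(t)$, with $A_n(t)=\bigcap\{A\in\mathcal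 A_n\cup\{\mathcal T\}:t\in A\}$, is a bijection from $\mathcal T$ onto $\mathcal A\setminus\{\varnothing\}$. The sequence $(\mathcal A_n)$ is fixed, and $\varnothing$ and $\varnothing'=\bigcap_{A\in\mathcal A,A\ne\varnothing}A$ are assumed to belong to every $\mathcal A_n$. $\mathcal B=\sigma(\mathcal A)$. $\mathcal C_k=\{A_0\setminus\bigcup_{i=1}^{k+1}A_i:A_0,\dots,A_{k+1}\in\mathcal A\}$. $\mathcal C^\ell(\mathcal A_n)$ is the collection of sets $A\setminus\bigcup_{A'\in\mathcal A_n,A'\subsetneq A}A'$, $A\in\mathcal A_n$; $\mathcal C^\ell=\bigcup_n\mathcal C^\ell(\mathcal A_n)$. Finite dimension: there is $p\in\mathbb N^*$ such that every $(\mathcal A_n,\subseteq)$ admits an order embedding into $\mathbb N^p$ (componentwise order) and $\mathcal C^\ell\subseteq\mathcal C_{p-1}$. Compatible metric. A pseudo-metric $d_{\mathcal A}$ on $\mathcal A$ ("metric" for short), transported to $\mathcal T$ by $d_{\mathcal T}(s,t)=d_{\mathcal A}(A(s),A(t))$, is (set-indexed) compatible if: (i) $d_{\mathcal A}(A\cap A'',A'\cap A'')\le d_{\mathcal A}(A,A')$; (ii) $d_{\mathcal A}(A_n,\bigcap_kA_k)\to0$ for every non-increasing sequence $(A_n)$ in $\mathcal A$; (iii) $\max_{C\in\mathcal C^\ell(\mathcal A_n)}\mathrm{diam}(C)\to0$ as $n\to\infty$, where $\mathrm{diam}(C)=\sup_{s,s'\in C}d_{\mathcal T}(s,s')$; (iv)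 for $A\subseteq A'$ in $\mathcal A$ there is $A''\in\mathcal A$ with $A\subseteq A''\subseteq A'$ and $d_{\mathcal A}(A,A'')=d_{\mathcal A}(A'',A')=d_{\mathcal A}(A,A')/2$. A compatible metric $d_{\mathcal A}$ is fixed, with open balls $B_{\mathcal A}(A,\rho)$. $m$ is a measure on $(\mathcal T,\mathcal B)$, finite on $\mathcal A$, such that $d_m(A,A')=m(A\triangle A')$ is also compatible. Victiny: $\mathcal V(A,\rho)=\bigcup_{A'\in B_{\mathcal A}(A,\rho)}(A\triangle A')$. The processes. $(\Omega,\mathcal F,\mathbf P)$ is a complete probability space. $\sigma\ge0$, $\nu$ is a Borel measure on $\mathbb R$ with $\nu(\{0\})=0$ and $\int x^2\,\nu(dx)<\infty$. $B=\{B_A\}$ is a centered Gaussian process with $\mathbf E[B_{A_1}B_{A_2}]=m(A_1\cap A_2)$, and $\widetilde\Pi$ is an independent Poisson random set on $\mathcal T\times\mathbb R$ with intensity $m\otimes\nu$. For measurable $g:\mathcal T\to\mathbb R$ and $\varepsilon>0$, $$\int_Ag\,d\widetilde N^\varepsilon=\sum_{(t,J)\in\widetilde\Pi,\ t\in A,\ |J|\ge\varepsilon}g(t)J,\qquad \int_Ag\,dN^\varepsilon=\int_Ag\,d\widetilde N^\varepsilon-\int_Ag\,dm\int_{\varepsilon\le|x|\le1}x\,\nu(dx),$$ and $\int_Ag\,dN$ (resp. $\int_Ag\,d\widetilde N$ when $\int_{|x|\le1}|x|\nu(dx)<\infty$) is the limit as $\varepsilon\to0^+$, which holds almost surely uniformly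 over $\{A'\in\mathcal A:A'\subseteq A\}$ for each $A\in\mathcal A$. $\int_Ag\,dB$ is the Wiener integral. Drifts are cancelled: $X_A=\sigma B_A+\int_A1\,dN$ and $Y_A=\sigma\int_Af\,dB+\int_Af\,dN$ if $\int_{|x|\le1}|x|\nu(dx)=\infty$; the same with $\widetilde N$ in place of $N$ if $\int_{|x|\le1}|x|\nu(dx)<\infty$. Thus $X$ has Lévy–Khintchine triplet $(b,\sigma^2,\nu)$ (truncation $\mathbf 1_{|x|\le1}$) with $b=0$, resp. $b=\int_{|x|\le1}x\,\nu(dx)$. $f$ is locally $X$-integrable: it is $\mathcal B$-measurable and for every $A\in\mathcal A$, $g=f\mathbf 1_A$ satisfies $(b+\int_{|x|>1}x\,\nu(dx))^2\|g\|_{L^1(m)}^2+(\sigma^2+\int x^2\nu(dx))\|g\|_{L^2(m)}^2<\infty$ (with $0\times\infty=0$). *)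

theory Defs
  imports "HOL-Probability.Probability"
begin

text \<open>The discretizing sequence of finite subcollections is written \<open>\<A>s\<close> and is part of the
  structure.\<close>

definition g_approx :: "'a set \<Rightarrow> (nat \<Rightarrow> 'a set set) \<Rightarrow> nat \<Rightarrow> 'a set \<Rightarrow> 'a set" where
  "g_approx T \<A>s n A = \<Inter>{A' \<in> \<A>s n \<union> {T}. A \<subseteq> A'}"

definition point_set_n :: "'a set \<Rightarrow> (nat \<Rightarrow> 'a set set) \<Rightarrow> nat \<Rightarrow> 'a \<Rightarrow> 'a set" where
  "point_set_n T \<A>s n t = \<Inter>{A \<in> \<A>s n \<union> {T}. t \<in> A}"

definition point_set :: "'a set \<Rightarrow> (nat \<Rightarrow> 'a set set) \<Rightarrow> 'a \<Rightarrow> 'a set" where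
  "point_set T \<A>s t = (\<Inter>n. point_set_n T \<A>s n t)"

text \<open>Intersections are over non-empty families, so \<open>T\<close> itself need not belong to \<open>\<A>\<close>;
  likewise the covering family in \<open>SHAPE\<close> is non-empty.\<close>

locale indexing_collection =
  fixes T :: "'a set" and \<A> :: "'a set set" and \<A>s :: "nat \<Rightarrow> 'a set set"
  assumes T_nonempty: "T \<noteq> {}"
    and subsets: "\<A> \<subseteq> Pow T"
    and empty_mem: "{} \<in> \<A>"
    and countable_Inter:
      "\<And>F. F \<subseteq> \<A> \<Longrightarrow> F \<noteq> {} \<Longrightarrow> countable F \<Longrightarrow> \<Inter>F \<in> \<A>"
    and countable_Inter_nonempty:
      "\<And>F. F \<subseteq> \<A> - {{}} \<Longrightarrow> F \<noteq> {} \<Longrightarrow> countable F \<Longrightarrow> \<Inter>F \<in> \<A> - {{}}"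
    and approx_subset: "\<And>n. \<A>s n \<subseteq> \<A>"
    and approx_finite: "\<And>n. finite (\<A>s n)"
    and approx_mono: "mono \<A>s"
    and approx_Int: "\<And>n A B. A \<in> \<A>s n \<Longrightarrow> B \<in> \<A>s n \<Longrightarrow> A \<inter> B \<in> \<A>s n"
    and approx: "\<And>A. A \<in> \<A> \<Longrightarrow> A = (\<Inter>n. g_approx T \<A>s n A)"
    and SHAPE: "\<And>A F. A \<in> \<A> \<Longrightarrow> F \<subseteq> \<A> \<Longrightarrow> finite F \<Longrightarrow> F \<noteq> {} \<Longrightarrow> A \<subseteq> \<Union>F
      \<Longrightarrow> \<exists>A'\<in>F. A \<subseteq> A'"
    and TIP: "bij_betw (point_set T \<A>s) T (\<A> - {{}})"
    and empty_approx: "\<And>n. {} \<in> \<A>s n"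
    and empty'_approx: "\<And>n. \<Inter>(\<A> - {{}}) \<in> \<A>s n"

definition C_class :: "'a set set \<Rightarrow> nat \<Rightarrow> 'a set set" where
  "C_class \<A> k = {F 0 - (\<Union>i\<in>{1..k+1}. F i) |F. \<forall>i\<le>k+1. F i \<in> \<A>}"

definition left_nbhds :: "'a set set \<Rightarrow> 'a set set" where
  "left_nbhds \<D> = {A - \<Union>{A' \<in> \<D>. A' \<subset> A} |A. A \<in> \<D>}"

definition order_embeds_nat_pow :: "nat \<Rightarrow> 'a set set \<Rightarrow> bool" where
  "order_embeds_nat_pow p \<D> \<longleftrightarrow>
    (\<exists>\<phi> :: 'a set \<Rightarrow> nat \<Rightarrow> nat. \<forall>A\<in>\<D>. \<forall>A'\<in>\<D>. A \<subseteq> A' \<longleftrightarrow> (\<forall>i<p. \<phi> A i \<le> \<phi> A' i))"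

definition finite_dimension :: "'a set set \<Rightarrow> (nat \<Rightarrow> 'a set set) \<Rightarrow> bool" where
  "finite_dimension \<A> \<A>s \<longleftrightarrow>
    (\<exists>p\<ge>1. (\<forall>n. order_embeds_nat_pow p (\<A>s n)) \<and> (\<Union>n. left_nbhds (\<A>s n)) \<subseteq> C_class \<A> (p - 1))"

definition d_point :: "'a set \<Rightarrow> (nat \<Rightarrow> 'a set set) \<Rightarrow> ('a set \<Rightarrow> 'a set \<Rightarrow> real) \<Rightarrow> 'a \<Rightarrow> 'a \<Rightarrow> real"
  where "d_point T \<A>s d s t = d (point_set T \<A>s s) (point_set T \<A>s t)"

text \<open>The diameter is \<open>ennreal\<close>-valued, so it may be infinite, and is \<open>0\<close> for the empty set.\<close>

definition diam_point ::
  "'a set \<Rightarrow> (nat \<Rightarrow> 'a set set) \<Rightarrow> ('a set \<Rightarrow> 'a set \<Rightarrow> real) \<Rightarrow> 'a set \<Rightarrow> ennreal" where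
  "diam_point T \<A>s d C = (SUP (s, s')\<in>C \<times> C. ennreal (d_point T \<A>s d s s'))"

text \<open>\<open>d\<close> is only a pseudo-metric: \<open>d A A' = 0\<close> does not entail \<open>A = A'\<close>.\<close>

locale compatible_metric =
  fixes T :: "'a set" and \<A> :: "'a set set" and \<A>s :: "nat \<Rightarrow> 'a set set"
    and d :: "'a set \<Rightarrow> 'a set \<Rightarrow> real"
  assumes nonneg: "\<And>A A'. A \<in> \<A> \<Longrightarrow> A' \<in> \<A> \<Longrightarrow> 0 \<le> d A A'"
    and refl: "\<And>A. A \<in> \<A> \<Longrightarrow> d A A = 0"
    and sym: "\<And>A A'. A \<in> \<A> \<Longrightarrow> A' \<in> \<A> \<Longrightarrow> d A A' = d A' A"
    and triangle: "\<And>A A' A''. A \<in> \<A> \<Longrightarrow> A' \<in> \<A> \<Longrightarrow> A'' \<in> \<A> \<Longrightarrow> d A A'' \<le> d A A' + d A' A''"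
    and contractive: "\<And>A A' A''. A \<in> \<A> \<Longrightarrow> A' \<in> \<A> \<Longrightarrow> A'' \<in> \<A> \<Longrightarrow>
      d (A \<inter> A'') (A' \<inter> A'') \<le> d A A'"
    and outer_continuous: "\<And>F :: nat \<Rightarrow> 'a set. (\<And>n. F n \<in> \<A>) \<Longrightarrow> decseq F \<Longrightarrow>
      (\<lambda>n. d (F n) (\<Inter>k. F k)) \<longlonglongrightarrow> 0"
    and diam_tendsto_0: "(\<lambda>n. Max (diam_point T \<A>s d ` left_nbhds (\<A>s n))) \<longlonglongrightarrow> 0"
    and midpoint: "\<And>A A'. A \<in> \<A> \<Longrightarrow> A' \<in> \<A> \<Longrightarrow> A \<subseteq> A' \<Longrightarrow>
      \<exists>A''\<in>\<A>. A \<subseteq> A'' \<and> A'' \<subseteq> A' \<and> d A A'' = d A A' / 2 \<and> d A'' A' = d A A' / 2"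

definition ball_ic :: "'a set set \<Rightarrow> ('a set \<Rightarrow> 'a set \<Rightarrow> real) \<Rightarrow> 'a set \<Rightarrow> real \<Rightarrow> 'a set set" where
  "ball_ic \<A> d A \<rho> = {A' \<in> \<A>. d A A' < \<rho>}"

text \<open>For \<open>A \<in> \<A>\<close> this uncountable union is measurable: by outer continuity applied to the
  approximations \<open>g_approx\<close>, it is unchanged if \<open>A'\<close> is restricted to the countably many sets of
  the discretizing subcollections (and \<open>T\<close>, if \<open>T \<in> \<A>\<close>).\<close>

definition vicinity :: "'a set set \<Rightarrow> ('a set \<Rightarrow> 'a set \<Rightarrow> real) \<Rightarrow> 'a set \<Rightarrow> real \<Rightarrow> 'a set" where
  "vicinity \<A> d A \<rho> = (\<Union>A'\<in>ball_ic \<A> d A \<rho>. sym_diff A A')"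

definition reference_measure ::
  "'a set \<Rightarrow> 'a set set \<Rightarrow> (nat \<Rightarrow> 'a set set) \<Rightarrow> 'a measure \<Rightarrow> bool" where
  "reference_measure T \<A> \<A>s m \<longleftrightarrow>
    space m = T \<and> sets m = sigma_sets T \<A> \<and> (\<forall>A\<in>\<A>. emeasure m A < \<infinity>) \<and>
    compatible_metric T \<A> \<A>s (\<lambda>A A'. measure m (sym_diff A A'))"

definition sigma_gen ::
  "'w measure \<Rightarrow> ('i \<Rightarrow> 'w \<Rightarrow> 'b::topological_space) \<Rightarrow> 'i set \<Rightarrow> 'w set set" where
  "sigma_gen M X I = sigma_sets (space M) (\<Union>i\<in>I. {X i -` S \<inter> space M |S. S \<in> sets borel})"

text \<open>Degenerate Gaussian laws (point mass at \<open>0\<close>) are allowed.\<close>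

definition centered_gaussian :: "'w measure \<Rightarrow> ('w \<Rightarrow> real) \<Rightarrow> bool" where
  "centered_gaussian M Z \<longleftrightarrow> Z \<in> borel_measurable M \<and>
    ((AE \<omega> in M. Z \<omega> = 0) \<or> (\<exists>s>0. distributed M lborel Z (normal_density 0 s)))"

definition centered_gaussian_process :: "'w measure \<Rightarrow> ('i \<Rightarrow> 'w \<Rightarrow> real) \<Rightarrow> 'i set \<Rightarrow> bool" where
  "centered_gaussian_process M B I \<longleftrightarrow>
    (\<forall>F c. finite F \<longrightarrow> F \<subseteq> I \<longrightarrow> centered_gaussian M (\<lambda>\<omega>. \<Sum>i\<in>F. c i * B i \<omega>))"

definition set_indexed_brownian ::
  "'w measure \<Rightarrow> 'a set set \<Rightarrow> 'a measure \<Rightarrow> ('a set \<Rightarrow> 'w \<Rightarrow> real) \<Rightarrow> bool" where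
  "set_indexed_brownian M \<A> m B \<longleftrightarrow> centered_gaussian_process M B \<A> \<and>
    (\<forall>A1\<in>\<A>. \<forall>A2\<in>\<A>. (\<integral>\<omega>. B A1 \<omega> * B A2 \<omega> \<partial>M) = measure m (A1 \<inter> A2))"

text \<open>\<open>W\<close> is a version of the Wiener integral of \<open>g\<close>: the value at \<open>g\<close> of the isometry from
  \<open>L\<^sup>2(m)\<close> to \<open>L\<^sup>2(M)\<close> extending by linearity and density the map sending the indicator of \<open>A\<close> to
  \<open>B A\<close>. It is unique up to almost sure equality.\<close>

definition is_wiener_integral ::
  "'w measure \<Rightarrow> 'a set set \<Rightarrow> 'a measure \<Rightarrow> ('a set \<Rightarrow> 'w \<Rightarrow> real) \<Rightarrow> ('a \<Rightarrow> real) \<Rightarrow> ('w \<Rightarrow> real) \<Rightarrow> bool"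
  where
  "is_wiener_integral M \<A> m B g W \<longleftrightarrow> W \<in> borel_measurable M \<and>
    (\<exists>(F :: nat \<Rightarrow> 'a set set) (c :: nat \<Rightarrow> 'a set \<Rightarrow> real).
      (\<forall>n. finite (F n) \<and> F n \<subseteq> \<A>) \<and>
      (\<lambda>n. \<integral>\<^sup>+t. ennreal ((g t - (\<Sum>A\<in>F n. c n A * indicator A t))\<^sup>2) \<partial>m) \<longlonglongrightarrow> 0 \<and>
      (\<lambda>n. \<integral>\<^sup>+\<omega>. ennreal ((W \<omega> - (\<Sum>A\<in>F n. c n A * B A \<omega>))\<^sup>2) \<partial>M) \<longlonglongrightarrow> 0)"

definition pt_count :: "('w \<Rightarrow> 'b set) \<Rightarrow> 'b set \<Rightarrow> 'w \<Rightarrow> ennreal" where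
  "pt_count \<Xi> E \<omega> = emeasure (count_space UNIV) (\<Xi> \<omega> \<inter> E)"

text \<open>The Poisson law of infinite mean is the point mass at \<open>\<infinity>\<close>.\<close>

definition poisson_law :: "'w measure \<Rightarrow> ('w \<Rightarrow> ennreal) \<Rightarrow> ennreal \<Rightarrow> bool" where
  "poisson_law M N r \<longleftrightarrow>
    (if r = \<infinity> then (AE \<omega> in M. N \<omega> = \<infinity>)
     else (\<forall>k::nat. measure M {\<omega> \<in> space M. N \<omega> = of_nat k}
             = exp (- enn2real r) * enn2real r ^ k / fact k))"

definition poisson_random_set :: "'w measure \<Rightarrow> 'b measure \<Rightarrow> ('w \<Rightarrow> 'b set) \<Rightarrow> bool" where
  "poisson_random_set M \<mu> \<Xi> \<longleftrightarrow>
    (\<forall>\<omega>\<in>space M. countable (\<Xi> \<omega>) \<and> \<Xi> \<omega> \<subseteq> space \<mu>) \<and>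
    (\<forall>E\<in>sets \<mu>. pt_count \<Xi> E \<in> borel_measurable M \<and> poisson_law M (pt_count \<Xi> E) (emeasure \<mu> E)) \<and>
    (\<forall>(n::nat) E. (\<forall>i<n. E i \<in> sets \<mu>) \<longrightarrow> disjoint_family_on E {..<n} \<longrightarrow>
      prob_space.indep_vars M (\<lambda>_. borel) (\<lambda>i. pt_count \<Xi> (E i)) {..<n})"

definition jump_measure :: "real measure \<Rightarrow> bool" where
  "jump_measure \<nu> \<longleftrightarrow> sets \<nu> = sets borel \<and> emeasure \<nu> {0} = 0 \<and>
    (\<integral>\<^sup>+x. ennreal (x\<^sup>2) \<partial>\<nu>) < \<infinity>"

definition summable_small_jumps :: "real measure \<Rightarrow> bool" where
  "summable_small_jumps \<nu> \<longleftrightarrow> (\<integral>\<^sup>+x\<in>{x. \<bar>x\<bar> \<le> 1}. ennreal \<bar>x\<bar> \<partial>\<nu>) < \<infinity>"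

text \<open>The first component of a point of \<open>\<Xi> \<omega>\<close> is a location, the second a jump size. Almost surely
  the sum is finite for every \<open>A \<in> \<A>\<close> and \<open>\<epsilon> > 0\<close>.\<close>

definition jump_sum ::
  "('w \<Rightarrow> ('a \<times> real) set) \<Rightarrow> ('a \<Rightarrow> real) \<Rightarrow> real \<Rightarrow> 'a set \<Rightarrow> 'w \<Rightarrow> real" where
  "jump_sum \<Xi> g \<epsilon> A \<omega> = (\<Sum>\<^sub>\<infinity>(t, x)\<in>{(t, x) \<in> \<Xi> \<omega>. t \<in> A \<and> \<epsilon> \<le> \<bar>x\<bar>}. g t * x)"

definition compensated_jump_sum ::
  "'a measure \<Rightarrow> real measure \<Rightarrow> ('w \<Rightarrow> ('a \<times> real) set) \<Rightarrow> ('a \<Rightarrow> real) \<Rightarrow> real \<Rightarrow> 'a set \<Rightarrow> 'w \<Rightarrow> real"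
  where
  "compensated_jump_sum m \<nu> \<Xi> g \<epsilon> A \<omega> =
    jump_sum \<Xi> g \<epsilon> A \<omega> - (LINT t:A|m. g t) * (LINT x:{x. \<epsilon> \<le> \<bar>x\<bar> \<and> \<bar>x\<bar> \<le> 1}|\<nu>. x)"

text \<open>\<open>J A\<close> is a version of the integral of \<open>g\<close> over \<open>A\<close> against the uncompensated jump part if the
  small jumps are summable, and against the compensated one otherwise (cancelled drift).\<close>

definition is_jump_integral ::
  "'w measure \<Rightarrow> 'a set set \<Rightarrow> 'a measure \<Rightarrow> real measure \<Rightarrow> ('w \<Rightarrow> ('a \<times> real) set) \<Rightarrow>
    ('a \<Rightarrow> real) \<Rightarrow> ('a set \<Rightarrow> 'w \<Rightarrow> real) \<Rightarrow> bool" where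
  "is_jump_integral M \<A> m \<nu> \<Xi> g J \<longleftrightarrow>
    (\<forall>A\<in>\<A>. AE \<omega> in M. uniform_limit {A' \<in> \<A>. A' \<subseteq> A}
      (\<lambda>\<epsilon> A'. if summable_small_jumps \<nu> then jump_sum \<Xi> g \<epsilon> A' \<omega>
               else compensated_jump_sum m \<nu> \<Xi> g \<epsilon> A' \<omega>)
      (\<lambda>A'. J A' \<omega>) (at_right 0))"

definition is_levy_process ::
  "'w measure \<Rightarrow> 'a set set \<Rightarrow> 'a measure \<Rightarrow> real \<Rightarrow> real measure \<Rightarrow> ('a set \<Rightarrow> 'w \<Rightarrow> real) \<Rightarrow>
    ('w \<Rightarrow> ('a \<times> real) set) \<Rightarrow> ('a set \<Rightarrow> 'w \<Rightarrow> real) \<Rightarrow> bool" where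
  "is_levy_process M \<A> m \<sigma> \<nu> B \<Xi> X \<longleftrightarrow>
    (\<exists>J. is_jump_integral M \<A> m \<nu> \<Xi> (\<lambda>_. 1) J \<and>
      (\<forall>A\<in>\<A>. AE \<omega> in M. X A \<omega> = \<sigma> * B A \<omega> + J A \<omega>))"

text \<open>When \<open>\<sigma> = 0\<close> the Gaussian term is absent; the Wiener integral is then not required to exist,
  since local integrability imposes nothing on \<open>f\<close> if moreover \<open>\<nu> = 0\<close>.\<close>

definition is_integral_process ::
  "'w measure \<Rightarrow> 'a set set \<Rightarrow> 'a measure \<Rightarrow> real \<Rightarrow> real measure \<Rightarrow> ('a set \<Rightarrow> 'w \<Rightarrow> real) \<Rightarrow>
    ('w \<Rightarrow> ('a \<times> real) set) \<Rightarrow> ('a \<Rightarrow> real) \<Rightarrow> ('a set \<Rightarrow> 'w \<Rightarrow> real) \<Rightarrow> bool" where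
  "is_integral_process M \<A> m \<sigma> \<nu> B \<Xi> f Y \<longleftrightarrow>
    (\<exists>W J. (\<sigma> \<noteq> 0 \<longrightarrow> (\<forall>A\<in>\<A>. is_wiener_integral M \<A> m B (\<lambda>t. f t * indicator A t) (W A))) \<and>
      is_jump_integral M \<A> m \<nu> \<Xi> f J \<and>
      (\<forall>A\<in>\<A>. AE \<omega> in M. Y A \<omega> = \<sigma> * W A \<omega> + J A \<omega>))"

definition levy_drift :: "real measure \<Rightarrow> real" where
  "levy_drift \<nu> = (if summable_small_jumps \<nu> then (LINT x:{x. \<bar>x\<bar> \<le> 1}|\<nu>. x) else 0)"

text \<open>The arithmetic of \<open>ennreal\<close> provides the convention \<open>0 * \<infinity> = 0\<close>.\<close>

definition locally_X_integrable ::
  "'a set set \<Rightarrow> 'a measure \<Rightarrow> real \<Rightarrow> real measure \<Rightarrow> ('a \<Rightarrow> real) \<Rightarrow> bool" where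
  "locally_X_integrable \<A> m \<sigma> \<nu> f \<longleftrightarrow> f \<in> borel_measurable m \<and>
    (\<forall>A\<in>\<A>.
      ennreal ((levy_drift \<nu> + (LINT x:{x. \<bar>x\<bar> > 1}|\<nu>. x))\<^sup>2) * (\<integral>\<^sup>+t\<in>A. ennreal \<bar>f t\<bar> \<partial>m)\<^sup>2
      + ennreal (\<sigma>\<^sup>2 + (\<integral>x. x\<^sup>2 \<partial>\<nu>)) * (\<integral>\<^sup>+t\<in>A. ennreal ((f t)\<^sup>2) \<partial>m) < \<infinity>)"

definition local_sigma ::
  "'w measure \<Rightarrow> 'a set set \<Rightarrow> ('a set \<Rightarrow> 'a set \<Rightarrow> real) \<Rightarrow> ('a set \<Rightarrow> 'w \<Rightarrow> real) \<Rightarrow> 'a set \<Rightarrow> real \<Rightarrow> 'w set set"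
  where
  "local_sigma M \<A> d Y A \<rho> =
    sigma_gen M (\<lambda>A' \<omega>. Y A \<omega> - Y A' \<omega>) {A' \<in> \<A>. 0 < d A A' \<and> d A A' < \<rho>}"

definition germ_sigma ::
  "'w measure \<Rightarrow> 'a set set \<Rightarrow> ('a set \<Rightarrow> 'a set \<Rightarrow> real) \<Rightarrow> ('a set \<Rightarrow> 'w \<Rightarrow> real) \<Rightarrow> 'a set \<Rightarrow> 'w set set"
  where
  "germ_sigma M \<A> d Y A = (\<Inter>\<rho>\<in>{0<..}. local_sigma M \<A> d Y A \<rho>)"

end

theory Submission
  imports Defs
begin

text \<open>The increments \<open>Y A - Y A'\<close> with \<open>d A A' < \<rho>\<close> only depend on the noise carried by the vicinity
  \<open>V\<^sub>\<rho>\<close> of \<open>A\<close>. Hence a germ event \<open>E\<close> is independent of the noise off \<open>V\<^sub>\<rho>\<close> for every \<open>\<rho>\<close>, and, as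
  \<open>m V\<^sub>\<rho> \<rightarrow> 0\<close>, of the increments themselves, thus of itself. Independence is
  expressed through characteristic functions: a bounded variable \<open>K\<close> with \<open>\<bbbE>[K e\<^sup>i\<^sup>X] = 0\<close> for every
  linear combination \<open>X\<close> of a family of real variables is orthogonal to every event generated by
  the family. This criterion passes to almost sure limits and ignores multiplicative constants of
  modulus one, so neither the compensators nor jump integrals over general sets play a role.\<close>

section \<open>Fourier totality\<close>

text \<open>The noise off a vicinity cannot be read from \<open>Y\<close>: the sets that remain
  after removing a vicinity need not lie in \<open>\<A>\<close>, and the convergence assumed for the
  jump integral concerns sets of \<open>\<A>\<close> only. The test variables are therefore built
  from the primitive noise, as \<open>cis (Z + psum \<Xi> \<phi>)\<close> with \<open>Z\<close> a
  Wiener integral and \<open>\<phi>\<close> a function whose support has finite intensity, both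
  integrands vanishing on the vicinity. Density of step functions provides the restricted Wiener
  integrals, and sums over a support of finite intensity are almost surely finite. The order of the
  limits matters. With jumps cut off at size 1/(k+1) for a fixed \<open>k\<close>, an increment
  becomes a Gaussian term plus a finite sum plus a constant, and removing the shrinking vicinity
  from it costs nothing in the limit; only afterwards does \<open>k\<close> tend to infinity. The
  restricted Gaussian terms are controlled through the L2 distance of their integrands, which is
  enough because the exponentials then converge in mean.\<close>

lemma borel_measurable_cis [measurable (raw)]:
  assumes "f \<in> borel_measurable M"
  shows "(\<lambda>x. cis (f x)) \<in> borel_measurable M"
  using assms by (rule measurable_compose[OF _ borel_measurable_continuous_onI])
    (intro continuous_intros)

text \<open>The two preimages of a Borel set differ inside a null set, and completeness makes every
  subset of it measurable. Sums over the random points and limits of noise variables are identified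
  only almost surely, and get their measurability from here.\<close>

lemma (in complete_measure) borel_measurable_AE_cong:
  fixes f g :: "'a \<Rightarrow> 'b::topological_space"
  assumes f: "f \<in> borel_measurable M" and eq: "AE x in M. f x = g x"
  shows "g \<in> borel_measurable M"
proof (rule measurableI)
  fix S :: "'b set" assume S: "S \<in> sets borel"
  obtain N where N: "{x \<in> space M. f x \<noteq> g x} \<subseteq> N" "N \<in> null_sets M"
    using eq by (auto elim!: AE_E simp: null_sets_def)
  have "g -` S \<inter> space M \<inter> N \<in> sets M"
    using N(2) by (auto intro: complete[of _ N])
  moreover have "g -` S \<inter> space M = (f -` S \<inter> space M - N) \<union> (g -` S \<inter> space M \<inter> N)"
    using N(1) by auto
  moreover have "f -` S \<inter> space M - N \<in> sets M"
    using measurable_sets[OF f S] N(2) by auto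
  ultimately show "g -` S \<inter> space M \<in> sets M" by (metis sets.Un)
qed auto

text \<open>Adding a constant to \<open>D\<close> and rescaling turns it into a probability density
  \<open>w\<close>. As \<open>D\<close> is orthogonal to every \<open>cis (t * X)\<close>, the
  variable \<open>X\<close> has the same characteristic function under the tilted and the original
  probability, hence the same law by Levy's uniqueness theorem.\<close>

lemma (in prob_space) Fourier_total_real:
  fixes D X :: "'a \<Rightarrow> real"
  assumes [measurable]: "X \<in> borel_measurable M" "D \<in> borel_measurable M"
    and bound: "\<And>\<omega>. \<omega> \<in> space M \<Longrightarrow> \<bar>D \<omega>\<bar> \<le> c"
    and zero: "\<And>t. (\<integral>\<omega>. complex_of_real (D \<omega>) * cis (t * X \<omega>) \<partial>M) = 0"
    and S: "S \<in> sets borel"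
  shows "(\<integral>\<omega>. D \<omega> * indicator S (X \<omega>) \<partial>M) = 0"
proof -
  note S [measurable]
  \<comment> \<open>The absolute value and the \<open>+ 1\<close> make \<open>b\<close> positive
    without a case distinction, so that \<open>(D + b) / b\<close> is defined and
    non-negative.\<close>
  define b where "b = \<bar>c\<bar> + 1"
  have b: "0 < b" and Db: "\<And>\<omega>. \<omega> \<in> space M \<Longrightarrow> \<bar>D \<omega>\<bar> \<le> b"
    using bound by (force simp: b_def)+
  define w where "w \<omega> = (D \<omega> + b) / b" for \<omega>
  have [measurable]: "w \<in> borel_measurable M" unfolding w_def by simp
  have w0: "AE \<omega> in M. 0 \<le> w \<omega>"
  proof (rule AE_I2)
    fix \<omega> assume "\<omega> \<in> space M"
    then show "0 \<le> w \<omega>" using Db[of \<omega>] b by (simp add: w_def abs_le_iff)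
  qed
  have iD: "integrable M D"
    by (rule integrable_const_bound[where B=b]) (use Db in auto)
  \<comment> \<open>Frequency \<open>0\<close> gives mean zero for \<open>D\<close>, which makes
    \<open>w\<close> integrate to one.\<close>
  have "complex_of_real (\<integral>\<omega>. D \<omega> \<partial>M) = 0"
    using zero[of 0] by simp
  then have D0: "(\<integral>\<omega>. D \<omega> \<partial>M) = 0" by simp
  define N where "N = density M (\<lambda>\<omega>. ennreal (w \<omega>))"
  have [measurable_cong, simp]: "sets N = sets M" by (simp add: N_def)
  have iw: "integrable M w" using iD by (simp add: w_def[abs_def])
  have "emeasure N (space N) = ennreal (\<integral>\<omega>. w \<omega> \<partial>M)"
    using iw w0 by (simp add: N_def emeasure_density nn_integral_eq_integral[symmetric]
        cong: nn_integral_cong)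
  also have "(\<integral>\<omega>. w \<omega> \<partial>M) = 1"
    using b D0 iD by (simp add: w_def add_divide_distrib prob_space)
  finally have N: "prob_space N" by (intro prob_spaceI) simp
  have int_N: "(\<integral>\<omega>. g \<omega> \<partial>N) = (\<integral>\<omega>. w \<omega> *\<^sub>R g \<omega> \<partial>M)"
    if "g \<in> borel_measurable M" for g :: "'a \<Rightarrow> 'b::{banach,second_countable_topology}"
    unfolding N_def using that w0 by (subst integral_density) auto
  have iDS: "integrable M (\<lambda>\<omega>. D \<omega> * indicator S (X \<omega>))"
    by (rule integrable_const_bound[where B=b])
      (use Db b in \<open>auto simp: abs_mult indicator_def\<close>)
  have iS: "integrable M (\<lambda>\<omega>. indicator S (X \<omega>) :: real)"
    by (rule integrable_const_bound[where B=1]) (auto simp: indicator_def)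
  have icis: "integrable M (\<lambda>\<omega>. cis (t * X \<omega>))" for t
    by (rule integrable_const_bound[where B=1]) auto
  have iDcis: "integrable M (\<lambda>\<omega>. complex_of_real (D \<omega>) * cis (t * X \<omega>))" for t
    by (rule integrable_const_bound[where B=b]) (use Db in \<open>auto simp: norm_mult\<close>)
  have "char (distr N borel X) = char (distr M borel X)"
  proof
    fix t
    have "char (distr N borel X) t = (\<integral>\<omega>. cis (t * X \<omega>) \<partial>N)"
      by (simp add: char_def integral_distr cis_conv_exp)
    also have "\<dots> = (\<integral>\<omega>. w \<omega> *\<^sub>R cis (t * X \<omega>) \<partial>M)"
      by (rule int_N) simp
    also have "\<dots> = (\<integral>\<omega>. (complex_of_real (D \<omega>) * cis (t * X \<omega>)) / b + cis (t * X \<omega>) \<partial>M)"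
      using b by (intro Bochner_Integration.integral_cong)
        (auto simp: w_def scaleR_conv_of_real field_simps)
    also have "\<dots> = (\<integral>\<omega>. cis (t * X \<omega>) \<partial>M)"
      using zero[of t] by (subst Bochner_Integration.integral_add) (auto intro: icis iDcis)
    also have "\<dots> = char (distr M borel X) t"
      by (simp add: char_def integral_distr cis_conv_exp)
    finally show "char (distr N borel X) t = char (distr M borel X) t" .
  qed
  then have "distr N borel X = distr M borel X"
    by (intro Levy_uniqueness prob_space.real_distribution_distr N prob_space_axioms) auto
  then have "(\<integral>x. indicator S x \<partial>distr N borel X) = (\<integral>x. indicator S x \<partial>distr M borel X :: real)"
    by simp
  then have "(\<integral>\<omega>. indicator S (X \<omega>) \<partial>N) = (\<integral>\<omega>. indicator S (X \<omega>) \<partial>M :: real)"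
    by (subst (asm) (1 2) integral_distr) auto
  then have "(\<integral>\<omega>. w \<omega> *\<^sub>R indicator S (X \<omega>) \<partial>M) = (\<integral>\<omega>. indicator S (X \<omega>) \<partial>M :: real)"
    by (subst (asm) int_N) auto
  moreover have "(\<integral>\<omega>. w \<omega> *\<^sub>R indicator S (X \<omega>) \<partial>M)
      = (\<integral>\<omega>. D \<omega> * indicator S (X \<omega>) / b + indicator S (X \<omega>) \<partial>M)"
    using b by (intro Bochner_Integration.integral_cong) (auto simp: w_def field_simps)
  moreover have "\<dots> = (\<integral>\<omega>. D \<omega> * indicator S (X \<omega>) \<partial>M) / b + (\<integral>\<omega>. indicator S (X \<omega>) \<partial>M)"
    by (subst Bochner_Integration.integral_add)
      (use iDS iS in auto)
  ultimately show ?thesis using b by simp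
qed

text \<open>Conjugation exchanges the frequencies \<open>t\<close> and \<open>-t\<close>, so
  \<open>cnj K\<close> satisfies the same hypothesis as \<open>K\<close>. The real and imaginary
  parts are combinations of these two, and the real case applies to each.\<close>

lemma (in prob_space) Fourier_total:
  fixes K :: "'a \<Rightarrow> complex" and X :: "'a \<Rightarrow> real"
  assumes [measurable]: "X \<in> borel_measurable M" "K \<in> borel_measurable M"
    and bound: "\<And>\<omega>. \<omega> \<in> space M \<Longrightarrow> norm (K \<omega>) \<le> c"
    and zero: "\<And>t. (\<integral>\<omega>. K \<omega> * cis (t * X \<omega>) \<partial>M) = 0"
    and S: "S \<in> sets borel"
  shows "(\<integral>\<omega>. K \<omega> * indicator S (X \<omega>) \<partial>M) = 0"
proof -
  note S[measurable]
  have c0: "0 \<le> c"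
    using bound not_empty order_trans[OF norm_ge_zero] by blast
  have iK: "integrable M (\<lambda>\<omega>. K \<omega> * cis (t * X \<omega>))" for t
    by (rule integrable_const_bound[where B=c]) (use bound in \<open>auto simp: norm_mult\<close>)
  have [measurable]: "(\<lambda>\<omega>. cnj (K \<omega>)) \<in> borel_measurable M"
    by (rule measurable_compose[OF _ borel_measurable_continuous_onI]) (auto intro: continuous_intros)
  have iK': "integrable M (\<lambda>\<omega>. cnj (K \<omega>) * cis (t * X \<omega>))" for t
    by (rule integrable_const_bound[where B=c]) (use bound in \<open>auto simp: norm_mult\<close>)
  have zero': "(\<integral>\<omega>. cnj (K \<omega>) * cis (t * X \<omega>) \<partial>M) = 0" for t
  proof -
    have "(\<integral>\<omega>. cnj (K \<omega>) * cis (t * X \<omega>) \<partial>M) = (\<integral>\<omega>. cnj (K \<omega> * cis (- t * X \<omega>)) \<partial>M)"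
      by (simp add: cis_cnj)
    also have "\<dots> = cnj (\<integral>\<omega>. K \<omega> * cis (- t * X \<omega>) \<partial>M)"
      by (rule Bochner_Integration.integral_cnj)
    finally show ?thesis using zero[of "-t"] by simp
  qed
  have Re: "(\<integral>\<omega>. Re (K \<omega>) * indicator S (X \<omega>) \<partial>M) = 0"
  proof (rule Fourier_total_real[where c=c])
    fix t
    have "(\<integral>\<omega>. complex_of_real (Re (K \<omega>)) * cis (t * X \<omega>) \<partial>M)
      = (\<integral>\<omega>. (K \<omega> * cis (t * X \<omega>) + cnj (K \<omega>) * cis (t * X \<omega>)) / 2 \<partial>M)"
      by (intro Bochner_Integration.integral_cong refl)
        (simp add: distrib_right[symmetric] complex_add_cnj)
    then show "(\<integral>\<omega>. complex_of_real (Re (K \<omega>)) * cis (t * X \<omega>) \<partial>M) = 0"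
      by (simp add: iK iK' zero zero' Bochner_Integration.integral_add)
  qed (use bound abs_Re_le_cmod order_trans S in \<open>auto intro: order_trans[OF abs_Re_le_cmod]\<close>)
  have Im: "(\<integral>\<omega>. Im (K \<omega>) * indicator S (X \<omega>) \<partial>M) = 0"
  proof (rule Fourier_total_real[where c=c])
    fix t
    have "(\<integral>\<omega>. complex_of_real (Im (K \<omega>)) * cis (t * X \<omega>) \<partial>M)
      = (\<integral>\<omega>. (K \<omega> * cis (t * X \<omega>) - cnj (K \<omega>) * cis (t * X \<omega>)) / (2 * \<i>) \<partial>M)"
      by (intro Bochner_Integration.integral_cong refl, subst nonzero_eq_divide_eq)
        (simp_all add: left_diff_distrib[symmetric] complex_diff_cnj)
    then show "(\<integral>\<omega>. complex_of_real (Im (K \<omega>)) * cis (t * X \<omega>) \<partial>M) = 0"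
      by (simp add: iK iK' zero zero' Bochner_Integration.integral_diff)
  qed (use bound S in \<open>auto intro: order_trans[OF abs_Im_le_cmod]\<close>)
  have iS: "integrable M (\<lambda>\<omega>. K \<omega> * indicator S (X \<omega>))"
    by (rule integrable_const_bound[where B=c])
      (use bound c0 in \<open>auto simp: norm_mult indicator_def\<close>)
  have "Re (\<integral>\<omega>. K \<omega> * indicator S (X \<omega>) \<partial>M) = (\<integral>\<omega>. Re (K \<omega> * indicator S (X \<omega>)) \<partial>M)"
    by (rule integral_Re[OF iS, symmetric])
  also have "\<dots> = (\<integral>\<omega>. Re (K \<omega>) * indicator S (X \<omega>) \<partial>M)"
    by (intro Bochner_Integration.integral_cong) (auto simp: indicator_def)
  finally have 1: "Re (\<integral>\<omega>. K \<omega> * indicator S (X \<omega>) \<partial>M) = 0" using Re by simp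
  have "Im (\<integral>\<omega>. K \<omega> * indicator S (X \<omega>) \<partial>M) = (\<integral>\<omega>. Im (K \<omega> * indicator S (X \<omega>)) \<partial>M)"
    by (rule integral_Im[OF iS, symmetric])
  also have "\<dots> = (\<integral>\<omega>. Im (K \<omega>) * indicator S (X \<omega>) \<partial>M)"
    by (intro Bochner_Integration.integral_cong) (auto simp: indicator_def)
  finally have 2: "Im (\<integral>\<omega>. K \<omega> * indicator S (X \<omega>) \<partial>M) = 0" using Im by simp
  show ?thesis using 1 2 by (simp add: complex_eq_iff)
qed

lemma (in prob_space) sigma_gen_subset:
  assumes "\<And>i. i \<in> I \<Longrightarrow> X i \<in> borel_measurable M"
  shows "sigma_gen M X I \<subseteq> sets M"
  unfolding sigma_gen_def using assms
  by (intro sets.sigma_sets_subset) (auto intro: measurable_sets)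

text \<open>Exponentials are traded for indicators one variable at a time, so uniqueness on the real
  line suffices for the multivariate statement. The cylinder sets form a pi-system, from which a
  Dynkin argument reaches the generated sigma-algebra.\<close>

lemma (in prob_space) Fourier_total_sigma_gen:
  fixes K :: "'a \<Rightarrow> complex" and X :: "'i \<Rightarrow> 'a \<Rightarrow> real"
  assumes X: "\<And>i. i \<in> I \<Longrightarrow> X i \<in> borel_measurable M" and K[measurable]: "K \<in> borel_measurable M"
    and bound: "\<And>\<omega>. \<omega> \<in> space M \<Longrightarrow> norm (K \<omega>) \<le> c"
    and zero: "\<And>F t. finite F \<Longrightarrow> F \<subseteq> I \<Longrightarrow> (\<integral>\<omega>. K \<omega> * cis (\<Sum>i\<in>F. t i * X i \<omega>) \<partial>M) = 0"
    and E: "E \<in> sigma_gen M X I"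
  shows "(\<integral>\<omega>. K \<omega> * indicator E \<omega> \<partial>M) = 0"
proof -
  define G where "G = {space M \<inter> (\<Inter>i\<in>F. X i -` S i) |F S. finite F \<and> F \<subseteq> I \<and> (\<forall>i\<in>F. S i \<in> sets borel)}"
  have prod_meas: "(\<lambda>\<omega>. \<Prod>i\<in>F. indicator (S i) (X i \<omega>) :: complex) \<in> borel_measurable M"
    if "finite F" "F \<subseteq> I" "\<And>i. i \<in> F \<Longrightarrow> S i \<in> sets borel" for F S
    using that X by (intro borel_measurable_prod measurable_compose[OF _ borel_measurable_indicator]) auto
  have prod_le: "norm (\<Prod>i\<in>F. indicator (S i) (X i \<omega>) :: complex) \<le> 1" for F :: "'i set" and S \<omega>
    unfolding prod_norm[symmetric] by (rule prod_le_1) (auto simp: indicator_def)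
  \<comment> \<open>Induction on the set \<open>F\<close> of variables already carrying an
    indicator, with arbitrary frequencies left on the disjoint set \<open>F'\<close>. The product so
    far, times the remaining exponential, is bounded and takes the place of \<open>K\<close> in the
    one-variable lemma.\<close>
  have prod_zero: "(\<integral>\<omega>. K \<omega> * (\<Prod>i\<in>F. indicator (S i) (X i \<omega>)) * cis (\<Sum>i\<in>F'. t i * X i \<omega>) \<partial>M) = 0"
    if "finite F" "F \<subseteq> I" "\<And>i. i \<in> F \<Longrightarrow> S i \<in> sets borel" "finite F'" "F' \<subseteq> I" "F \<inter> F' = {}"
    for F S F' t
    using that
  proof (induction F arbitrary: F' t rule: finite_induct)
    case empty
    then show ?case using zero by simp
  next
    case (insert j F)
    let ?K = "\<lambda>\<omega>. K \<omega> * (\<Prod>i\<in>F. indicator (S i) (X i \<omega>)) * cis (\<Sum>i\<in>F'. t i * X i \<omega>)"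
    have [measurable]: "(\<lambda>\<omega>. \<Prod>i\<in>F. indicator (S i) (X i \<omega>) :: complex) \<in> borel_measurable M"
      using insert by (intro prod_meas) auto
    have [measurable]: "(\<lambda>\<omega>. \<Sum>i\<in>F'. t i * X i \<omega>) \<in> borel_measurable M"
      using insert X by (intro borel_measurable_sum borel_measurable_times) auto
    have "(\<integral>\<omega>. ?K \<omega> * indicator (S j) (X j \<omega>) \<partial>M) = 0"
    proof (rule Fourier_total[where c="c"])
      show "X j \<in> borel_measurable M" using X insert by auto
      show "?K \<in> borel_measurable M" by measurable
      show "norm (?K \<omega>) \<le> c" if "\<omega> \<in> space M" for \<omega>
        using mult_mono[OF bound[OF that] prod_le[of S \<omega> F]]
          order_trans[OF norm_ge_zero bound[OF that]]
        by (simp add: norm_mult)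
      show "S j \<in> sets borel" using insert by auto
      fix s
      \<comment> \<open>The frequency \<open>s\<close> of the new variable joins the free ones; the
        induction hypothesis is then used for \<open>F\<close> and \<open>insert j F'\<close>, which
        are again disjoint.\<close>
      have "(\<Sum>i\<in>insert j F'. (t(j := s)) i * X i \<omega>) = s * X j \<omega> + (\<Sum>i\<in>F'. t i * X i \<omega>)" for \<omega>
        using insert by (subst sum.insert) (auto intro!: sum.cong)
      then have "?K \<omega> * cis (s * X j \<omega>)
        = K \<omega> * (\<Prod>i\<in>F. indicator (S i) (X i \<omega>)) * cis (\<Sum>i\<in>insert j F'. (t(j := s)) i * X i \<omega>)" for \<omega>
        by (simp add: cis_mult[symmetric] mult_ac)
      then show "(\<integral>\<omega>. ?K \<omega> * cis (s * X j \<omega>) \<partial>M) = 0"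
        using insert by (simp only:) (rule insert.IH, auto)
    qed
    then show ?case using insert by (simp add: mult_ac)
  qed
  have "Int_stable G"
  proof (rule Int_stableI)
    fix a b assume "a \<in> G" "b \<in> G"
    then obtain F S F' S' where *: "a = space M \<inter> (\<Inter>i\<in>F. X i -` S i)" "finite F" "F \<subseteq> I"
      "\<forall>i\<in>F. S i \<in> sets borel" "b = space M \<inter> (\<Inter>i\<in>F'. X i -` S' i)" "finite F'" "F' \<subseteq> I"
      "\<forall>i\<in>F'. S' i \<in> sets borel"
      unfolding G_def by auto
    \<comment> \<open>\<open>UNIV\<close> is the neutral constraint for an index that occurs in only
      one of the two cylinders.\<close>
    let ?S = "\<lambda>i. (if i \<in> F then S i else UNIV) \<inter> (if i \<in> F' then S' i else UNIV)"
    have "a \<inter> b = space M \<inter> (\<Inter>i\<in>F \<union> F'. X i -` ?S i)"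
      unfolding *(1,5) by (auto split: if_splits)
    moreover have "\<forall>i\<in>F \<union> F'. ?S i \<in> sets borel"
      using *(4,8) by (intro ballI sets.Int) auto
    ultimately show "a \<inter> b \<in> G" unfolding G_def
      using *(2,3,6,7) by (intro CollectI exI[of _ "F \<union> F'"] exI[of _ ?S] conjI) auto
  qed
  have G_sub: "G \<subseteq> sets M"
  proof
    fix a assume "a \<in> G"
    then obtain F S where *: "a = space M \<inter> (\<Inter>i\<in>F. X i -` S i)" "finite F" "F \<subseteq> I"
      "\<forall>i\<in>F. S i \<in> sets borel"
      unfolding G_def by auto
    have "a = space M \<inter> (\<Inter>i\<in>F. X i -` S i \<inter> space M)" unfolding *(1) by auto
    also have "\<dots> \<in> sets M"
    \<comment> \<open>An intersection over no index is \<open>UNIV\<close> rather than an event, so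
      the empty cylinder is treated apart.\<close>
    proof (cases "F = {}")
      case False
      have "X i -` S i \<inter> space M \<in> sets M" if "i \<in> F" for i
        using that *(3,4) X by (intro measurable_sets) auto
      then have "(\<Inter>i\<in>F. X i -` S i \<inter> space M) \<in> sets M"
        using False *(2) by (intro sets.finite_INT) auto
      then show ?thesis by auto
    qed simp
    finally show "a \<in> sets M" .
  qed
  have "E \<in> sigma_sets (space M) G"
  proof -
    have "(\<Union>i\<in>I. {X i -` S \<inter> space M |S. S \<in> sets borel}) \<subseteq> G"
    proof safe
      fix i and S :: "real set" assume "i \<in> I" and S: "S \<in> sets borel"
      then show "X i -` S \<inter> space M \<in> G" unfolding G_def
        by (intro CollectI exI[of _ "{i}"] exI[of _ "\<lambda>_. S"]) auto
    qed
    then show ?thesis using E unfolding sigma_gen_def by (meson sigma_sets_mono' subsetD)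
  qed
  have c0: "0 \<le> c"
    using bound not_empty order_trans[OF norm_ge_zero] by blast
  have G_Pow: "G \<subseteq> Pow (space M)" by (auto simp: G_def)
  have sub: "a \<in> sets M" if "a \<in> sigma_sets (space M) G" for a
    using that G_sub sets.sigma_sets_subset by blast
  have iK: "integrable M (\<lambda>\<omega>. K \<omega> * indicator a \<omega>)" if "a \<in> sets M" for a
    using that bound c0 by (intro integrable_const_bound[where B=c])
      (auto simp: norm_mult indicator_def)
  from \<open>Int_stable G\<close> G_Pow \<open>E \<in> sigma_sets (space M) G\<close> show ?thesis
  proof (induction rule: sigma_sets_induct_disjoint)
    case (basic a)
    then obtain F S where *: "a = space M \<inter> (\<Inter>i\<in>F. X i -` S i)" "finite F" "F \<subseteq> I"
      "\<forall>i\<in>F. S i \<in> sets borel"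
      unfolding G_def by auto
    have "(\<integral>\<omega>. K \<omega> * indicator a \<omega> \<partial>M) = (\<integral>\<omega>. K \<omega> * (\<Prod>i\<in>F. indicator (S i) (X i \<omega>)) * cis (\<Sum>i\<in>{}. 0 * X i \<omega>) \<partial>M)"
    proof (intro Bochner_Integration.integral_cong refl)
      fix \<omega> assume "\<omega> \<in> space M"
      then have "indicator a \<omega> = (\<Prod>i\<in>F. indicator (S i) (X i \<omega>) :: complex)"
        using *(1,2) by (cases "\<forall>i\<in>F. X i \<omega> \<in> S i") (auto simp: indicator_def prod_zero_iff)
      then show "K \<omega> * indicator a \<omega> = K \<omega> * (\<Prod>i\<in>F. indicator (S i) (X i \<omega>)) * cis (\<Sum>i\<in>{}. 0 * X i \<omega>)"
        by simp
    qed
    also have "\<dots> = 0" using * by (intro prod_zero) auto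
    finally show ?case .
  next
    case empty
    show ?case by simp
  next
    case (compl a)
    have a: "a \<in> sets M" by (rule sub) fact
    have "(\<integral>\<omega>. K \<omega> * indicator (space M - a) \<omega> \<partial>M)
      = (\<integral>\<omega>. K \<omega> * indicator (space M) \<omega> - K \<omega> * indicator a \<omega> \<partial>M)"
      by (intro Bochner_Integration.integral_cong) (auto simp: indicator_def)
    also have "\<dots> = (\<integral>\<omega>. K \<omega> * indicator (space M) \<omega> \<partial>M)"
      using compl by (subst Bochner_Integration.integral_diff) (auto intro: iK a)
    also have "\<dots> = (\<integral>\<omega>. K \<omega> \<partial>M)" by (intro Bochner_Integration.integral_cong) auto
    \<comment> \<open>The exponential of the empty combination is one, so \<open>K\<close> itself
      has mean zero.\<close>
    also have "\<dots> = 0" using zero[of "{}"] by simp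
    finally show ?case .
  next
    case (union a)
    have a[measurable]: "a i \<in> sets M" for i by (rule sub) (use union in auto)
    have "(\<lambda>i. \<integral>\<omega>. K \<omega> * indicator (\<Union>j<i. a j) \<omega> \<partial>M) \<longlonglongrightarrow> (\<integral>\<omega>. K \<omega> * indicator (\<Union>i. a i) \<omega> \<partial>M)"
    proof (rule integral_dominated_convergence[where w="\<lambda>_. c"])
      show "AE \<omega> in M. (\<lambda>i. K \<omega> * indicator (\<Union>j<i. a j) \<omega>) \<longlonglongrightarrow> K \<omega> * indicator (\<Union>i. a i) \<omega>"
        by (intro AE_I2 tendsto_mult tendsto_const LIMSEQ_indicator_UN)
      show "AE \<omega> in M. norm (K \<omega> * indicator (\<Union>j<i. a j) \<omega>) \<le> c" for i
        using bound c0 by (auto simp: norm_mult indicator_def)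
    qed auto
    moreover have "(\<integral>\<omega>. K \<omega> * indicator (\<Union>j<i. a j) \<omega> \<partial>M) = 0" for i
    proof -
      have "indicator (\<Union>j<i. a j) \<omega> = (\<Sum>j<i. indicator (a j) \<omega> :: complex)" for \<omega>
        using union(1) by (intro indicator_UN_disjoint) (auto simp: disjoint_family_on_def)
      then have "(\<integral>\<omega>. K \<omega> * indicator (\<Union>j<i. a j) \<omega> \<partial>M) = (\<integral>\<omega>. (\<Sum>j<i. K \<omega> * indicator (a j) \<omega>) \<partial>M)"
        by (simp add: sum_distrib_left)
      also have "\<dots> = 0"
        using union by (subst Bochner_Integration.integral_sum) (auto intro: iK)
      finally show ?thesis .
    qed
    ultimately show ?case by (simp add: LIMSEQ_const_iff)
  qed
qed

section \<open>Sums over a Poisson random set\<close>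

lemma cis_sum: "finite I \<Longrightarrow> cis (\<Sum>i\<in>I. f i) = (\<Prod>i\<in>I. cis (f i))"
  by (induction I rule: finite_induct) (auto simp: cis_mult[symmetric])

lemma (in prob_space) expectation_bounded_tendsto:
  fixes s :: "nat \<Rightarrow> 'a \<Rightarrow> complex"
  assumes "\<And>n. s n \<in> borel_measurable M" "f \<in> borel_measurable M"
    and "AE \<omega> in M. (\<lambda>n. s n \<omega>) \<longlonglongrightarrow> f \<omega>"
    and "\<And>n \<omega>. \<omega> \<in> space M \<Longrightarrow> norm (s n \<omega>) \<le> c"
  shows "(\<lambda>n. \<integral>\<omega>. s n \<omega> \<partial>M) \<longlonglongrightarrow> (\<integral>\<omega>. f \<omega> \<partial>M)"
  by (rule integral_dominated_convergence[where w="\<lambda>_. c"]) (use assms in auto)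

lemma tendsto_cis [tendsto_intros]:
  "(f \<longlongrightarrow> a) F \<Longrightarrow> ((\<lambda>x. cis (f x)) \<longlongrightarrow> cis a) F"
  by (rule continuous_on_tendsto_compose[of UNIV cis]) (auto intro: continuous_intros)

lemma (in prob_space) expectation_cis_tendsto:
  fixes X :: "nat \<Rightarrow> 'a \<Rightarrow> real"
  assumes [measurable]: "\<And>n. X n \<in> borel_measurable M" "Z \<in> borel_measurable M"
    and lim: "AE \<omega> in M. (\<lambda>n. X n \<omega>) \<longlonglongrightarrow> Z \<omega>"
  shows "(\<lambda>n. \<integral>\<omega>. cis (X n \<omega>) \<partial>M) \<longlonglongrightarrow> (\<integral>\<omega>. cis (Z \<omega>) \<partial>M)"
  using lim by (intro expectation_bounded_tendsto[where c=1]) (auto elim!: eventually_mono intro: tendsto_cis)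

section \<open>Sums over the random points and their reduction to counts\<close>

definition psum :: "('w \<Rightarrow> 'b set) \<Rightarrow> ('b \<Rightarrow> real) \<Rightarrow> 'w \<Rightarrow> real" where
  "psum \<Xi> \<phi> \<omega> = infsum \<phi> (\<Xi> \<omega>)"

text \<open>A support of finite intensity carries almost surely finitely many points. There
  \<open>psum\<close> is a finite sum and does not fall back on the default value \<open>0\<close>
  of a divergent \<open>infsum\<close>.\<close>

definition fin_supp :: "'b measure \<Rightarrow> ('b \<Rightarrow> real) \<Rightarrow> bool" where
  "fin_supp \<mu> \<phi> \<longleftrightarrow> \<phi> \<in> borel_measurable \<mu> \<and> emeasure \<mu> {p \<in> space \<mu>. \<phi> p \<noteq> 0} < \<infinity>"

lemma fin_supp_mono:
  assumes "fin_supp \<mu> \<phi>" "\<psi> \<in> borel_measurable \<mu>" "\<And>p. p \<in> space \<mu> \<Longrightarrow> \<phi> p = 0 \<Longrightarrow> \<psi> p = 0"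
  shows "fin_supp \<mu> \<psi>"
proof -
  have [measurable]: "\<phi> \<in> borel_measurable \<mu>" using assms(1) by (simp add: fin_supp_def)
  have "emeasure \<mu> {p \<in> space \<mu>. \<psi> p \<noteq> 0} \<le> emeasure \<mu> {p \<in> space \<mu>. \<phi> p \<noteq> 0}"
    using assms(3) by (intro emeasure_mono) auto
  then show ?thesis using assms(1,2) by (auto simp: fin_supp_def)
qed

lemma fin_supp_add:
  assumes "fin_supp \<mu> \<phi>" "fin_supp \<mu> \<psi>"
  shows "fin_supp \<mu> (\<lambda>p. \<phi> p + \<psi> p)"
proof -
  have [measurable]: "\<phi> \<in> borel_measurable \<mu>" "\<psi> \<in> borel_measurable \<mu>"
    using assms by (simp_all add: fin_supp_def)
  have "emeasure \<mu> {p \<in> space \<mu>. \<phi> p + \<psi> p \<noteq> 0}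
      \<le> emeasure \<mu> ({p \<in> space \<mu>. \<phi> p \<noteq> 0} \<union> {p \<in> space \<mu>. \<psi> p \<noteq> 0})"
    by (intro emeasure_mono) auto
  also have "\<dots> \<le> emeasure \<mu> {p \<in> space \<mu>. \<phi> p \<noteq> 0} + emeasure \<mu> {p \<in> space \<mu>. \<psi> p \<noteq> 0}"
    by (rule emeasure_subadditive) auto
  also have "\<dots> < \<infinity>" using assms by (auto simp: fin_supp_def)
  finally show ?thesis by (simp add: fin_supp_def)
qed

lemma fin_supp_cmult: "fin_supp \<mu> \<phi> \<Longrightarrow> fin_supp \<mu> (\<lambda>p. c * \<phi> p)"
  by (rule fin_supp_mono[of \<mu> \<phi>]) (auto simp: fin_supp_def)

locale poisson_set = prob_space M + complete_measure M for M :: "'w measure" +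
  fixes \<mu> :: "'b measure" and \<Xi> :: "'w \<Rightarrow> 'b set"
  assumes poisson: "poisson_random_set M \<mu> \<Xi>"
begin

lemma Xi_subset: "\<omega> \<in> space M \<Longrightarrow> \<Xi> \<omega> \<subseteq> space \<mu>"
  using poisson by (auto simp: poisson_random_set_def)

lemma measurable_pt_count [measurable]: "E \<in> sets \<mu> \<Longrightarrow> pt_count \<Xi> E \<in> borel_measurable M"
  using poisson by (auto simp: poisson_random_set_def)

lemma pt_count_law:
  assumes "E \<in> sets \<mu>" "emeasure \<mu> E < \<infinity>"
  shows "prob {\<omega> \<in> space M. pt_count \<Xi> E \<omega> = of_nat k}
    = exp (- measure \<mu> E) * measure \<mu> E ^ k / fact k"
proof -
  have "poisson_law M (pt_count \<Xi> E) (emeasure \<mu> E)"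
    using poisson assms(1) by (auto simp: poisson_random_set_def)
  then show ?thesis using assms(2) by (simp add: poisson_law_def measure_def less_top[symmetric])
qed

text \<open>The law is given through the probabilities of the finite values. With \<open>r\<close>
  the intensity of \<open>E\<close> they sum to \<open>exp (- r) * exp r = 1\<close>, which leaves
  no mass for an infinite count.\<close>

lemma AE_finite_points:
  assumes E: "E \<in> sets \<mu>" "emeasure \<mu> E < \<infinity>"
  shows "AE \<omega> in M. finite (\<Xi> \<omega> \<inter> E)"
proof -
  note E(1)[measurable]
  let ?A = "\<lambda>k. {\<omega> \<in> space M. pt_count \<Xi> E \<omega> = of_nat k}"
  have "(\<lambda>k. prob (?A k)) sums prob (\<Union>k. ?A k)"
    by (intro finite_measure_UNION) (auto simp: disjoint_family_on_def)
  moreover have "(\<lambda>k. prob (?A k)) sums (exp (- measure \<mu> E) * exp (measure \<mu> E))"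
  proof -
    have "prob (?A k) = exp (- measure \<mu> E) * (measure \<mu> E ^ k /\<^sub>R fact k)" for k
      unfolding pt_count_law[OF E] by (simp add: divide_inverse)
    then show ?thesis by (simp only:) (rule sums_mult[OF exp_converges])
  qed
  ultimately have "prob (\<Union>k. ?A k) = exp (- measure \<mu> E) * exp (measure \<mu> E)"
    by (rule sums_unique2)
  also have "\<dots> = 1" by (simp add: exp_minus)
  finally have "prob (\<Union>k. ?A k) = 1" .
  then have "AE \<omega> in M. \<omega> \<in> (\<Union>k. ?A k)" by (rule AE_prob_1)
  then show ?thesis
  proof eventually_elim
    case (elim \<omega>)
    then have "pt_count \<Xi> E \<omega> \<noteq> \<infinity>" by auto
    then show ?case unfolding pt_count_def
      by (metis emeasure_count_space_infinite subset_UNIV infinity_ennreal_def)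
  qed
qed

lemma AE_no_points:
  assumes E: "E \<in> sets \<mu>" "emeasure \<mu> E = 0"
  shows "AE \<omega> in M. \<Xi> \<omega> \<inter> E = {}"
proof -
  note E(1)[measurable]
  have "prob {\<omega> \<in> space M. pt_count \<Xi> E \<omega> = of_nat 0} = 1"
    using E by (subst pt_count_law) (auto simp: measure_def)
  then have "AE \<omega> in M. \<omega> \<in> {\<omega> \<in> space M. pt_count \<Xi> E \<omega> = of_nat 0}" by (rule AE_prob_1)
  then show ?thesis
    by eventually_elim (simp add: pt_count_def emeasure_count_space_eq_0)
qed

lemma AE_finite_supp:
  assumes "fin_supp \<mu> \<phi>"
  shows "AE \<omega> in M. \<omega> \<in> space M \<and> finite {p \<in> \<Xi> \<omega>. \<phi> p \<noteq> 0}"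
proof -
  have [measurable]: "\<phi> \<in> borel_measurable \<mu>" using assms(1) by (simp add: fin_supp_def)
  have "AE \<omega> in M. finite (\<Xi> \<omega> \<inter> {p \<in> space \<mu>. \<phi> p \<noteq> 0})"
    using assms by (intro AE_finite_points) (auto simp: fin_supp_def)
  with AE_space show ?thesis
  proof eventually_elim
    case (elim \<omega>)
    moreover have "{p \<in> \<Xi> \<omega>. \<phi> p \<noteq> 0} = \<Xi> \<omega> \<inter> {p \<in> space \<mu>. \<phi> p \<noteq> 0}"
      using Xi_subset elim by auto
    ultimately show ?case by simp
  qed
qed

text \<open>The finite set comes from \<open>\<phi>\<close> while the summand is
  \<open>\<psi>\<close>: one set then serves for a function together with its approximants or its
  restrictions.\<close>

lemma psum_eq_sum:
  assumes "finite {p \<in> \<Xi> \<omega>. \<phi> p \<noteq> 0}" "\<And>p. p \<in> \<Xi> \<omega> \<Longrightarrow> \<phi> p = 0 \<Longrightarrow> \<psi> p = 0"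
  shows "psum \<Xi> \<psi> \<omega> = (\<Sum>p\<in>{p \<in> \<Xi> \<omega>. \<phi> p \<noteq> 0}. \<psi> p)"
proof -
  have "psum \<Xi> \<psi> \<omega> = infsum \<psi> {p \<in> \<Xi> \<omega>. \<phi> p \<noteq> 0}"
    unfolding psum_def using assms(2) by (intro infsum_cong_neutral) auto
  then show ?thesis using assms(1) by (simp add: infsum_finite)
qed

lemma psum_cmult: "psum \<Xi> (\<lambda>p. c * \<phi> p) \<omega> = c * psum \<Xi> \<phi> \<omega>"
  by (simp add: psum_def infsum_cmult_right')

lemma AE_psum_add:
  assumes "fin_supp \<mu> \<phi>" "fin_supp \<mu> \<psi>"
  shows "AE \<omega> in M. psum \<Xi> (\<lambda>p. \<phi> p + \<psi> p) \<omega> = psum \<Xi> \<phi> \<omega> + psum \<Xi> \<psi> \<omega>"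
  using AE_finite_supp[OF assms(1)] AE_finite_supp[OF assms(2)]
proof eventually_elim
  case (elim \<omega>)
  \<comment> \<open>The indicator of the union of both supports, so that all three sums run over one
    finite set.\<close>
  let ?\<chi> = "\<lambda>p. if \<phi> p = 0 \<and> \<psi> p = 0 then 0 else 1 :: real"
  have "finite {p \<in> \<Xi> \<omega>. ?\<chi> p \<noteq> 0}"
    by (rule finite_subset[of _ "{p \<in> \<Xi> \<omega>. \<phi> p \<noteq> 0} \<union> {p \<in> \<Xi> \<omega>. \<psi> p \<noteq> 0}"]) (use elim in auto)
  note eq = psum_eq_sum[OF this]
  show ?case
    by (subst (1 2 3) eq) (auto simp: sum.distrib split: if_splits)
qed

text \<open>The sum of \<open>s\<close> over the points, regrouped by values, because joint laws are
  known for counts of disjoint sets only. The value \<open>0\<close> is left out: its level set may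
  carry infinitely many points and may meet the level sets of another function of disjoint
  support.\<close>

definition count_combo :: "('b \<Rightarrow> real) \<Rightarrow> 'w \<Rightarrow> real" where
  "count_combo s \<omega> = (\<Sum>y\<in>s ` space \<mu> - {0}. y * enn2real (pt_count \<Xi> {p \<in> space \<mu>. s p = y} \<omega>))"

lemma measurable_count_combo:
  "simple_function \<mu> s \<Longrightarrow> count_combo s \<in> borel_measurable M"
  unfolding count_combo_def
  by (intro borel_measurable_sum borel_measurable_times borel_measurable_const
      measurable_compose[OF measurable_pt_count borel_measurable_enn2real[OF measurable_ident_sets[OF refl]]])
    (auto simp: simple_functionD intro: borel_measurable_simple_function)

lemma AE_psum_eq_count_combo:
  assumes s: "simple_function \<mu> s" and fin: "fin_supp \<mu> s"
  shows "AE \<omega> in M. psum \<Xi> s \<omega> = count_combo s \<omega>"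
  using AE_finite_supp[OF fin]
proof eventually_elim
  case (elim \<omega>)
  let ?P = "{p \<in> \<Xi> \<omega>. s p \<noteq> 0}"
  have "psum \<Xi> s \<omega> = (\<Sum>p\<in>?P. s p)" using elim by (intro psum_eq_sum) auto
  also have "\<dots> = (\<Sum>y\<in>s ` space \<mu> - {0}. \<Sum>p | p \<in> ?P \<and> s p = y. s p)"
    using elim s Xi_subset[of \<omega>] by (intro sum.group[symmetric]) (auto simp: simple_functionD)
  also have "\<dots> = count_combo s \<omega>"
    unfolding count_combo_def
  proof (rule sum.cong[OF refl])
    fix y assume y: "y \<in> s ` space \<mu> - {0}"
    have eq: "\<Xi> \<omega> \<inter> {p \<in> space \<mu>. s p = y} = {p \<in> ?P. s p = y}"
      using y elim Xi_subset[of \<omega>] by auto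
    have "pt_count \<Xi> {p \<in> space \<mu>. s p = y} \<omega> = of_nat (card {p \<in> ?P. s p = y})"
      unfolding pt_count_def eq using elim
      by (subst emeasure_count_space_finite) (auto intro: finite_subset[of _ ?P])
    then have "enn2real (pt_count \<Xi> {p \<in> space \<mu>. s p = y} \<omega>) = card {p \<in> ?P. s p = y}"
      by (simp add: ennreal_of_nat_eq_real_of_nat)
    then show "(\<Sum>p | p \<in> ?P \<and> s p = y. s p) = y * enn2real (pt_count \<Xi> {p \<in> space \<mu>. s p = y} \<omega>)"
      by simp
  qed
  finally show ?case .
qed

text \<open>The approximants vanish wherever \<open>\<phi>\<close> does. Hence the finitely many
  points charged by \<open>\<phi>\<close> suffice for all \<open>k\<close>, the sums converge term
  by term, and disjointness of supports survives the approximation.\<close>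

lemma count_combo_approx:
  assumes \<phi>: "fin_supp \<mu> \<phi>"
  shows "\<exists>s. (\<forall>k. simple_function \<mu> (s k)) \<and> (\<forall>k. fin_supp \<mu> (s k)) \<and>
    (\<forall>k. \<forall>p\<in>space \<mu>. \<phi> p = 0 \<longrightarrow> s k p = 0) \<and>
    (AE \<omega> in M. (\<lambda>k. count_combo (s k) \<omega>) \<longlonglongrightarrow> psum \<Xi> \<phi> \<omega>)"
proof -
  have \<phi>m: "\<phi> \<in> borel_measurable \<mu>" using \<phi> by (simp add: fin_supp_def)
  \<comment> \<open>The base point \<open>0\<close> turns the distance bound of the approximation
    theorem into the bound by \<open>2 * \<bar>\<phi> p\<bar>\<close>, which forces the supports to
    be nested.\<close>
  obtain s where s: "\<And>k. simple_function \<mu> (s k)" "\<And>p. p \<in> space \<mu> \<Longrightarrow> (\<lambda>k. s k p) \<longlonglongrightarrow> \<phi> p"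
    "\<And>k p. p \<in> space \<mu> \<Longrightarrow> \<bar>s k p\<bar> \<le> 2 * \<bar>\<phi> p\<bar>"
    using borel_measurable_implies_sequence_metric[OF \<phi>m, of 0]
    unfolding dist_real_def diff_0_right by metis
  have s0: "\<And>k p. p \<in> space \<mu> \<Longrightarrow> \<phi> p = 0 \<Longrightarrow> s k p = 0"
    using s(3) by force
  have fin: "fin_supp \<mu> (s k)" for k
    using \<phi> by (rule fin_supp_mono) (use s s0 in \<open>auto intro: borel_measurable_simple_function\<close>)
  have "AE \<omega> in M. \<forall>k. psum \<Xi> (s k) \<omega> = count_combo (s k) \<omega>"
    by (simp add: AE_all_countable AE_psum_eq_count_combo s(1) fin)
  with AE_finite_supp[OF \<phi>]
  have "AE \<omega> in M. (\<lambda>k. count_combo (s k) \<omega>) \<longlonglongrightarrow> psum \<Xi> \<phi> \<omega>"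
  proof eventually_elim
    case (elim \<omega>)
    note sub = Xi_subset[of \<omega>]
    have "(\<lambda>k. psum \<Xi> (s k) \<omega>) = (\<lambda>k. \<Sum>p\<in>{p \<in> \<Xi> \<omega>. \<phi> p \<noteq> 0}. s k p)"
      using elim sub s0 by (intro ext psum_eq_sum) auto
    moreover have "psum \<Xi> \<phi> \<omega> = (\<Sum>p\<in>{p \<in> \<Xi> \<omega>. \<phi> p \<noteq> 0}. \<phi> p)"
      using elim by (intro psum_eq_sum) auto
    moreover have "(\<lambda>k. \<Sum>p\<in>{p \<in> \<Xi> \<omega>. \<phi> p \<noteq> 0}. s k p) \<longlonglongrightarrow> (\<Sum>p\<in>{p \<in> \<Xi> \<omega>. \<phi> p \<noteq> 0}. \<phi> p)"
      using sub elim by (intro tendsto_sum s(2)) auto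
    ultimately show ?case using elim by simp
  qed
  then show ?thesis using s(1) s0 fin by (intro exI[of _ s]) auto
qed

lemma measurable_psum:
  assumes \<phi>: "fin_supp \<mu> \<phi>"
  shows "psum \<Xi> \<phi> \<in> borel_measurable M"
proof -
  obtain s where s: "\<And>k. simple_function \<mu> (s k)" "\<And>k. fin_supp \<mu> (s k)"
    "\<And>k p. p \<in> space \<mu> \<Longrightarrow> \<phi> p = 0 \<Longrightarrow> s k p = 0"
    "AE \<omega> in M. (\<lambda>k. count_combo (s k) \<omega>) \<longlonglongrightarrow> psum \<Xi> \<phi> \<omega>"
    using count_combo_approx[OF \<phi>] by (elim exE conjE, intro that) simp_all
  note [measurable] = measurable_count_combo[OF s(1)]
  have m: "(\<lambda>\<omega>. lim (\<lambda>k. count_combo (s k) \<omega>)) \<in> borel_measurable M"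
    by measurable
  show ?thesis
    using m by (rule borel_measurable_AE_cong) (use s(4) in \<open>auto elim!: eventually_mono simp: limI\<close>)
qed

text \<open>Independence of the counts is assumed along initial segments of the naturals; an
  enumeration of \<open>I\<close> transports it to any finite index set.\<close>

lemma expectation_cis_counts:
  assumes I: "finite I" and E: "\<And>i. i \<in> I \<Longrightarrow> E i \<in> sets \<mu>" and disj: "disjoint_family_on E I"
  shows "(\<integral>\<omega>. (\<Prod>i\<in>I. cis (y i * enn2real (pt_count \<Xi> (E i) \<omega>))) \<partial>M)
    = (\<Prod>i\<in>I. \<integral>\<omega>. cis (y i * enn2real (pt_count \<Xi> (E i) \<omega>)) \<partial>M)"
proof -
  obtain h where h: "bij_betw h {..<card I} I"
    using ex_bij_betw_nat_finite[OF I] by (auto simp: atLeast0LessThan)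
  let ?X = "\<lambda>i \<omega>. cis (y i * enn2real (pt_count \<Xi> (E i) \<omega>))"
  have "disjoint_family_on (\<lambda>i. E (h i)) {..<card I}"
    using disj h unfolding disjoint_family_on_def bij_betw_def inj_on_def by blast
  moreover have "\<forall>i<card I. E (h i) \<in> sets \<mu>" using E h by (auto simp: bij_betw_def)
  ultimately have "indep_vars (\<lambda>_. borel) (\<lambda>i. pt_count \<Xi> (E (h i))) {..<card I}"
    using poisson by (auto simp: poisson_random_set_def)
  then have "indep_vars (\<lambda>_. borel) (\<lambda>i. (\<lambda>x. cis (y (h i) * enn2real x)) \<circ> pt_count \<Xi> (E (h i))) {..<card I}"
    by (rule indep_vars_compose) auto
  then have ind: "indep_vars (\<lambda>_. borel) (\<lambda>i. ?X (h i)) {..<card I}"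
    by (simp add: comp_def)
  have "integrable M (?X (h i))" if "i < card I" for i
  proof -
    have [measurable]: "pt_count \<Xi> (E (h i)) \<in> borel_measurable M"
      using that E h by (intro measurable_pt_count) (auto simp: bij_betw_def)
    show ?thesis by (intro integrable_const_bound[where B=1]) auto
  qed
  then have "(\<integral>\<omega>. (\<Prod>i<card I. ?X (h i) \<omega>) \<partial>M) = (\<Prod>i<card I. \<integral>\<omega>. ?X (h i) \<omega> \<partial>M)"
    using ind by (intro indep_vars_lebesgue_integral) auto
  moreover have "(\<Prod>i<card I. ?X (h i) \<omega>) = (\<Prod>i\<in>I. ?X i \<omega>)" for \<omega>
    by (rule prod.reindex_bij_betw[OF h])
  moreover have "(\<Prod>i<card I. \<integral>\<omega>. ?X (h i) \<omega> \<partial>M) = (\<Prod>i\<in>I. \<integral>\<omega>. ?X i \<omega> \<partial>M)"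
    by (rule prod.reindex_bij_betw[OF h])
  ultimately show ?thesis by simp
qed

text \<open>The level sets of both functions at non-zero values form a single disjoint family, over
  which the counts are independent. An infinite count is turned into \<open>0\<close> by
  \<open>enn2real\<close>, which keeps every factor defined.\<close>

lemma count_combo_indep:
  assumes s: "simple_function \<mu> s" and s': "simple_function \<mu> s'"
    and disj: "\<And>p. p \<in> space \<mu> \<Longrightarrow> s p = 0 \<or> s' p = 0"
  shows "(\<integral>\<omega>. cis (count_combo s \<omega>) * cis (count_combo s' \<omega>) \<partial>M)
    = (\<integral>\<omega>. cis (count_combo s \<omega>) \<partial>M) * (\<integral>\<omega>. cis (count_combo s' \<omega>) \<partial>M)"
proof -
  let ?I = "s ` space \<mu> - {0}" and ?I' = "s' ` space \<mu> - {0}"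
  let ?J = "Inl ` ?I" and ?J' = "Inr ` ?I'"
  \<comment> \<open>The sum type keeps a value attained by both functions as two separate
    indices.\<close>
  define E where "E i = (case i of Inl y \<Rightarrow> {p \<in> space \<mu>. s p = y} | Inr y \<Rightarrow> {p \<in> space \<mu>. s' p = y})" for i
  define y :: "real + real \<Rightarrow> real" where "y i = (case i of Inl y \<Rightarrow> y | Inr y \<Rightarrow> y)" for i
  let ?X = "\<lambda>i \<omega>. cis (y i * enn2real (pt_count \<Xi> (E i) \<omega>))"
  have [measurable]: "s \<in> borel_measurable \<mu>" "s' \<in> borel_measurable \<mu>"
    using s s' by (auto intro: borel_measurable_simple_function)
  have fin: "finite ?J" "finite ?J'" using s s' by (auto simp: simple_functionD)
  have E: "E i \<in> sets \<mu>" for i unfolding E_def by (cases i) auto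
  have disjE: "disjoint_family_on E (?J \<union> ?J')"
    unfolding disjoint_family_on_def E_def using disj by (fastforce split: sum.splits)
  have 1: "cis (count_combo s \<omega>) = (\<Prod>i\<in>?J. ?X i \<omega>)" for \<omega>
    unfolding count_combo_def using s
    by (subst cis_sum) (auto simp: simple_functionD prod.reindex y_def E_def)
  have 2: "cis (count_combo s' \<omega>) = (\<Prod>i\<in>?J'. ?X i \<omega>)" for \<omega>
    unfolding count_combo_def using s'
    by (subst cis_sum) (auto simp: simple_functionD prod.reindex y_def E_def)
  have "(\<integral>\<omega>. cis (count_combo s \<omega>) * cis (count_combo s' \<omega>) \<partial>M) = (\<integral>\<omega>. (\<Prod>i\<in>?J \<union> ?J'. ?X i \<omega>) \<partial>M)"
    unfolding 1 2 using fin by (subst prod.union_disjoint) auto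
  also have "\<dots> = (\<Prod>i\<in>?J \<union> ?J'. \<integral>\<omega>. ?X i \<omega> \<partial>M)"
    using fin disjE E by (intro expectation_cis_counts) auto
  also have "\<dots> = (\<Prod>i\<in>?J. \<integral>\<omega>. ?X i \<omega> \<partial>M) * (\<Prod>i\<in>?J'. \<integral>\<omega>. ?X i \<omega> \<partial>M)"
    using fin by (intro prod.union_disjoint) auto
  also have "(\<Prod>i\<in>?J. \<integral>\<omega>. ?X i \<omega> \<partial>M) = (\<integral>\<omega>. (\<Prod>i\<in>?J. ?X i \<omega>) \<partial>M)"
    using fin E by (intro expectation_cis_counts[symmetric] disjoint_family_on_mono[OF _ disjE]) auto
  also have "(\<Prod>i\<in>?J'. \<integral>\<omega>. ?X i \<omega> \<partial>M) = (\<integral>\<omega>. (\<Prod>i\<in>?J'. ?X i \<omega>) \<partial>M)"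
    using fin E by (intro expectation_cis_counts[symmetric] disjoint_family_on_mono[OF _ disjE]) auto
  finally show ?thesis unfolding 1 2 .
qed

lemma psum_indep:
  assumes \<phi>: "fin_supp \<mu> \<phi>" and \<psi>: "fin_supp \<mu> \<psi>"
    and disj: "\<And>p. p \<in> space \<mu> \<Longrightarrow> \<phi> p = 0 \<or> \<psi> p = 0"
  shows "(\<integral>\<omega>. cis (psum \<Xi> \<phi> \<omega>) * cis (psum \<Xi> \<psi> \<omega>) \<partial>M)
    = (\<integral>\<omega>. cis (psum \<Xi> \<phi> \<omega>) \<partial>M) * (\<integral>\<omega>. cis (psum \<Xi> \<psi> \<omega>) \<partial>M)"
proof -
  obtain s where s: "\<And>k. simple_function \<mu> (s k)" "\<And>k. fin_supp \<mu> (s k)"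
    "\<And>k p. p \<in> space \<mu> \<Longrightarrow> \<phi> p = 0 \<Longrightarrow> s k p = 0"
    "AE \<omega> in M. (\<lambda>k. count_combo (s k) \<omega>) \<longlonglongrightarrow> psum \<Xi> \<phi> \<omega>"
    using count_combo_approx[OF \<phi>] by (elim exE conjE, intro that) simp_all
  obtain s' where s': "\<And>k. simple_function \<mu> (s' k)" "\<And>k. fin_supp \<mu> (s' k)"
    "\<And>k p. p \<in> space \<mu> \<Longrightarrow> \<psi> p = 0 \<Longrightarrow> s' k p = 0"
    "AE \<omega> in M. (\<lambda>k. count_combo (s' k) \<omega>) \<longlonglongrightarrow> psum \<Xi> \<psi> \<omega>"
    using count_combo_approx[OF \<psi>] by (elim exE conjE, intro that) simp_all
  note [measurable] = measurable_count_combo[OF s(1)] measurable_count_combo[OF s'(1)]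
    measurable_psum[OF \<phi>] measurable_psum[OF \<psi>]
  have "AE \<omega> in M. (\<lambda>k. cis (count_combo (s k) \<omega>) * cis (count_combo (s' k) \<omega>))
      \<longlonglongrightarrow> cis (psum \<Xi> \<phi> \<omega>) * cis (psum \<Xi> \<psi> \<omega>)"
    using s(4) s'(4) by eventually_elim (intro tendsto_intros)
  then have "(\<lambda>k. \<integral>\<omega>. cis (count_combo (s k) \<omega>) * cis (count_combo (s' k) \<omega>) \<partial>M)
      \<longlonglongrightarrow> (\<integral>\<omega>. cis (psum \<Xi> \<phi> \<omega>) * cis (psum \<Xi> \<psi> \<omega>) \<partial>M)"
    by (intro expectation_bounded_tendsto[where c=1]) (auto simp: norm_mult)
  moreover have "(\<lambda>k. \<integral>\<omega>. cis (count_combo (s k) \<omega>) * cis (count_combo (s' k) \<omega>) \<partial>M)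
      \<longlonglongrightarrow> (\<integral>\<omega>. cis (psum \<Xi> \<phi> \<omega>) \<partial>M) * (\<integral>\<omega>. cis (psum \<Xi> \<psi> \<omega>) \<partial>M)"
  proof -
    have "(\<integral>\<omega>. cis (count_combo (s k) \<omega>) * cis (count_combo (s' k) \<omega>) \<partial>M)
      = (\<integral>\<omega>. cis (count_combo (s k) \<omega>) \<partial>M) * (\<integral>\<omega>. cis (count_combo (s' k) \<omega>) \<partial>M)" for k
      using disj s(3) s'(3) by (intro count_combo_indep s(1) s'(1)) blast
    then show ?thesis using s(4) s'(4)
      by (simp only:) (intro tendsto_mult expectation_cis_tendsto, auto)
  qed
  ultimately show ?thesis by (rule LIMSEQ_unique)
qed

end

section \<open>Wiener integrals\<close>

definition sq_integrable :: "'b measure \<Rightarrow> ('b \<Rightarrow> real) \<Rightarrow> bool" where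
  "sq_integrable \<mu> h \<longleftrightarrow> h \<in> borel_measurable \<mu> \<and> integrable \<mu> (\<lambda>t. (h t)\<^sup>2)"

lemma sq_integrable_mult:
  assumes "sq_integrable \<mu> g" "sq_integrable \<mu> h"
  shows "integrable \<mu> (\<lambda>t. g t * h t)"
proof (rule Bochner_Integration.integrable_bound)
  show "integrable \<mu> (\<lambda>t. (g t)\<^sup>2 + (h t)\<^sup>2)"
    using assms by (auto simp: sq_integrable_def)
  show "(\<lambda>t. g t * h t) \<in> borel_measurable \<mu>"
    using assms by (auto simp: sq_integrable_def)
  have "\<bar>x * y\<bar> \<le> x\<^sup>2 + y\<^sup>2" for x y :: real
  proof -
    have "2 * (\<bar>x\<bar> * \<bar>y\<bar>) \<le> x\<^sup>2 + y\<^sup>2" "0 \<le> \<bar>x\<bar> * \<bar>y\<bar>"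
      using sum_squares_bound[of "\<bar>x\<bar>" "\<bar>y\<bar>"] by simp_all
    then show ?thesis unfolding abs_mult by linarith
  qed
  then show "AE t in \<mu>. norm (g t * h t) \<le> norm ((g t)\<^sup>2 + (h t)\<^sup>2)" by simp
qed

lemma sq_integrable_add:
  assumes "sq_integrable \<mu> g" "sq_integrable \<mu> h"
  shows "sq_integrable \<mu> (\<lambda>t. g t + h t)"
proof -
  have "(g t + h t)\<^sup>2 = (g t)\<^sup>2 + (h t)\<^sup>2 + 2 * (g t * h t)" for t by (simp add: power2_sum)
  then show ?thesis
    using assms sq_integrable_mult[OF assms] by (auto simp: sq_integrable_def)
qed

lemma sq_integrable_cmult: "sq_integrable \<mu> h \<Longrightarrow> sq_integrable \<mu> (\<lambda>t. c * h t)"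
  by (auto simp: sq_integrable_def power_mult_distrib)

lemma sq_integrable_diff:
  assumes "sq_integrable \<mu> g" "sq_integrable \<mu> h"
  shows "sq_integrable \<mu> (\<lambda>t. g t - h t)"
  using sq_integrable_add[OF assms(1) sq_integrable_cmult[OF assms(2), of "-1"]] by simp

lemma sq_integrable_sum:
  "finite I \<Longrightarrow> (\<And>i. i \<in> I \<Longrightarrow> sq_integrable \<mu> (h i)) \<Longrightarrow> sq_integrable \<mu> (\<lambda>t. \<Sum>i\<in>I. h i t)"
  by (induction I rule: finite_induct) (auto intro: sq_integrable_add simp: sq_integrable_def[of _ "\<lambda>_. 0"])

lemma sq_integrable_indicator_mult:
  assumes h: "sq_integrable \<mu> h" and S: "S \<in> sets \<mu>"
  shows "sq_integrable \<mu> (\<lambda>t. h t * indicator S t)"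
proof -
  have "(h t * indicator S t)\<^sup>2 = (h t)\<^sup>2 * indicator S t" for t by (auto simp: indicator_def)
  then show ?thesis
    using h S by (auto simp: sq_integrable_def intro!: integrable_real_mult_indicator)
qed

lemma integral_sq_add_le:
  assumes g: "sq_integrable \<mu> g" and h: "sq_integrable \<mu> h"
  shows "(\<integral>t. (g t + h t)\<^sup>2 \<partial>\<mu>) \<le> 2 * (\<integral>t. (g t)\<^sup>2 \<partial>\<mu>) + 2 * (\<integral>t. (h t)\<^sup>2 \<partial>\<mu>)"
proof -
  have "(\<integral>t. (g t + h t)\<^sup>2 \<partial>\<mu>) \<le> (\<integral>t. 2 * (g t)\<^sup>2 + 2 * (h t)\<^sup>2 \<partial>\<mu>)"
  proof (rule integral_mono)
    show "integrable \<mu> (\<lambda>t. (g t + h t)\<^sup>2)" using sq_integrable_add[OF g h] by (simp add: sq_integrable_def)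
    show "integrable \<mu> (\<lambda>t. 2 * (g t)\<^sup>2 + 2 * (h t)\<^sup>2)" using g h by (auto simp: sq_integrable_def)
    show "(g t + h t)\<^sup>2 \<le> 2 * (g t)\<^sup>2 + 2 * (h t)\<^sup>2" for t
      using sum_squares_bound[of "g t" "h t"] by (simp add: power2_sum)
  qed
  then show ?thesis using g h by (simp add: sq_integrable_def)
qed

lemma integral_sq_triangle:
  assumes "sq_integrable \<mu> f" "sq_integrable \<mu> g" "sq_integrable \<mu> h"
  shows "(\<integral>t. (f t - h t)\<^sup>2 \<partial>\<mu>) \<le> 2 * (\<integral>t. (f t - g t)\<^sup>2 \<partial>\<mu>) + 2 * (\<integral>t. (g t - h t)\<^sup>2 \<partial>\<mu>)"
  using integral_sq_add_le[OF sq_integrable_diff[OF assms(1,2)] sq_integrable_diff[OF assms(2,3)]]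
  by simp

text \<open>The cross term is split by Young's inequality with a free weight
  \<open>\<delta>\<close>: the factor of the vanishing distance may be large, while the part
  proportional to the norm of \<open>h\<close> is made small by the choice of
  \<open>\<delta>\<close>.\<close>

lemma L2_norm_tendsto:
  assumes h: "sq_integrable \<mu> h" and g: "\<And>n. sq_integrable \<mu> (g n)"
    and lim: "(\<lambda>n. \<integral>t. (h t - g n t)\<^sup>2 \<partial>\<mu>) \<longlonglongrightarrow> 0"
  shows "(\<lambda>n. \<integral>t. (g n t)\<^sup>2 \<partial>\<mu>) \<longlonglongrightarrow> (\<integral>t. (h t)\<^sup>2 \<partial>\<mu>)"
proof -
  let ?H = "\<integral>t. (h t)\<^sup>2 \<partial>\<mu>" and ?D = "\<lambda>n. \<integral>t. (h t - g n t)\<^sup>2 \<partial>\<mu>"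
  have ih: "integrable \<mu> (\<lambda>t. (h t)\<^sup>2)" and ig: "integrable \<mu> (\<lambda>t. (g n t)\<^sup>2)"
    and id: "integrable \<mu> (\<lambda>t. (h t - g n t)\<^sup>2)" for n
    using h g[of n] sq_integrable_diff[OF h g[of n]] by (simp_all add: sq_integrable_def)
  have key: "\<bar>(\<integral>t. (g n t)\<^sup>2 \<partial>\<mu>) - ?H\<bar> \<le> (1 + 1 / \<delta>) * ?D n + \<delta> * ?H" if \<delta>: "0 < \<delta>" for \<delta> n
  proof -
    have pt: "\<bar>x\<^sup>2 - y\<^sup>2\<bar> \<le> (1 + 1 / \<delta>) * (y - x)\<^sup>2 + \<delta> * y\<^sup>2" for x y :: real
    proof -
      define z where "z = y - x"
      have "2 * (z / sqrt \<delta>) * (sqrt \<delta> * y) \<le> (z / sqrt \<delta>)\<^sup>2 + (sqrt \<delta> * y)\<^sup>2"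
        "2 * (- z / sqrt \<delta>) * (sqrt \<delta> * y) \<le> (- z / sqrt \<delta>)\<^sup>2 + (sqrt \<delta> * y)\<^sup>2"
        by (rule sum_squares_bound)+
      then have "2 * z * y \<le> z\<^sup>2 / \<delta> + \<delta> * y\<^sup>2" "- (2 * z * y) \<le> z\<^sup>2 / \<delta> + \<delta> * y\<^sup>2"
        using \<delta> by (simp_all add: power_divide power_mult_distrib)
      moreover have "x\<^sup>2 - y\<^sup>2 = z\<^sup>2 - 2 * z * y"
        by (simp add: z_def power2_eq_square algebra_simps)
      moreover have "(1 + 1 / \<delta>) * z\<^sup>2 = z\<^sup>2 + z\<^sup>2 / \<delta>" by (simp add: distrib_right)
      moreover have "0 \<le> z\<^sup>2" by simp
      ultimately show ?thesis
        unfolding z_def[symmetric] abs_le_iff by linarith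
    qed
    have "\<bar>(\<integral>t. (g n t)\<^sup>2 \<partial>\<mu>) - ?H\<bar> = \<bar>\<integral>t. (g n t)\<^sup>2 - (h t)\<^sup>2 \<partial>\<mu>\<bar>"
      using ih ig by simp
    also have "\<dots> \<le> (\<integral>t. \<bar>(g n t)\<^sup>2 - (h t)\<^sup>2\<bar> \<partial>\<mu>)" by (rule integral_abs_bound)
    also have "\<dots> \<le> (\<integral>t. (1 + 1 / \<delta>) * (h t - g n t)\<^sup>2 + \<delta> * (h t)\<^sup>2 \<partial>\<mu>)"
      using ih ig[of n] id[of n] pt by (intro integral_mono) auto
    also have "\<dots> = (1 + 1 / \<delta>) * ?D n + \<delta> * ?H"
      using ih id[of n] by simp
    finally show ?thesis .
  qed
  show ?thesis
  proof (rule LIMSEQ_I)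
    fix r :: real assume r: "0 < r"
    have H0: "0 \<le> ?H" by simp
    \<comment> \<open>Half of \<open>r\<close> is spent on the norm term; the \<open>+ 1\<close>
      covers the case \<open>?H = 0\<close>.\<close>
    define \<delta> where "\<delta> = r / (2 * (?H + 1))"
    have \<delta>: "0 < \<delta>" "\<delta> * ?H < r / 2"
      using r H0 by (auto simp: \<delta>_def field_simps add_pos_nonneg intro!: divide_pos_pos)
    have "(\<lambda>n. (1 + 1 / \<delta>) * ?D n) \<longlonglongrightarrow> (1 + 1 / \<delta>) * 0"
      by (intro tendsto_intros lim)
    then have "\<forall>\<^sub>F n in sequentially. (1 + 1 / \<delta>) * ?D n < r / 2"
      using r by (intro order_tendstoD(2)[of _ 0]) auto
    then obtain N where N: "\<And>n. n \<ge> N \<Longrightarrow> (1 + 1 / \<delta>) * ?D n < r / 2"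
      unfolding eventually_sequentially by blast
    have "norm ((\<integral>t. (g n t)\<^sup>2 \<partial>\<mu>) - ?H) < r" if "n \<ge> N" for n
    proof -
      have "\<bar>(\<integral>t. (g n t)\<^sup>2 \<partial>\<mu>) - ?H\<bar> \<le> (1 + 1 / \<delta>) * ?D n + \<delta> * ?H" by (rule key[OF \<delta>(1)])
      also have "\<dots> < r / 2 + r / 2" using N[OF that] \<delta>(2) by (rule add_strict_mono)
      finally show ?thesis by simp
    qed
    then show "\<exists>no. \<forall>n\<ge>no. norm ((\<integral>t. (g n t)\<^sup>2 \<partial>\<mu>) - ?H) < r" by blast
  qed
qed

text \<open>Convergence to \<open>0\<close> of extended-valued integrals makes one of them finite,
  and then \<open>h\<close> is the sum of the square-integrable functions \<open>h - g n\<close> and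
  \<open>g n\<close>.\<close>

lemma L2_limit_of_nn_integral:
  assumes [measurable]: "h \<in> borel_measurable \<mu>" and g: "\<And>n. sq_integrable \<mu> (g n)"
    and lim: "(\<lambda>n. \<integral>\<^sup>+t. ennreal ((h t - g n t)\<^sup>2) \<partial>\<mu>) \<longlonglongrightarrow> 0"
  shows "sq_integrable \<mu> h" "(\<lambda>n. \<integral>t. (h t - g n t)\<^sup>2 \<partial>\<mu>) \<longlonglongrightarrow> 0"
proof -
  have gm[measurable]: "g n \<in> borel_measurable \<mu>" for n using g by (simp add: sq_integrable_def)
  have "\<forall>\<^sub>F n in sequentially. (\<integral>\<^sup>+t. ennreal ((h t - g n t)\<^sup>2) \<partial>\<mu>) < \<infinity>"
    using lim by (rule order_tendstoD) simp
  then obtain n where "(\<integral>\<^sup>+t. ennreal ((h t - g n t)\<^sup>2) \<partial>\<mu>) < \<infinity>"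
    by (auto simp: eventually_sequentially)
  then have "sq_integrable \<mu> (\<lambda>t. h t - g n t)"
    by (auto simp: sq_integrable_def integrable_iff_bounded)
  from sq_integrable_add[OF this g[of n]] show h: "sq_integrable \<mu> h" by simp
  have "(\<integral>\<^sup>+t. ennreal ((h t - g n t)\<^sup>2) \<partial>\<mu>) = ennreal (\<integral>t. (h t - g n t)\<^sup>2 \<partial>\<mu>)" for n
    using sq_integrable_diff[OF h g[of n]]
    by (intro nn_integral_eq_integral) (auto simp: sq_integrable_def)
  with lim show "(\<lambda>n. \<integral>t. (h t - g n t)\<^sup>2 \<partial>\<mu>) \<longlonglongrightarrow> 0"
    by (simp add: ennreal_tendsto_0_iff)
qed

lemma (in prob_space) expectation_abs_le:
  assumes "sq_integrable M X"
  shows "(\<integral>\<omega>. \<bar>X \<omega>\<bar> \<partial>M) \<le> sqrt (\<integral>\<omega>. (X \<omega>)\<^sup>2 \<partial>M)"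
proof -
  have [measurable]: "X \<in> borel_measurable M" and i2: "integrable M (\<lambda>\<omega>. (X \<omega>)\<^sup>2)"
    using assms by (auto simp: sq_integrable_def)
  have i1: "integrable M (\<lambda>\<omega>. \<bar>X \<omega>\<bar>)"
    by (rule square_integrable_imp_integrable) (use i2 in auto)
  have "0 \<le> variance (\<lambda>\<omega>. \<bar>X \<omega>\<bar>)" by (rule variance_positive)
  also have "\<dots> = (\<integral>\<omega>. (X \<omega>)\<^sup>2 \<partial>M) - (\<integral>\<omega>. \<bar>X \<omega>\<bar> \<partial>M)\<^sup>2"
    using i1 i2 by (subst variance_eq) auto
  finally show ?thesis by (intro real_le_rsqrt) simp
qed

text \<open>Writing the characteristic function through the second moment covers degenerate and
  non-degenerate laws by one formula, and this formula is stable under L2 limits.\<close>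

lemma (in prob_space) centered_gaussian_facts:
  assumes "centered_gaussian M Z"
  shows centered_gaussian_sq_integrable: "sq_integrable M Z"
    and centered_gaussian_cis: "(\<integral>\<omega>. cis (Z \<omega>) \<partial>M) = of_real (exp (- (\<integral>\<omega>. (Z \<omega>)\<^sup>2 \<partial>M) / 2))"
proof -
  have Z[measurable]: "Z \<in> borel_measurable M" using assms by (simp add: centered_gaussian_def)
  have "sq_integrable M Z \<and> (\<integral>\<omega>. cis (Z \<omega>) \<partial>M) = of_real (exp (- (\<integral>\<omega>. (Z \<omega>)\<^sup>2 \<partial>M) / 2))"
  proof (cases "AE \<omega> in M. Z \<omega> = 0")
    case True
    have "AE \<omega> in M. (Z \<omega>)\<^sup>2 = 0" "AE \<omega> in M. cis (Z \<omega>) = 1"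
      using True by (auto elim!: eventually_mono)
    then have "(\<integral>\<omega>. (Z \<omega>)\<^sup>2 \<partial>M) = (\<integral>\<omega>. 0 \<partial>M)" "(\<integral>\<omega>. cis (Z \<omega>) \<partial>M) = (\<integral>\<omega>. 1 \<partial>M)"
      by (intro integral_cong_AE; simp)+
    moreover have "integrable M (\<lambda>\<omega>. (Z \<omega>)\<^sup>2)"
      using \<open>AE \<omega> in M. (Z \<omega>)\<^sup>2 = 0\<close> by (subst integrable_cong_AE[of _ _ "\<lambda>_. 0"]) auto
    ultimately show ?thesis by (simp add: sq_integrable_def prob_space)
  next
    case False
    then obtain s where s: "0 < s" and D: "distributed M lborel Z (normal_density 0 s)"
      using assms by (auto simp: centered_gaussian_def)
    have "integrable lborel (\<lambda>x. normal_density 0 s x * x\<^sup>2)"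
      using integrable_normal_moment[OF s, of 0 2] by simp
    then have i2: "integrable M (\<lambda>\<omega>. (Z \<omega>)\<^sup>2)"
      using distributed_integrable[OF D, of "\<lambda>x. x\<^sup>2"] by simp
    have v: "(\<integral>\<omega>. (Z \<omega>)\<^sup>2 \<partial>M) = s\<^sup>2"
      using normal_distributed_variance[OF s D] normal_distributed_expectation[OF s D] by simp
    \<comment> \<open>The characteristic function is known for the standard normal law, so
      \<open>Z\<close> is divided by \<open>s\<close> and the frequency \<open>s\<close> is
      used.\<close>
    have "distributed M lborel (\<lambda>\<omega>. Z \<omega> / s) std_normal_density"
      using normal_standard_normal_convert[OF s, of Z 0] D by simp
    then have "distr M lborel (\<lambda>\<omega>. Z \<omega> / s) = density lborel std_normal_density"
      by (rule distributed_distr_eq_density)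
    then have "char (distr M lborel (\<lambda>\<omega>. Z \<omega> / s)) s = of_real (exp (- s\<^sup>2 / 2))"
      by (simp add: char_std_normal_distribution)
    moreover have "char (distr M lborel (\<lambda>\<omega>. Z \<omega> / s)) s = (\<integral>\<omega>. cis (Z \<omega>) \<partial>M)"
      using s by (simp add: char_def integral_distr cis_conv_exp)
    ultimately show ?thesis using i2 v by (simp add: sq_integrable_def)
  qed
  then show "sq_integrable M Z" "(\<integral>\<omega>. cis (Z \<omega>) \<partial>M) = of_real (exp (- (\<integral>\<omega>. (Z \<omega>)\<^sup>2 \<partial>M) / 2))"
    by auto
qed

section \<open>Isometry between step functions and Gaussian combinations\<close>

locale brownian = prob_space M for M :: "'w measure" +
  fixes \<A> :: "'a set set" and m :: "'a measure" and B :: "'a set \<Rightarrow> 'w \<Rightarrow> real"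
  assumes brownian: "set_indexed_brownian M \<A> m B"
    and Int_closed: "\<And>A A'. A \<in> \<A> \<Longrightarrow> A' \<in> \<A> \<Longrightarrow> A \<inter> A' \<in> \<A>"
    and sub_space: "\<A> \<subseteq> Pow (space m)"
    and sets_m: "sets m = sigma_sets (space m) \<A>"
    and finite_m: "\<And>A. A \<in> \<A> \<Longrightarrow> emeasure m A < \<infinity>"
begin

lemma sets_A [measurable, simp]: "A \<in> \<A> \<Longrightarrow> A \<in> sets m"
  by (simp add: sets_m)

text \<open>A relation and not a function of \<open>g\<close>: the same step function may be written
  with different sets and coefficients, giving a priori different variables
  \<open>G\<close>.\<close>

definition elem :: "('a \<Rightarrow> real) \<Rightarrow> ('w \<Rightarrow> real) \<Rightarrow> bool" where
  "elem g G \<longleftrightarrow> (\<exists>F c. finite F \<and> F \<subseteq> \<A> \<and> g = (\<lambda>t. \<Sum>A\<in>F. c A * indicator A t) \<and>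
    G = (\<lambda>\<omega>. \<Sum>A\<in>F. c A * B A \<omega>))"

lemma elemI: "finite F \<Longrightarrow> F \<subseteq> \<A> \<Longrightarrow> elem (\<lambda>t. \<Sum>A\<in>F. c A * indicator A t) (\<lambda>\<omega>. \<Sum>A\<in>F. c A * B A \<omega>)"
  unfolding elem_def by blast

lemma elem_0: "elem (\<lambda>_. 0) (\<lambda>_. 0)"
  using elemI[of "{}"] by simp

lemma elem_indicator: "A \<in> \<A> \<Longrightarrow> elem (indicator A) (B A)"
  using elemI[of "{A}" "\<lambda>_. 1"] by simp

lemma elem_cmult:
  assumes "elem g G"
  shows "elem (\<lambda>t. c * g t) (\<lambda>\<omega>. c * G \<omega>)"
proof -
  obtain F b where "finite F" "F \<subseteq> \<A>" "g = (\<lambda>t. \<Sum>A\<in>F. b A * indicator A t)" "G = (\<lambda>\<omega>. \<Sum>A\<in>F. b A * B A \<omega>)"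
    using assms by (auto simp: elem_def)
  with elemI[of F "\<lambda>A. c * b A"] show ?thesis
    by (simp only: sum_distrib_left mult.assoc)
qed

lemma elem_add:
  assumes "elem g G" "elem g' G'"
  shows "elem (\<lambda>t. g t + g' t) (\<lambda>\<omega>. G \<omega> + G' \<omega>)"
proof -
  obtain F b where 1: "finite F" "F \<subseteq> \<A>" "g = (\<lambda>t. \<Sum>A\<in>F. b A * indicator A t)" "G = (\<lambda>\<omega>. \<Sum>A\<in>F. b A * B A \<omega>)"
    using assms by (auto simp: elem_def)
  obtain F' b' where 2: "finite F'" "F' \<subseteq> \<A>" "g' = (\<lambda>t. \<Sum>A\<in>F'. b' A * indicator A t)" "G' = (\<lambda>\<omega>. \<Sum>A\<in>F'. b' A * B A \<omega>)"
    using assms by (auto simp: elem_def)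
  \<comment> \<open>Both coefficient families are extended by \<open>0\<close>, so that a set common
    to \<open>F\<close> and \<open>F'\<close> receives the sum of its two coefficients.\<close>
  define c where "c A = (if A \<in> F then b A else 0) + (if A \<in> F' then b' A else 0)" for A
  have c: "(\<Sum>A\<in>F \<union> F'. c A * r A) = (\<Sum>A\<in>F. b A * r A) + (\<Sum>A\<in>F'. b' A * r A)" for r :: "'a set \<Rightarrow> real"
  proof -
    have "(\<Sum>A\<in>F \<union> F'. (if A \<in> F then b A else 0) * r A) = (\<Sum>A\<in>F. b A * r A)"
      using 1 2 by (intro sum.mono_neutral_cong_right) auto
    moreover have "(\<Sum>A\<in>F \<union> F'. (if A \<in> F' then b' A else 0) * r A) = (\<Sum>A\<in>F'. b' A * r A)"
      using 1 2 by (intro sum.mono_neutral_cong_right) auto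
    ultimately show ?thesis by (simp add: c_def distrib_right sum.distrib)
  qed
  have "elem (\<lambda>t. \<Sum>A\<in>F \<union> F'. c A * indicator A t) (\<lambda>\<omega>. \<Sum>A\<in>F \<union> F'. c A * B A \<omega>)"
    using 1 2 by (intro elemI) auto
  then show ?thesis unfolding c 1(3,4) 2(3,4) .
qed

lemma elem_diff:
  assumes "elem g G" "elem g' G'"
  shows "elem (\<lambda>t. g t - g' t) (\<lambda>\<omega>. G \<omega> - G' \<omega>)"
  using elem_add[OF assms(1) elem_cmult[OF assms(2), of "-1"]] by simp

lemma elem_gaussian: "elem g G \<Longrightarrow> centered_gaussian M G"
  using brownian by (auto simp: elem_def set_indexed_brownian_def centered_gaussian_process_def)

lemma sq_integrable_indicator: "A \<in> \<A> \<Longrightarrow> S \<in> sets m \<Longrightarrow> sq_integrable m (indicator (A \<inter> S))"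
proof -
  assume "A \<in> \<A>" "S \<in> sets m"
  then have "emeasure m (A \<inter> S) < \<infinity>"
    by (intro le_less_trans[OF emeasure_mono finite_m[of A]]) auto
  moreover have "(indicator (A \<inter> S) t)\<^sup>2 = (indicator (A \<inter> S) t :: real)" for t
    by (auto simp: indicator_def)
  ultimately show ?thesis
    using \<open>A \<in> \<A>\<close> \<open>S \<in> sets m\<close> by (simp add: sq_integrable_def less_top)
qed

text \<open>Both second moments are the same quadratic form in the coefficients, with matrix
  \<open>measure m (A \<inter> A')\<close>.\<close>

lemma elem_isometry:
  assumes "elem g G"
  shows "sq_integrable m g" "(\<integral>\<omega>. (G \<omega>)\<^sup>2 \<partial>M) = (\<integral>t. (g t)\<^sup>2 \<partial>m)"
proof -
  obtain F c where F: "finite F" "F \<subseteq> \<A>" and g: "g = (\<lambda>t. \<Sum>A\<in>F. c A * indicator A t)"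
    and G: "G = (\<lambda>\<omega>. \<Sum>A\<in>F. c A * B A \<omega>)"
    using assms by (auto simp: elem_def)
  have sqB: "sq_integrable M (B A)" if "A \<in> F" for A
    using that F by (intro centered_gaussian_sq_integrable elem_gaussian[OF elem_indicator]) auto
  have sqi: "sq_integrable m (indicator A)" if "A \<in> F" for A
    using sq_integrable_indicator[of A A] that F by auto
  show "sq_integrable m g"
    unfolding g using F sqi by (intro sq_integrable_sum sq_integrable_cmult) auto
  have "(\<integral>\<omega>. (G \<omega>)\<^sup>2 \<partial>M) = (\<integral>\<omega>. (\<Sum>A\<in>F. \<Sum>A'\<in>F. c A * c A' * (B A \<omega> * B A' \<omega>)) \<partial>M)"
    unfolding G by (simp add: power2_eq_square sum_product mult_ac)
  also have "\<dots> = (\<Sum>A\<in>F. \<Sum>A'\<in>F. c A * c A' * (\<integral>\<omega>. B A \<omega> * B A' \<omega> \<partial>M))"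
    using sqB by (simp add: Bochner_Integration.integral_sum Bochner_Integration.integrable_sum sq_integrable_mult)
  also have "\<dots> = (\<Sum>A\<in>F. \<Sum>A'\<in>F. c A * c A' * measure m (A \<inter> A'))"
    using brownian F by (intro sum.cong refl) (auto simp: set_indexed_brownian_def)
  also have "\<dots> = (\<Sum>A\<in>F. \<Sum>A'\<in>F. c A * c A' * (\<integral>t. indicator A t * indicator A' t \<partial>m))"
  proof (intro sum.cong refl)
    fix A A' assume A: "A \<in> F" "A' \<in> F"
    then have [measurable]: "A \<in> sets m" "A' \<in> sets m" using F by auto
    have "(\<integral>t. indicator A t * indicator A' t \<partial>m) = (\<integral>t. indicator (A \<inter> A') t \<partial>m :: real)"
      by (simp add: indicator_inter_arith)
    then show "c A * c A' * measure m (A \<inter> A') = c A * c A' * (\<integral>t. indicator A t * indicator A' t \<partial>m)"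
      by (simp add: inf.absorb1 sets.sets_into_space)
  qed
  also have "\<dots> = (\<integral>t. (\<Sum>A\<in>F. \<Sum>A'\<in>F. c A * c A' * (indicator A t * indicator A' t)) \<partial>m)"
    using sqi by (simp add: Bochner_Integration.integral_sum Bochner_Integration.integrable_sum sq_integrable_mult)
  also have "\<dots> = (\<integral>t. (g t)\<^sup>2 \<partial>m)"
    unfolding g by (simp add: power2_eq_square sum_product mult_ac)
  finally show "(\<integral>\<omega>. (G \<omega>)\<^sup>2 \<partial>M) = (\<integral>t. (g t)\<^sup>2 \<partial>m)" .
qed

lemma elem_sq_integrable: "elem g G \<Longrightarrow> sq_integrable M G"
  by (intro centered_gaussian_sq_integrable elem_gaussian)

lemma elem_measurable: "elem g G \<Longrightarrow> G \<in> borel_measurable M"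
  using elem_sq_integrable by (auto simp: sq_integrable_def)

lemma elem_cis: "elem g G \<Longrightarrow> (\<integral>\<omega>. cis (G \<omega>) \<partial>M) = of_real (exp (- (\<integral>t. (g t)\<^sup>2 \<partial>m) / 2))"
  using centered_gaussian_cis[OF elem_gaussian] elem_isometry(2) by simp

text \<open>The integrand is approximated in L2 but the variable almost surely, the mode in which
  exponentials pass to the limit under the expectation. An L2 limit satisfies the definition along a
  subsequence. As for \<open>elem\<close>, no particular version is singled out.\<close>

definition wiener :: "('a \<Rightarrow> real) \<Rightarrow> ('w \<Rightarrow> real) \<Rightarrow> bool" where
  "wiener h W \<longleftrightarrow> sq_integrable m h \<and> W \<in> borel_measurable M \<and>
    (\<exists>g G. (\<forall>n. elem (g n) (G n)) \<and> (\<lambda>n. \<integral>t. (h t - g n t)\<^sup>2 \<partial>m) \<longlonglongrightarrow> 0 \<and>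
      (AE \<omega> in M. (\<lambda>n :: nat. G n \<omega>) \<longlonglongrightarrow> W \<omega>))"

lemma wiener_0: "wiener (\<lambda>_. 0) (\<lambda>_. 0)"
  unfolding wiener_def using elem_0
  by (intro conjI exI[of _ "\<lambda>_ _. 0"]) (auto simp: sq_integrable_def)

lemma wiener_cmult:
  assumes "wiener h W"
  shows "wiener (\<lambda>t. c * h t) (\<lambda>\<omega>. c * W \<omega>)"
proof -
  obtain g G where *: "sq_integrable m h" "W \<in> borel_measurable M" "\<And>n. elem (g n) (G n)"
    "(\<lambda>n. \<integral>t. (h t - g n t)\<^sup>2 \<partial>m) \<longlonglongrightarrow> 0" "AE \<omega> in M. (\<lambda>n :: nat. G n \<omega>) \<longlonglongrightarrow> W \<omega>"
    using assms by (auto simp: wiener_def)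
  have "(\<lambda>n. \<integral>t. (c * h t - c * g n t)\<^sup>2 \<partial>m) = (\<lambda>n. c\<^sup>2 * (\<integral>t. (h t - g n t)\<^sup>2 \<partial>m))"
    by (simp add: right_diff_distrib[symmetric] power_mult_distrib)
  then have "(\<lambda>n. \<integral>t. (c * h t - c * g n t)\<^sup>2 \<partial>m) \<longlonglongrightarrow> 0"
    using tendsto_mult_right_zero[OF *(4)] by simp
  moreover have "AE \<omega> in M. (\<lambda>n. c * G n \<omega>) \<longlonglongrightarrow> c * W \<omega>"
    using *(5) by eventually_elim (intro tendsto_intros)
  ultimately show ?thesis unfolding wiener_def
    using * by (intro conjI exI[of _ "\<lambda>n t. c * g n t"] exI[of _ "\<lambda>n \<omega>. c * G n \<omega>"] allI elem_cmult sq_integrable_cmult) auto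
qed

lemma wiener_add:
  assumes "wiener h W" "wiener h' W'"
  shows "wiener (\<lambda>t. h t + h' t) (\<lambda>\<omega>. W \<omega> + W' \<omega>)"
proof -
  obtain g G where 1: "sq_integrable m h" "W \<in> borel_measurable M" "\<And>n. elem (g n) (G n)"
    "(\<lambda>n. \<integral>t. (h t - g n t)\<^sup>2 \<partial>m) \<longlonglongrightarrow> 0" "AE \<omega> in M. (\<lambda>n :: nat. G n \<omega>) \<longlonglongrightarrow> W \<omega>"
    using assms by (auto simp: wiener_def)
  obtain g' G' where 2: "sq_integrable m h'" "W' \<in> borel_measurable M" "\<And>n. elem (g' n) (G' n)"
    "(\<lambda>n. \<integral>t. (h' t - g' n t)\<^sup>2 \<partial>m) \<longlonglongrightarrow> 0" "AE \<omega> in M. (\<lambda>n :: nat. G' n \<omega>) \<longlonglongrightarrow> W' \<omega>"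
    using assms by (auto simp: wiener_def)
  have "(\<lambda>n. \<integral>t. (h t + h' t - (g n t + g' n t))\<^sup>2 \<partial>m) \<longlonglongrightarrow> 0"
  proof (rule tendsto_sandwich)
    show "\<forall>\<^sub>F n in sequentially. 0 \<le> (\<integral>t. (h t + h' t - (g n t + g' n t))\<^sup>2 \<partial>m)" by simp
    have "(\<integral>t. (h t + h' t - (g n t + g' n t))\<^sup>2 \<partial>m)
        \<le> 2 * (\<integral>t. (h t - g n t)\<^sup>2 \<partial>m) + 2 * (\<integral>t. (h' t - g' n t)\<^sup>2 \<partial>m)" for n
      using integral_sq_add_le[OF sq_integrable_diff[OF 1(1) elem_isometry(1)[OF 1(3)]]
          sq_integrable_diff[OF 2(1) elem_isometry(1)[OF 2(3)]], of n n]
      by (simp add: algebra_simps)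
    then show "\<forall>\<^sub>F n in sequentially. (\<integral>t. (h t + h' t - (g n t + g' n t))\<^sup>2 \<partial>m)
        \<le> 2 * (\<integral>t. (h t - g n t)\<^sup>2 \<partial>m) + 2 * (\<integral>t. (h' t - g' n t)\<^sup>2 \<partial>m)" by simp
    show "(\<lambda>n. 2 * (\<integral>t. (h t - g n t)\<^sup>2 \<partial>m) + 2 * (\<integral>t. (h' t - g' n t)\<^sup>2 \<partial>m)) \<longlonglongrightarrow> 0"
      using tendsto_add[OF tendsto_mult_right_zero[OF 1(4), of 2] tendsto_mult_right_zero[OF 2(4), of 2]]
      by simp
  qed auto
  moreover have "AE \<omega> in M. (\<lambda>n. G n \<omega> + G' n \<omega>) \<longlonglongrightarrow> W \<omega> + W' \<omega>"
    using 1(5) 2(5) by eventually_elim (intro tendsto_intros)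
  ultimately show ?thesis unfolding wiener_def
    using 1 2 by (intro conjI exI[of _ "\<lambda>n t. g n t + g' n t"] exI[of _ "\<lambda>n \<omega>. G n \<omega> + G' n \<omega>"] allI
        elem_add sq_integrable_add borel_measurable_add) auto
qed

lemma wiener_measurable: "wiener h W \<Longrightarrow> W \<in> borel_measurable M"
  by (simp add: wiener_def)

lemma wiener_sq_integrable: "wiener h W \<Longrightarrow> sq_integrable m h"
  by (simp add: wiener_def)

lemma wiener_cis:
  assumes "wiener h W"
  shows "(\<integral>\<omega>. cis (W \<omega>) \<partial>M) = of_real (exp (- (\<integral>t. (h t)\<^sup>2 \<partial>m) / 2))"
proof -
  obtain g G where *: "sq_integrable m h" "W \<in> borel_measurable M" "\<And>n. elem (g n) (G n)"
    "(\<lambda>n. \<integral>t. (h t - g n t)\<^sup>2 \<partial>m) \<longlonglongrightarrow> 0" "AE \<omega> in M. (\<lambda>n :: nat. G n \<omega>) \<longlonglongrightarrow> W \<omega>"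
    using assms by (auto simp: wiener_def)
  have "(\<lambda>n. \<integral>\<omega>. cis (G n \<omega>) \<partial>M) \<longlonglongrightarrow> (\<integral>\<omega>. cis (W \<omega>) \<partial>M)"
    using *(2,5) elem_measurable[OF *(3)] by (intro expectation_cis_tendsto)
  moreover have "(\<lambda>n. complex_of_real (exp (- (\<integral>t. (g n t)\<^sup>2 \<partial>m) / 2)))
      \<longlonglongrightarrow> of_real (exp (- (\<integral>t. (h t)\<^sup>2 \<partial>m) / 2))"
    by (intro tendsto_intros L2_norm_tendsto[OF *(1) elem_isometry(1)[OF *(3)] *(4)]) auto
  ultimately show ?thesis
    unfolding elem_cis[OF *(3)] by (rule LIMSEQ_unique)
qed

text \<open>For disjoint supports the squared norms add up, so the Gaussian characteristic functions
  multiply. Frequencies other than one are covered by scaling \<open>h\<close> and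
  \<open>h'\<close>.\<close>

lemma wiener_indep:
  assumes h: "wiener h W" "wiener h' W'" and disj: "\<And>t. t \<in> space m \<Longrightarrow> h t = 0 \<or> h' t = 0"
  shows "(\<integral>\<omega>. cis (W \<omega> + W' \<omega>) \<partial>M) = (\<integral>\<omega>. cis (W \<omega>) \<partial>M) * (\<integral>\<omega>. cis (W' \<omega>) \<partial>M)"
proof -
  have "(\<integral>t. (h t + h' t)\<^sup>2 \<partial>m) = (\<integral>t. (h t)\<^sup>2 + (h' t)\<^sup>2 \<partial>m)"
    using disj by (intro Bochner_Integration.integral_cong) (auto simp: power2_sum)
  also have "\<dots> = (\<integral>t. (h t)\<^sup>2 \<partial>m) + (\<integral>t. (h' t)\<^sup>2 \<partial>m)"
    using h[THEN wiener_sq_integrable] by (simp add: sq_integrable_def)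
  finally show ?thesis
    unfolding wiener_cis[OF wiener_add[OF h]] wiener_cis[OF h(1)] wiener_cis[OF h(2)]
    by (simp add: exp_add[symmetric] add_divide_distrib flip: of_real_mult)
qed

text \<open>The mean square of the left integrand is two minus twice the real part of the
  characteristic function of \<open>W - W'\<close>, itself a Wiener integral of
  \<open>h - h'\<close>. Hence exponentials converge in mean as soon as the integrands converge in
  L2, even if the integrals do not converge almost surely.\<close>

lemma wiener_cis_dist:
  assumes W: "wiener h W" "wiener h' W'"
  shows "(\<integral>\<omega>. norm (cis (W \<omega>) - cis (W' \<omega>)) \<partial>M)
    \<le> sqrt (2 - 2 * exp (- (\<integral>t. (h t - h' t)\<^sup>2 \<partial>m) / 2))"
proof -
  have [measurable]: "W \<in> borel_measurable M" "W' \<in> borel_measurable M"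
    using W by (simp_all add: wiener_def)
  let ?X = "\<lambda>\<omega>. norm (cis (W \<omega>) - cis (W' \<omega>))"
  have sq: "(?X \<omega>)\<^sup>2 = 2 - 2 * Re (cis (W \<omega> - W' \<omega>))" for \<omega>
  proof -
    have "(?X \<omega>)\<^sup>2 = ((sin (W \<omega>))\<^sup>2 + (cos (W \<omega>))\<^sup>2) + ((sin (W' \<omega>))\<^sup>2 + (cos (W' \<omega>))\<^sup>2)
        - 2 * (cos (W \<omega>) * cos (W' \<omega>) + sin (W \<omega>) * sin (W' \<omega>))"
      unfolding cmod_power2 by (simp add: power2_diff algebra_simps)
    then show ?thesis by (simp add: cos_diff)
  qed
  have icis: "integrable M (\<lambda>\<omega>. cis (W \<omega> - W' \<omega>))"
    by (rule integrable_const_bound[where B=1]) auto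
  have iX: "sq_integrable M ?X"
    unfolding sq_integrable_def sq using integrable_Re[OF icis] by auto
  have "wiener (\<lambda>t. h t - h' t) (\<lambda>\<omega>. W \<omega> - W' \<omega>)"
    using wiener_add[OF W(1) wiener_cmult[OF W(2), of "-1"]] by simp
  note c = wiener_cis[OF this]
  have "(\<integral>\<omega>. (?X \<omega>)\<^sup>2 \<partial>M) = 2 - 2 * Re (\<integral>\<omega>. cis (W \<omega> - W' \<omega>) \<partial>M)"
    unfolding sq integral_Re[OF icis, symmetric] using integrable_Re[OF icis] by (simp add: prob_space)
  then show ?thesis using expectation_abs_le[OF iX] unfolding c by simp
qed

section \<open>Density of step functions and restricted Wiener integrals\<close>

definition approximable :: "('a \<Rightarrow> real) \<Rightarrow> bool" where
  "approximable h \<longleftrightarrow> sq_integrable m h \<and> (\<forall>e>0. \<exists>g G. elem g G \<and> (\<integral>t. (h t - g t)\<^sup>2 \<partial>m) < e)"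

lemma approximable_elem: "elem g G \<Longrightarrow> approximable g"
  unfolding approximable_def using elem_isometry(1) by force

text \<open>The class is closed in L2. The tolerance \<open>e / 4\<close> pays for the factor
  \<open>2\<close> in front of each squared distance in the triangle inequality.\<close>

lemma approximable_limit:
  assumes h: "sq_integrable m h"
    and ex: "\<And>e. e > 0 \<Longrightarrow> \<exists>h'. approximable h' \<and> (\<integral>t. (h t - h' t)\<^sup>2 \<partial>m) < e"
  shows "approximable h"
  unfolding approximable_def
proof (intro conjI h allI impI)
  fix e :: real assume "0 < e"
  then obtain h' where h': "approximable h'" "(\<integral>t. (h t - h' t)\<^sup>2 \<partial>m) < e / 4"
    using ex[of "e / 4"] by auto
  have "0 < e / 4" using \<open>0 < e\<close> by simp
  with h'(1) obtain g G where g: "elem g G" "(\<integral>t. (h' t - g t)\<^sup>2 \<partial>m) < e / 4"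
    unfolding approximable_def by blast
  have "(\<integral>t. (h t - g t)\<^sup>2 \<partial>m) \<le> 2 * (\<integral>t. (h t - h' t)\<^sup>2 \<partial>m) + 2 * (\<integral>t. (h' t - g t)\<^sup>2 \<partial>m)"
    using h h'(1) elem_isometry(1)[OF g(1)] by (intro integral_sq_triangle) (auto simp: approximable_def)
  then show "\<exists>g G. elem g G \<and> (\<integral>t. (h t - g t)\<^sup>2 \<partial>m) < e"
    using h' g by (intro exI[of _ g] exI[of _ G]) auto
qed

lemma approximable_cmult:
  assumes "approximable h"
  shows "approximable (\<lambda>t. c * h t)"
proof -
  have h: "sq_integrable m h" using assms by (simp add: approximable_def)
  show ?thesis
  proof (rule approximable_limit)
    show "sq_integrable m (\<lambda>t. c * h t)" using h by (rule sq_integrable_cmult)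
    fix e :: real assume "0 < e"
    \<comment> \<open>The summand \<open>1\<close> in the denominator allows
      \<open>c = 0\<close>.\<close>
    then have "0 < e / (c\<^sup>2 + 1)" by (intro divide_pos_pos) (auto simp: add_nonneg_pos)
    then obtain g G where g: "elem g G" "(\<integral>t. (h t - g t)\<^sup>2 \<partial>m) < e / (c\<^sup>2 + 1)"
      using assms unfolding approximable_def by blast
    have "(\<integral>t. (c * h t - c * g t)\<^sup>2 \<partial>m) = c\<^sup>2 * (\<integral>t. (h t - g t)\<^sup>2 \<partial>m)"
      by (simp add: right_diff_distrib[symmetric] power_mult_distrib)
    also have "\<dots> \<le> (c\<^sup>2 + 1) * (\<integral>t. (h t - g t)\<^sup>2 \<partial>m)"
      by (intro mult_right_mono) auto
    also have "\<dots> < e" using g(2) by (simp add: pos_less_divide_eq add_nonneg_pos mult.commute)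
    finally show "\<exists>h'. approximable h' \<and> (\<integral>t. (c * h t - h' t)\<^sup>2 \<partial>m) < e"
      using approximable_elem[OF elem_cmult[OF g(1)]] by blast
  qed
qed

lemma approximable_add:
  assumes "approximable h" "approximable h'"
  shows "approximable (\<lambda>t. h t + h' t)"
proof -
  have h: "sq_integrable m h" "sq_integrable m h'" using assms by (auto simp: approximable_def)
  show ?thesis
  proof (rule approximable_limit)
    show "sq_integrable m (\<lambda>t. h t + h' t)" using h by (rule sq_integrable_add)
    fix e :: real assume "0 < e"
    then have "0 < e / 4" by simp
    then obtain g G g' G' where g: "elem g G" "(\<integral>t. (h t - g t)\<^sup>2 \<partial>m) < e / 4"
      "elem g' G'" "(\<integral>t. (h' t - g' t)\<^sup>2 \<partial>m) < e / 4"
      using assms unfolding approximable_def by meson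
    have "(\<integral>t. (h t + h' t - (g t + g' t))\<^sup>2 \<partial>m)
        \<le> 2 * (\<integral>t. (h t - g t)\<^sup>2 \<partial>m) + 2 * (\<integral>t. (h' t - g' t)\<^sup>2 \<partial>m)"
      using integral_sq_add_le[OF sq_integrable_diff[OF h(1) elem_isometry(1)[OF g(1)]]
          sq_integrable_diff[OF h(2) elem_isometry(1)[OF g(3)]]]
      by (simp add: algebra_simps)
    then show "\<exists>k. approximable k \<and> (\<integral>t. (h t + h' t - k t)\<^sup>2 \<partial>m) < e"
      using approximable_elem[OF elem_add[OF g(1,3)]] g by (intro exI[of _ "\<lambda>t. g t + g' t"]) auto
  qed
qed

lemma approximable_sum:
  "finite I \<Longrightarrow> (\<And>i. i \<in> I \<Longrightarrow> approximable (h i)) \<Longrightarrow> approximable (\<lambda>t. \<Sum>i\<in>I. h i t)"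
  by (induction I rule: finite_induct) (auto intro: approximable_add approximable_elem elem_0)

text \<open>A Dynkin induction on \<open>S\<close> carried out inside a fixed \<open>A\<close>: the
  whole space may have infinite measure and need not belong to \<open>\<A>\<close>, while
  \<open>A\<close> supplies both the complement, as \<open>indicator A\<close> minus the indicator
  of \<open>A \<inter> S\<close>, and the dominating function.\<close>

lemma approximable_indicator:
  assumes A: "A \<in> \<A>" and S: "S \<in> sets m"
  shows "approximable (indicator (A \<inter> S))"
proof -
  have "Int_stable \<A>" using Int_closed by (auto simp: Int_stable_def)
  from this sub_space S[unfolded sets_m] show ?thesis
  proof (induction rule: sigma_sets_induct_disjoint)
    case (basic S)
    then show ?case using A Int_closed elem_indicator approximable_elem by blast
  next
    case empty
    show ?case using approximable_elem[OF elem_0] by (simp add: indicator_def[abs_def])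
  next
    case (compl S)
    have "indicator (A \<inter> (space m - S)) = (\<lambda>t. indicator A t + (-1) * indicator (A \<inter> S) t :: real)"
      using A sub_space by (intro ext) (auto simp: indicator_def)
    then show ?case
      using approximable_add[OF approximable_elem[OF elem_indicator[OF A]] approximable_cmult[OF compl(2), of "-1"]]
      by simp
  next
    case (union S)
    have S[measurable]: "S i \<in> sets m" for i using union sets_m by auto
    have [measurable]: "A \<in> sets m" using A by simp
    show ?case
    proof (rule approximable_limit)
      show "sq_integrable m (indicator (A \<inter> (\<Union>i. S i)))"
        using A by (intro sq_integrable_indicator) auto
      fix e :: real assume "0 < e"
      have fin: "integrable m (indicator A :: 'a \<Rightarrow> real)"
        using finite_m[OF A] by (simp add: less_top)
      have "(\<lambda>n. \<integral>t. (indicator (A \<inter> (\<Union>i. S i)) t - (\<Sum>i<n. indicator (A \<inter> S i) t :: real))\<^sup>2 \<partial>m)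
          \<longlonglongrightarrow> (\<integral>t. 0 \<partial>m)"
      proof (rule integral_dominated_convergence[where w="indicator A"])
        have eq: "(\<Sum>i<n. indicator (A \<inter> S i) t :: real) = indicator A t * indicator (\<Union>i<n. S i) t" for n t
        proof -
          have "indicator (\<Union>i<n. S i) t = (\<Sum>i<n. indicator (S i) t :: real)"
            using union(1) by (intro indicator_UN_disjoint) (auto simp: disjoint_family_on_def)
          then show ?thesis by (simp add: indicator_inter_arith sum_distrib_left)
        qed
        show "AE t in m. (\<lambda>n. (indicator (A \<inter> (\<Union>i. S i)) t - (\<Sum>i<n. indicator (A \<inter> S i) t :: real))\<^sup>2) \<longlonglongrightarrow> 0"
        proof (rule AE_I2)
          fix t
          have "(\<lambda>n. (indicator (A \<inter> (\<Union>i. S i)) t - indicator A t * indicator (\<Union>i<n. S i) t :: real)\<^sup>2)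
            \<longlonglongrightarrow> (indicator (A \<inter> (\<Union>i. S i)) t - indicator A t * indicator (\<Union>i. S i) t)\<^sup>2"
            by (intro tendsto_intros LIMSEQ_indicator_UN)
          then show "(\<lambda>n. (indicator (A \<inter> (\<Union>i. S i)) t - (\<Sum>i<n. indicator (A \<inter> S i) t :: real))\<^sup>2) \<longlonglongrightarrow> 0"
            unfolding eq by (simp add: indicator_inter_arith)
        qed
        show "AE t in m. norm ((indicator (A \<inter> (\<Union>i. S i)) t - (\<Sum>i<n. indicator (A \<inter> S i) t :: real))\<^sup>2) \<le> indicator A t" for n
          unfolding eq by (auto simp: indicator_def)
      qed (use fin in auto)
      then have "\<forall>\<^sub>F n in sequentially. (\<integral>t. (indicator (A \<inter> (\<Union>i. S i)) t - (\<Sum>i<n. indicator (A \<inter> S i) t :: real))\<^sup>2 \<partial>m) < e"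
        using \<open>0 < e\<close> by (intro order_tendstoD(2)[of _ 0]) auto
      then obtain n where "(\<integral>t. (indicator (A \<inter> (\<Union>i. S i)) t - (\<Sum>i<n. indicator (A \<inter> S i) t :: real))\<^sup>2 \<partial>m) < e"
        by (auto simp: eventually_sequentially)
      moreover have "approximable (\<lambda>t. \<Sum>i<n. indicator (A \<inter> S i) t)"
        using union by (intro approximable_sum) auto
      ultimately show "\<exists>h'. approximable h' \<and> (\<integral>t. (indicator (A \<inter> (\<Union>i. S i)) t - h' t)\<^sup>2 \<partial>m) < e" by blast
    qed
  qed
qed

text \<open>Multiplication by \<open>indicator S\<close> does not increase L2 distances, and it maps
  a step function to a combination of indicators of the form \<open>A \<inter> S\<close>.\<close>

lemma approximable_restrict:
  assumes "approximable h" and S: "S \<in> sets m"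
  shows "approximable (\<lambda>t. h t * indicator S t)"
proof -
  have h: "sq_integrable m h" using assms by (simp add: approximable_def)
  show ?thesis
  proof (rule approximable_limit)
    show "sq_integrable m (\<lambda>t. h t * indicator S t)" using h S by (rule sq_integrable_indicator_mult)
    fix e :: real assume "0 < e"
    then obtain g G where g: "elem g G" "(\<integral>t. (h t - g t)\<^sup>2 \<partial>m) < e"
      using assms unfolding approximable_def by blast
    then obtain F c where F: "finite F" "F \<subseteq> \<A>" and gF: "g = (\<lambda>t. \<Sum>A\<in>F. c A * indicator A t)"
      by (auto simp: elem_def)
    have "(\<lambda>t. g t * indicator S t) = (\<lambda>t. \<Sum>A\<in>F. c A * indicator (A \<inter> S) t)"
      by (simp add: gF sum_distrib_right indicator_inter_arith mult.assoc)
    then have a: "approximable (\<lambda>t. g t * indicator S t)"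
      using F S by (simp only:) (intro approximable_sum approximable_cmult approximable_indicator, auto)
    have d: "sq_integrable m (\<lambda>t. h t - g t)" by (intro sq_integrable_diff h elem_isometry(1)[OF g(1)])
    have "(\<integral>t. (h t * indicator S t - g t * indicator S t)\<^sup>2 \<partial>m) \<le> (\<integral>t. (h t - g t)\<^sup>2 \<partial>m)"
      using d sq_integrable_indicator_mult[OF d S]
      by (intro integral_mono) (auto simp: sq_integrable_def left_diff_distrib indicator_def)
    then show "\<exists>h'. approximable h' \<and> (\<integral>t. (h t * indicator S t - h' t)\<^sup>2 \<partial>m) < e"
      using a g(2) by (intro exI[of _ "\<lambda>t. g t * indicator S t"]) auto
  qed
qed

lemma wiener_approximable:
  assumes "wiener h W"
  shows "approximable h"
proof -
  obtain g G where *: "sq_integrable m h" "\<And>n. elem (g n) (G n)"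
    "(\<lambda>n. \<integral>t. (h t - g n t)\<^sup>2 \<partial>m) \<longlonglongrightarrow> 0"
    using assms by (auto simp: wiener_def)
  show ?thesis unfolding approximable_def
  proof (intro conjI *(1) allI impI)
    fix e :: real assume "0 < e"
    then have "\<forall>\<^sub>F n in sequentially. (\<integral>t. (h t - g n t)\<^sup>2 \<partial>m) < e"
      using *(3) by (intro order_tendstoD(2)[of _ 0]) auto
    then obtain n where "(\<integral>t. (h t - g n t)\<^sup>2 \<partial>m) < e" by (auto simp: eventually_sequentially)
    then show "\<exists>g G. elem g G \<and> (\<integral>t. (h t - g t)\<^sup>2 \<partial>m) < e" using *(2) by blast
  qed
qed

text \<open>By the isometry, step functions converging in L2 have Gaussian variables that are Cauchy
  in mean square, hence in mean, and a subsequence converges almost surely.\<close>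

lemma approximable_wiener:
  assumes "approximable h"
  shows "\<exists>W. wiener h W"
proof -
  have h: "sq_integrable m h" using assms by (simp add: approximable_def)
  have "\<exists>g G. elem g G \<and> (\<integral>t. (h t - g t)\<^sup>2 \<partial>m) < 1 / Suc n" for n
    using assms by (simp add: approximable_def)
  then obtain g G where g: "\<And>n. elem (g n) (G n)" "\<And>n. (\<integral>t. (h t - g n t)\<^sup>2 \<partial>m) < 1 / Suc n"
    by metis
  note Gm[measurable] = elem_measurable[OF g(1)]
  have bound: "(\<integral>\<omega>. norm (G i \<omega> - G j \<omega>) \<partial>M) \<le> sqrt (2 / Suc i + 2 / Suc j)" for i j
  proof -
    note el = elem_diff[OF g(1)[of i] g(1)[of j]]
    have "(\<integral>\<omega>. norm (G i \<omega> - G j \<omega>) \<partial>M) \<le> sqrt (\<integral>\<omega>. (G i \<omega> - G j \<omega>)\<^sup>2 \<partial>M)"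
      using expectation_abs_le[OF elem_sq_integrable[OF el]] by simp
    also have "(\<integral>\<omega>. (G i \<omega> - G j \<omega>)\<^sup>2 \<partial>M) = (\<integral>t. (g i t - g j t)\<^sup>2 \<partial>m)"
      by (rule elem_isometry(2)[OF el])
    also have "\<dots> \<le> 2 * (\<integral>t. (g i t - h t)\<^sup>2 \<partial>m) + 2 * (\<integral>t. (h t - g j t)\<^sup>2 \<partial>m)"
      by (rule integral_sq_triangle[OF elem_isometry(1)[OF g(1)] h elem_isometry(1)[OF g(1)]])
    also have "\<dots> \<le> 2 / Suc i + 2 / Suc j"
      using g(2)[of i] g(2)[of j] by (simp add: power2_commute[of "g i _"])
    finally show ?thesis by simp
  qed
  obtain r where r: "strict_mono r" "AE \<omega> in M. Cauchy (\<lambda>i. G (r i) \<omega>)"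
  proof (rule cauchy_L1_AE_cauchy_subseq[of M G])
    show "integrable M (G n)" for n
      by (rule square_integrable_imp_integrable)
        (use elem_sq_integrable[OF g(1)[of n]] in \<open>auto simp: sq_integrable_def\<close>)
    fix e :: real assume "0 < e"
    \<comment> \<open>Beyond \<open>N\<close> each of the two terms under the root is at most
      \<open>2 / Suc N\<close>; their sum is then at most \<open>4 / Suc N\<close>, which is below
      the square of \<open>e\<close>.\<close>
    obtain N where "4 / e\<^sup>2 < real N" using reals_Archimedean2 by blast
    then have N: "4 / e\<^sup>2 < real (Suc N)" by simp
    have "sqrt (2 / Suc i + 2 / Suc j) < e" if "i \<ge> N" "j \<ge> N" for i j
    proof -
      have "2 / Suc i \<le> 2 / real (Suc N)" "2 / Suc j \<le> 2 / real (Suc N)"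
        using that by (auto intro!: divide_left_mono)
      then have "2 / Suc i + 2 / Suc j \<le> 4 / real (Suc N)" by simp
      also have "\<dots> < e\<^sup>2" using N \<open>0 < e\<close> by (simp add: field_simps)
      finally show ?thesis using \<open>0 < e\<close> by (intro real_less_lsqrt) (auto simp: add_nonneg_nonneg)
    qed
    then show "\<exists>N. \<forall>i\<ge>N. \<forall>j\<ge>N. (\<integral>\<omega>. norm (G i \<omega> - G j \<omega>) \<partial>M) < e"
      using bound by (meson le_less_trans)
  qed
  define W where "W \<omega> = lim (\<lambda>i. G (r i) \<omega>)" for \<omega>
  have Wm: "W \<in> borel_measurable M" unfolding W_def by measurable
  have Wlim: "AE \<omega> in M. (\<lambda>i. G (r i) \<omega>) \<longlonglongrightarrow> W \<omega>"
    using r(2) by eventually_elim (simp add: W_def Cauchy_convergent_iff convergent_LIMSEQ_iff)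
  have "(\<lambda>n. \<integral>t. (h t - g n t)\<^sup>2 \<partial>m) \<longlonglongrightarrow> 0"
    by (rule tendsto_sandwich[OF _ _ tendsto_const LIMSEQ_inverse_real_of_nat])
      (use g(2) in \<open>auto simp: inverse_eq_divide less_imp_le\<close>)
  then have "(\<lambda>i. \<integral>t. (h t - g (r i) t)\<^sup>2 \<partial>m) \<longlonglongrightarrow> 0"
    using LIMSEQ_subseq_LIMSEQ[OF _ r(1)] by (fastforce simp: comp_def)
  then have "wiener h W"
    unfolding wiener_def using h Wm Wlim g(1)
    by (intro conjI exI[of _ "\<lambda>i. g (r i)"] exI[of _ "\<lambda>i. G (r i)"]) auto
  then show ?thesis by blast
qed

text \<open>Here \<open>S\<close> is any measurable set, in particular the complement of a vicinity:
  this is how Gaussian noise off a vicinity becomes available.\<close>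

lemma wiener_restrict:
  assumes "wiener h W" "S \<in> sets m"
  shows "\<exists>W'. wiener (\<lambda>t. h t * indicator S t) W'"
  using assms wiener_approximable approximable_restrict approximable_wiener by blast

text \<open>Mean square convergence of the variables gives almost sure convergence along a
  subsequence, and the integrands still converge along it. Square integrability of \<open>h\<close>
  follows from its distance to a step function being eventually finite.\<close>

lemma is_wiener_integral_wiener:
  assumes h[measurable]: "h \<in> borel_measurable m" and W: "is_wiener_integral M \<A> m B h W"
  shows "wiener h W"
proof -
  have Wm[measurable]: "W \<in> borel_measurable M" using W by (simp add: is_wiener_integral_def)
  obtain F c where F: "\<And>n. finite (F n) \<and> F n \<subseteq> \<A>"
    and hl: "(\<lambda>n. \<integral>\<^sup>+t. ennreal ((h t - (\<Sum>A\<in>F n. c n A * indicator A t))\<^sup>2) \<partial>m) \<longlonglongrightarrow> 0"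
    and Wl: "(\<lambda>n. \<integral>\<^sup>+\<omega>. ennreal ((W \<omega> - (\<Sum>A\<in>F n. c n A * B A \<omega>))\<^sup>2) \<partial>M) \<longlonglongrightarrow> 0"
    using W unfolding is_wiener_integral_def by blast
  define g where "g n t = (\<Sum>A\<in>F n. c n A * indicator A t)" for n t
  define G where "G n \<omega> = (\<Sum>A\<in>F n. c n A * B A \<omega>)" for n \<omega>
  have el: "elem (g n) (G n)" for n
    using elemI[of "F n" "c n"] F[of n] by (simp add: g_def[abs_def] G_def[abs_def])
  have hs: "sq_integrable m h" and hl': "(\<lambda>n. \<integral>t. (h t - g n t)\<^sup>2 \<partial>m) \<longlonglongrightarrow> 0"
    using L2_limit_of_nn_integral[OF h elem_isometry(1)[OF el]] hl by (auto simp: g_def)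
  have Ws: "sq_integrable M W" and Wl': "(\<lambda>n. \<integral>\<omega>. (W \<omega> - G n \<omega>)\<^sup>2 \<partial>M) \<longlonglongrightarrow> 0"
    using L2_limit_of_nn_integral[OF Wm elem_sq_integrable[OF el]] Wl by (auto simp: G_def)
  have "\<exists>r::nat\<Rightarrow>nat. strict_mono r \<and> (AE \<omega> in M. (\<lambda>n. (W \<omega> - G (r n) \<omega>)\<^sup>2) \<longlonglongrightarrow> 0)"
  proof (rule tendsto_L1_AE_subseq[of M "\<lambda>n \<omega>. (W \<omega> - G n \<omega>)\<^sup>2"])
    show "integrable M (\<lambda>\<omega>. (W \<omega> - G n \<omega>)\<^sup>2)" for n
      using sq_integrable_diff[OF Ws elem_sq_integrable[OF el[of n]]] by (simp add: sq_integrable_def)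
    show "(\<lambda>n. \<integral>\<omega>. norm ((W \<omega> - G n \<omega>)\<^sup>2) \<partial>M) \<longlonglongrightarrow> 0" using Wl' by simp
  qed
  then obtain r :: "nat \<Rightarrow> nat" where r: "strict_mono r"
    "AE \<omega> in M. (\<lambda>n. (W \<omega> - G (r n) \<omega>)\<^sup>2) \<longlonglongrightarrow> 0" by blast
  have "AE \<omega> in M. (\<lambda>n. G (r n) \<omega>) \<longlonglongrightarrow> W \<omega>"
    using r(2)
  proof eventually_elim
    case (elim \<omega>)
    then have "(\<lambda>n. sqrt ((W \<omega> - G (r n) \<omega>)\<^sup>2)) \<longlonglongrightarrow> sqrt 0" by (intro tendsto_intros)
    then have "(\<lambda>n. W \<omega> - G (r n) \<omega>) \<longlonglongrightarrow> 0" by (simp add: tendsto_rabs_zero_iff)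
    from tendsto_diff[OF tendsto_const[of "W \<omega>"] this] show ?case by simp
  qed
  moreover have "(\<lambda>n. \<integral>t. (h t - g (r n) t)\<^sup>2 \<partial>m) \<longlonglongrightarrow> 0"
    using LIMSEQ_subseq_LIMSEQ[OF hl' r(1)] by (simp add: comp_def)
  ultimately show ?thesis
    unfolding wiener_def using hs Wm el
    by (intro conjI exI[of _ "\<lambda>i. g (r i)"] exI[of _ "\<lambda>i. G (r i)"]) auto
qed

end

section \<open>Gaussian and Poissonian noise combined\<close>

text \<open>Wrapping the set system as the events of a measure makes the usual rules available for
  measurability with respect to it.\<close>

lemma sets_sigma_sigma_gen: "sets (sigma (space M) (sigma_gen M X I)) = sigma_gen M X I"
proof -
  have "sigma_gen M X I \<subseteq> Pow (space M)"
  proof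
    fix a assume "a \<in> sigma_gen M X I"
    then have "a \<subseteq> space M" unfolding sigma_gen_def by (rule sigma_sets_into_sp[rotated]) auto
    then show "a \<in> Pow (space M)" by simp
  qed
  then show ?thesis
    by (simp add: sets_measure_of) (unfold sigma_gen_def, rule sigma_sets_sigma_sets_eq, auto)
qed

lemma measurable_sigma_gen:
  fixes X :: "'i \<Rightarrow> 'w \<Rightarrow> 'b::topological_space"
  assumes "i \<in> I"
  shows "X i \<in> borel_measurable (sigma (space M) (sigma_gen M X I))"
proof (rule measurableI)
  fix S :: "'b set" assume "S \<in> sets borel"
  then have "X i -` S \<inter> space M \<in> sigma_gen M X I"
    unfolding sigma_gen_def using assms by (intro sigma_sets.Basic) auto
  then show "X i -` S \<inter> space (sigma (space M) (sigma_gen M X I)) \<in> sets (sigma (space M) (sigma_gen M X I))"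
    unfolding sets_sigma_sigma_gen by (simp add: space_measure_of_conv)
qed auto

lemma (in prob_space) indep_set_expectation_cis:
  fixes X Z :: "'a \<Rightarrow> real" and U :: "'i \<Rightarrow> 'a \<Rightarrow> 'b::topological_space"
    and U' :: "'j \<Rightarrow> 'a \<Rightarrow> 'c::topological_space"
  assumes ind: "indep_set (sigma_gen M U I) (sigma_gen M U' J)"
    and X: "X \<in> borel_measurable (sigma (space M) (sigma_gen M U I))"
    and Z: "Z \<in> borel_measurable (sigma (space M) (sigma_gen M U' J))"
  shows "(\<integral>\<omega>. cis (X \<omega>) * cis (Z \<omega>) \<partial>M) = (\<integral>\<omega>. cis (X \<omega>) \<partial>M) * (\<integral>\<omega>. cis (Z \<omega>) \<partial>M)"
proof -
  have ev: "sigma_gen M U I \<subseteq> sets M" "sigma_gen M U' J \<subseteq> sets M"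
    using ind by (auto simp: indep_set_def indep_sets_def split: bool.splits)
  have X': "X -` S \<inter> space M \<in> sigma_gen M U I" if "S \<in> sets borel" for S
    using measurable_sets[OF X that] by (simp add: sets_sigma_sigma_gen space_measure_of_conv)
  have Z': "Z -` S \<inter> space M \<in> sigma_gen M U' J" if "S \<in> sets borel" for S
    using measurable_sets[OF Z that] by (simp add: sets_sigma_sigma_gen space_measure_of_conv)
  have [measurable]: "X \<in> borel_measurable M" "Z \<in> borel_measurable M"
    using X' Z' ev by (auto intro!: measurableI)
  have "indep_var borel X borel Z"
    unfolding indep_var_eq
  proof (intro conjI)
    have "sigma_sets (space M) {X -` S \<inter> space M |S. S \<in> sets borel} \<subseteq> sigma_gen M U I"
      "sigma_sets (space M) {Z -` S \<inter> space M |S. S \<in> sets borel} \<subseteq> sigma_gen M U' J"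
      using X' Z' unfolding sigma_gen_def by (intro sigma_sets_mono; auto)+
    then show "indep_set (sigma_sets (space M) {X -` S \<inter> space M |S. S \<in> sets borel})
        (sigma_sets (space M) {Z -` S \<inter> space M |S. S \<in> sets borel})"
      using ind unfolding indep_set_def by (elim indep_sets_mono_sets) (auto split: bool.split)
  qed auto
  then have "indep_var borel (cis \<circ> X) borel (cis \<circ> Z)"
    by (rule indep_var_compose) (auto intro: borel_measurable_cis[of "\<lambda>x. x"])
  moreover have "integrable M (cis \<circ> X)" "integrable M (cis \<circ> Z)"
    unfolding comp_def by (auto intro!: integrable_const_bound[where B=1])
  ultimately show ?thesis
    using indep_var_lebesgue_integral[of "cis \<circ> X" "cis \<circ> Z"] by (simp add: comp_def)
qed

text \<open>Chebyshev's inequality for the second moment of \<open>\<nu>\<close>.\<close>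

lemma jump_measure_tail:
  assumes "jump_measure \<nu>" "0 < \<epsilon>"
  shows "{x. \<epsilon> \<le> \<bar>x\<bar>} \<in> sets \<nu>" "emeasure \<nu> {x. \<epsilon> \<le> \<bar>x\<bar>} < \<infinity>"
proof -
  have [measurable_cong]: "sets \<nu> = sets borel" and fin: "(\<integral>\<^sup>+x. ennreal (x\<^sup>2) \<partial>\<nu>) < \<infinity>"
    using assms(1) by (auto simp: jump_measure_def)
  show S: "{x. \<epsilon> \<le> \<bar>x\<bar>} \<in> sets \<nu>" by measurable
  have "emeasure \<nu> {x. \<epsilon> \<le> \<bar>x\<bar>} = (\<integral>\<^sup>+x. indicator {x. \<epsilon> \<le> \<bar>x\<bar>} x \<partial>\<nu>)" using S by simp
  also have "\<dots> \<le> (\<integral>\<^sup>+x. ennreal (1 / \<epsilon>\<^sup>2) * ennreal (x\<^sup>2) \<partial>\<nu>)"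
  proof (rule nn_integral_mono)
    fix x :: real
    have "1 \<le> 1 / \<epsilon>\<^sup>2 * x\<^sup>2" if "\<epsilon> \<le> \<bar>x\<bar>"
      using assms(2) power_mono[OF that, of 2] by (simp add: pos_le_divide_eq)
    then show "indicator {x. \<epsilon> \<le> \<bar>x\<bar>} x \<le> ennreal (1 / \<epsilon>\<^sup>2) * ennreal (x\<^sup>2)"
      by (auto simp: indicator_def ennreal_mult[symmetric])
  qed
  also have "\<dots> = ennreal (1 / \<epsilon>\<^sup>2) * (\<integral>\<^sup>+x. ennreal (x\<^sup>2) \<partial>\<nu>)"
    by (rule nn_integral_cmult) measurable
  also have "\<dots> < \<infinity>" using fin by (simp add: ennreal_mult_less_top)
  finally show "emeasure \<nu> {x. \<epsilon> \<le> \<bar>x\<bar>} < \<infinity>" .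
qed

text \<open>The line is exhausted by the origin, which is null, and the tails at 1/(k+1). This is
  used for the product measure of rectangles, where \<open>\<nu>\<close> is the second
  factor.\<close>

lemma sigma_finite_jump_measure:
  assumes "jump_measure \<nu>"
  shows "sigma_finite_measure \<nu>"
proof (unfold_locales, intro exI conjI)
  let ?S = "insert {0} (range (\<lambda>k :: nat. {x :: real. 1 / Suc k \<le> \<bar>x\<bar>}))"
  show "countable ?S" by simp
  have \<nu>: "sets \<nu> = sets borel" "emeasure \<nu> {0} = 0"
    using assms by (simp_all add: jump_measure_def)
  have tail: "{x. 1 / real (Suc k) \<le> \<bar>x\<bar>} \<in> sets \<nu>" "emeasure \<nu> {x. 1 / real (Suc k) \<le> \<bar>x\<bar>} \<noteq> \<infinity>" for k
    using jump_measure_tail[OF assms, of "1 / real (Suc k)"] by (auto simp del: of_nat_Suc)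
  have "{0} \<in> sets \<nu>" unfolding \<nu> by simp
  then show "?S \<subseteq> sets \<nu>" using tail(1) by blast
  have "x \<in> \<Union>?S" for x
  proof (cases "x = 0")
    case False
    then obtain k where "inverse (of_nat (Suc k)) < \<bar>x\<bar>"
      using reals_Archimedean[of "\<bar>x\<bar>"] by auto
    then have "x \<in> {x. 1 / real (Suc k) \<le> \<bar>x\<bar>}" by (simp add: inverse_eq_divide)
    then show ?thesis by (intro UnionI[of "{x. 1 / real (Suc k) \<le> \<bar>x\<bar>}"]) auto
  qed auto
  moreover have "space \<nu> = UNIV"
    using sets_eq_imp_space_eq[OF \<nu>(1)] by simp
  ultimately show "\<Union>?S = space \<nu>" by auto
  show "\<forall>a\<in>?S. emeasure \<nu> a \<noteq> \<infinity>"
    using tail(2) \<nu>(2) by (simp del: of_nat_Suc)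
qed

text \<open>The integrand of the jump sum at level 1/(k+1). Cutting off the small jumps gives it a
  support of finite intensity when \<open>h\<close> has a support of finite measure.\<close>

definition jump_part :: "('a \<Rightarrow> real) \<Rightarrow> nat \<Rightarrow> 'a \<times> real \<Rightarrow> real" where
  "jump_part h k = (\<lambda>(t, x). h t * (x * indicator {x. 1 / real (Suc k) \<le> \<bar>x\<bar>} x))"

locale levy_noise =
  brownian M \<A> m B + poisson_set M "m \<Otimes>\<^sub>M \<nu>" \<Xi>
  for M :: "'w measure" and \<A> :: "'a set set" and m B and \<nu> :: "real measure" and \<Xi> +
  fixes \<sigma> :: real
  assumes jump: "jump_measure \<nu>"
    and indep: "indep_set (sigma_gen M B \<A>) (sigma_gen M (pt_count \<Xi>) (sets (m \<Otimes>\<^sub>M \<nu>)))"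
begin

lemma sets_nu [measurable_cong, simp]: "sets \<nu> = sets borel"
  using jump by (simp add: jump_measure_def)

lemma space_nu [simp]: "space \<nu> = UNIV"
  using sets_eq_imp_space_eq[OF sets_nu] by simp

lemma emeasure_Times_nu:
  "U \<in> sets m \<Longrightarrow> S \<in> sets \<nu> \<Longrightarrow> emeasure (m \<Otimes>\<^sub>M \<nu>) (U \<times> S) = emeasure m U * emeasure \<nu> S"
  using sigma_finite_jump_measure[OF jump] by (rule sigma_finite_measure.emeasure_pair_measure_Times)

text \<open>The sigma-algebras in \<open>indep\<close> are not completed, whereas \<open>Z\<close>
  and \<open>psum\<close> are only almost surely limits of variables measurable for them. The
  product formula is therefore established for step functions and counts and carried to the
  limit.\<close>

lemma wiener_psum_indep:
  assumes W: "wiener g Z" and \<phi>: "fin_supp (m \<Otimes>\<^sub>M \<nu>) \<phi>"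
  shows "(\<integral>\<omega>. cis (Z \<omega>) * cis (psum \<Xi> \<phi> \<omega>) \<partial>M)
    = (\<integral>\<omega>. cis (Z \<omega>) \<partial>M) * (\<integral>\<omega>. cis (psum \<Xi> \<phi> \<omega>) \<partial>M)"
proof -
  obtain h G where G: "\<And>n. elem (h n) (G n)" "AE \<omega> in M. (\<lambda>n :: nat. G n \<omega>) \<longlonglongrightarrow> Z \<omega>"
    using W by (auto simp: wiener_def)
  obtain s where s: "\<And>k. simple_function (m \<Otimes>\<^sub>M \<nu>) (s k)"
    "AE \<omega> in M. (\<lambda>k. count_combo (s k) \<omega>) \<longlonglongrightarrow> psum \<Xi> \<phi> \<omega>"
    using count_combo_approx[OF \<phi>] by (elim exE conjE, intro that) simp_all
  note [measurable] = wiener_measurable[OF W] measurable_psum[OF \<phi>]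
    measurable_count_combo[OF s(1)] elem_measurable[OF G(1)]
  have eq: "(\<integral>\<omega>. cis (G n \<omega>) * cis (count_combo (s n) \<omega>) \<partial>M)
    = (\<integral>\<omega>. cis (G n \<omega>) \<partial>M) * (\<integral>\<omega>. cis (count_combo (s n) \<omega>) \<partial>M)" for n
  proof (rule indep_set_expectation_cis[OF indep])
    obtain F c where "F \<subseteq> \<A>" "G n = (\<lambda>\<omega>. \<Sum>A\<in>F. c A * B A \<omega>)"
      using G(1)[of n] by (auto simp: elem_def)
    then show "G n \<in> borel_measurable (sigma (space M) (sigma_gen M B \<A>))"
      by (auto intro!: borel_measurable_sum borel_measurable_times measurable_sigma_gen)
    have [measurable]: "s n \<in> borel_measurable (m \<Otimes>\<^sub>M \<nu>)"
      using s(1) by (rule borel_measurable_simple_function)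
    show "count_combo (s n) \<in> borel_measurable (sigma (space M) (sigma_gen M (pt_count \<Xi>) (sets (m \<Otimes>\<^sub>M \<nu>))))"
      unfolding count_combo_def
      by (intro borel_measurable_sum borel_measurable_times borel_measurable_const
          measurable_compose[OF measurable_sigma_gen borel_measurable_enn2real[OF measurable_ident_sets[OF refl]]])
        measurable
  qed
  have "AE \<omega> in M. (\<lambda>n. cis (G n \<omega>) * cis (count_combo (s n) \<omega>)) \<longlonglongrightarrow> cis (Z \<omega>) * cis (psum \<Xi> \<phi> \<omega>)"
    using G(2) s(2) by eventually_elim (intro tendsto_intros)
  then have "(\<lambda>n. \<integral>\<omega>. cis (G n \<omega>) * cis (count_combo (s n) \<omega>) \<partial>M)
      \<longlonglongrightarrow> (\<integral>\<omega>. cis (Z \<omega>) * cis (psum \<Xi> \<phi> \<omega>) \<partial>M)"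
    by (intro expectation_bounded_tendsto[where c=1]) (auto simp: norm_mult)
  moreover have "(\<lambda>n. \<integral>\<omega>. cis (G n \<omega>) * cis (count_combo (s n) \<omega>) \<partial>M)
      \<longlonglongrightarrow> (\<integral>\<omega>. cis (Z \<omega>) \<partial>M) * (\<integral>\<omega>. cis (psum \<Xi> \<phi> \<omega>) \<partial>M)"
    unfolding eq using G(2) s(2) by (intro tendsto_mult expectation_cis_tendsto) auto
  ultimately show ?thesis by (rule LIMSEQ_unique)
qed

text \<open>The two Gaussian terms are grouped together, as are the two sums. Independence of the
  two kinds of noise separates the groups, disjointness of supports separates the terms inside each
  group, and the four factors are recombined in the other way.\<close>

lemma wiener_psum_disjoint_indep:
  assumes g: "wiener g Z" "wiener g' Z'" "\<And>t. t \<in> space m \<Longrightarrow> g t = 0 \<or> g' t = 0"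
    and \<phi>: "fin_supp (m \<Otimes>\<^sub>M \<nu>) \<phi>" "fin_supp (m \<Otimes>\<^sub>M \<nu>) \<phi>'"
      "\<And>p. p \<in> space (m \<Otimes>\<^sub>M \<nu>) \<Longrightarrow> \<phi> p = 0 \<or> \<phi>' p = 0"
  shows "(\<integral>\<omega>. cis (Z \<omega> + psum \<Xi> \<phi> \<omega>) * cis (Z' \<omega> + psum \<Xi> \<phi>' \<omega>) \<partial>M)
    = (\<integral>\<omega>. cis (Z \<omega> + psum \<Xi> \<phi> \<omega>) \<partial>M) * (\<integral>\<omega>. cis (Z' \<omega> + psum \<Xi> \<phi>' \<omega>) \<partial>M)"
proof -
  note fs = fin_supp_add[OF \<phi>(1,2)]
  note [measurable] = wiener_measurable[OF g(1)] wiener_measurable[OF g(2)]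
    measurable_psum[OF \<phi>(1)] measurable_psum[OF \<phi>(2)] measurable_psum[OF fs]
  note add = AE_psum_add[OF \<phi>(1,2)]
  have "(\<integral>\<omega>. cis (Z \<omega> + psum \<Xi> \<phi> \<omega>) * cis (Z' \<omega> + psum \<Xi> \<phi>' \<omega>) \<partial>M)
    = (\<integral>\<omega>. cis (Z \<omega> + Z' \<omega>) * cis (psum \<Xi> (\<lambda>p. \<phi> p + \<phi>' p) \<omega>) \<partial>M)"
    using add by (intro integral_cong_AE) (measurable, auto simp: cis_mult algebra_simps elim!: eventually_mono)
  also have "\<dots> = (\<integral>\<omega>. cis (Z \<omega> + Z' \<omega>) \<partial>M) * (\<integral>\<omega>. cis (psum \<Xi> (\<lambda>p. \<phi> p + \<phi>' p) \<omega>) \<partial>M)"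
    by (rule wiener_psum_indep[OF wiener_add[OF g(1,2)] fs])
  also have "(\<integral>\<omega>. cis (psum \<Xi> (\<lambda>p. \<phi> p + \<phi>' p) \<omega>) \<partial>M)
    = (\<integral>\<omega>. cis (psum \<Xi> \<phi> \<omega>) * cis (psum \<Xi> \<phi>' \<omega>) \<partial>M)"
    using add by (intro integral_cong_AE) (measurable, auto simp: cis_mult elim!: eventually_mono)
  also have "\<dots> = (\<integral>\<omega>. cis (psum \<Xi> \<phi> \<omega>) \<partial>M) * (\<integral>\<omega>. cis (psum \<Xi> \<phi>' \<omega>) \<partial>M)"
    by (rule psum_indep[OF \<phi>])
  finally show ?thesis
    using wiener_indep[OF g] wiener_psum_indep[OF g(1) \<phi>(1)] wiener_psum_indep[OF g(2) \<phi>(2)]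
    by (simp add: cis_mult[symmetric] mult_ac)
qed

lemma fin_supp_jump_part:
  assumes "fin_supp m h"
  shows "fin_supp (m \<Otimes>\<^sub>M \<nu>) (jump_part h k)"
proof -
  have [measurable]: "h \<in> borel_measurable m" using assms by (simp add: fin_supp_def)
  let ?U = "{t \<in> space m. h t \<noteq> 0}" and ?S = "{x. 1 / real (Suc k) \<le> \<bar>x\<bar>}"
  have S: "?S \<in> sets \<nu>" "emeasure \<nu> ?S < \<infinity>"
    by (rule jump_measure_tail[OF jump], simp)+
  have [measurable]: "?S \<in> sets borel" using S by simp
  have "jump_part h k \<in> borel_measurable (m \<Otimes>\<^sub>M \<nu>)" unfolding jump_part_def by measurable
  moreover have "emeasure (m \<Otimes>\<^sub>M \<nu>) {p \<in> space (m \<Otimes>\<^sub>M \<nu>). jump_part h k p \<noteq> 0} \<le> emeasure (m \<Otimes>\<^sub>M \<nu>) (?U \<times> ?S)"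
    using S(1) by (intro emeasure_mono pair_measureI) (auto simp: jump_part_def space_pair_measure indicator_def split: if_splits)
  moreover have "\<dots> < \<infinity>"
    using assms S by (subst emeasure_Times_nu) (auto simp: fin_supp_def ennreal_mult_less_top)
  ultimately show ?thesis by (auto simp: fin_supp_def intro: le_less_trans)
qed

text \<open>\<open>\<kappa>\<close> absorbs the compensators: only their being constants matters.\<close>

definition noise :: "('a \<Rightarrow> real) \<Rightarrow> ('w \<Rightarrow> real) \<Rightarrow> bool" where
  "noise h D \<longleftrightarrow> fin_supp m h \<and> (\<exists>Z \<kappa>. wiener (\<lambda>t. \<sigma> * h t) Z \<and>
    (AE \<omega> in M. (\<lambda>k. Z \<omega> + psum \<Xi> (jump_part h k) \<omega> + \<kappa> k) \<longlonglongrightarrow> D \<omega>))"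

lemma noise_0: "noise (\<lambda>_. 0) (\<lambda>_. 0)"
proof -
  have "jump_part (\<lambda>_::'a. 0) k = (\<lambda>_. 0)" for k by (auto simp: jump_part_def)
  then show ?thesis unfolding noise_def
    by (intro conjI exI[of _ "\<lambda>_. 0"]) (use wiener_0 in \<open>auto simp: fin_supp_def psum_def\<close>)
qed

text \<open>The criterion for generated sigma-algebras tests all linear combinations of the family,
  so the class has to be a vector space; the constants \<open>\<kappa>\<close> transform along with
  \<open>D\<close>.\<close>

lemma noise_cmult:
  assumes "noise h D"
  shows "noise (\<lambda>t. c * h t) (\<lambda>\<omega>. c * D \<omega>)"
proof -
  obtain Z \<kappa> where *: "fin_supp m h" "wiener (\<lambda>t. \<sigma> * h t) Z"
    "AE \<omega> in M. (\<lambda>k. Z \<omega> + psum \<Xi> (jump_part h k) \<omega> + \<kappa> k) \<longlonglongrightarrow> D \<omega>"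
    using assms by (auto simp: noise_def)
  have jump_part: "jump_part (\<lambda>t. c * h t) k = (\<lambda>p. c * jump_part h k p)" for k by (auto simp: jump_part_def)
  have "AE \<omega> in M. (\<lambda>k. c * (Z \<omega> + psum \<Xi> (jump_part h k) \<omega> + \<kappa> k)) \<longlonglongrightarrow> c * D \<omega>"
    using *(3) by eventually_elim (intro tendsto_intros)
  moreover have "wiener (\<lambda>t. \<sigma> * (c * h t)) (\<lambda>\<omega>. c * Z \<omega>)"
    using wiener_cmult[OF *(2), of c] by (simp add: mult_ac)
  ultimately show ?thesis unfolding noise_def jump_part psum_cmult
    using fin_supp_cmult[OF *(1), of c]
    by (intro conjI exI[of _ "\<lambda>\<omega>. c * Z \<omega>"] exI[of _ "\<lambda>k. c * \<kappa> k"]) (simp_all add: distrib_left)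
qed

lemma noise_add:
  assumes "noise h D" "noise h' D'"
  shows "noise (\<lambda>t. h t + h' t) (\<lambda>\<omega>. D \<omega> + D' \<omega>)"
proof -
  obtain Z \<kappa> where 1: "fin_supp m h" "wiener (\<lambda>t. \<sigma> * h t) Z"
    "AE \<omega> in M. (\<lambda>k. Z \<omega> + psum \<Xi> (jump_part h k) \<omega> + \<kappa> k) \<longlonglongrightarrow> D \<omega>"
    using assms by (auto simp: noise_def)
  obtain Z' \<kappa>' where 2: "fin_supp m h'" "wiener (\<lambda>t. \<sigma> * h' t) Z'"
    "AE \<omega> in M. (\<lambda>k. Z' \<omega> + psum \<Xi> (jump_part h' k) \<omega> + \<kappa>' k) \<longlonglongrightarrow> D' \<omega>"
    using assms by (auto simp: noise_def)
  have jump_part: "jump_part (\<lambda>t. h t + h' t) k = (\<lambda>p. jump_part h k p + jump_part h' k p)" for k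
    by (auto simp: jump_part_def distrib_right)
  have "AE \<omega> in M. \<forall>k. psum \<Xi> (jump_part (\<lambda>t. h t + h' t) k) \<omega> = psum \<Xi> (jump_part h k) \<omega> + psum \<Xi> (jump_part h' k) \<omega>"
    unfolding AE_all_countable jump_part by (intro allI AE_psum_add fin_supp_jump_part 1 2)
  with 1(3) 2(3) have "AE \<omega> in M. (\<lambda>k. (Z \<omega> + Z' \<omega>) + psum \<Xi> (jump_part (\<lambda>t. h t + h' t) k) \<omega> + (\<kappa> k + \<kappa>' k))
      \<longlonglongrightarrow> D \<omega> + D' \<omega>"
  proof eventually_elim
    case (elim \<omega>)
    from tendsto_add[OF elim(1,2)] show ?case by (simp add: elim(3) add_ac)
  qed
  moreover have "wiener (\<lambda>t. \<sigma> * (h t + h' t)) (\<lambda>\<omega>. Z \<omega> + Z' \<omega>)"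
    using wiener_add[OF 1(2) 2(2)] by (simp add: distrib_left)
  ultimately show ?thesis unfolding noise_def
    using fin_supp_add[OF 1(1) 2(1)]
    by (intro conjI exI[of _ "\<lambda>\<omega>. Z \<omega> + Z' \<omega>"] exI[of _ "\<lambda>k. \<kappa> k + \<kappa>' k"])
qed

lemma noise_sum:
  "finite F \<Longrightarrow> (\<And>i. i \<in> F \<Longrightarrow> noise (h i) (D i)) \<Longrightarrow> noise (\<lambda>t. \<Sum>i\<in>F. h i t) (\<lambda>\<omega>. \<Sum>i\<in>F. D i \<omega>)"
  by (induction F rule: finite_induct) (auto intro: noise_add noise_0)

lemma noise_measurable:
  assumes "noise h D"
  shows "D \<in> borel_measurable M"
proof -
  obtain Z \<kappa> where *: "fin_supp m h" "wiener (\<lambda>t. \<sigma> * h t) Z"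
    "AE \<omega> in M. (\<lambda>k. Z \<omega> + psum \<Xi> (jump_part h k) \<omega> + \<kappa> k) \<longlonglongrightarrow> D \<omega>"
    using assms by (auto simp: noise_def)
  note [measurable] = wiener_measurable[OF *(2)] measurable_psum[OF fin_supp_jump_part[OF *(1)]]
  have "(\<lambda>\<omega>. lim (\<lambda>k. Z \<omega> + psum \<Xi> (jump_part h k) \<omega> + \<kappa> k)) \<in> borel_measurable M" by measurable
  then show ?thesis
    by (rule borel_measurable_AE_cong) (use *(3) in \<open>auto elim!: eventually_mono simp: limI\<close>)
qed

text \<open>The formula holds for each cutoff \<open>k\<close>, where the factor
  \<open>cis (\<kappa> k)\<close> comes out of both sides, and passes to the limit by bounded
  convergence.\<close>

lemma noise_indep:
  assumes D: "noise h D" and g: "wiener g Z'" and \<phi>: "fin_supp (m \<Otimes>\<^sub>M \<nu>) \<phi>"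
    and disj: "\<And>t. t \<in> space m \<Longrightarrow> h t \<noteq> 0 \<Longrightarrow> g t = 0" "\<And>t x. t \<in> space m \<Longrightarrow> h t \<noteq> 0 \<Longrightarrow> \<phi> (t, x) = 0"
  shows "(\<integral>\<omega>. cis (D \<omega>) * cis (Z' \<omega> + psum \<Xi> \<phi> \<omega>) \<partial>M)
    = (\<integral>\<omega>. cis (D \<omega>) \<partial>M) * (\<integral>\<omega>. cis (Z' \<omega> + psum \<Xi> \<phi> \<omega>) \<partial>M)"
proof -
  obtain Z \<kappa> where *: "fin_supp m h" "wiener (\<lambda>t. \<sigma> * h t) Z"
    "AE \<omega> in M. (\<lambda>k. Z \<omega> + psum \<Xi> (jump_part h k) \<omega> + \<kappa> k) \<longlonglongrightarrow> D \<omega>"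
    using D by (auto simp: noise_def)
  note [measurable] = wiener_measurable[OF *(2)] measurable_psum[OF fin_supp_jump_part[OF *(1)]]
    wiener_measurable[OF g] measurable_psum[OF \<phi>] noise_measurable[OF D]
  let ?X = "\<lambda>k \<omega>. Z \<omega> + psum \<Xi> (jump_part h k) \<omega> + \<kappa> k" and ?K = "\<lambda>\<omega>. cis (Z' \<omega> + psum \<Xi> \<phi> \<omega>)"
  have eq: "(\<integral>\<omega>. cis (?X k \<omega>) * ?K \<omega> \<partial>M) = (\<integral>\<omega>. cis (?X k \<omega>) \<partial>M) * (\<integral>\<omega>. ?K \<omega> \<partial>M)" for k
  proof -
    have "(\<integral>\<omega>. cis (Z \<omega> + psum \<Xi> (jump_part h k) \<omega>) * ?K \<omega> \<partial>M)
      = (\<integral>\<omega>. cis (Z \<omega> + psum \<Xi> (jump_part h k) \<omega>) \<partial>M) * (\<integral>\<omega>. ?K \<omega> \<partial>M)"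
      using disj by (intro wiener_psum_disjoint_indep[OF *(2) g _ fin_supp_jump_part[OF *(1)] \<phi>])
        (auto simp: jump_part_def space_pair_measure)
    then have "cis (\<kappa> k) * (\<integral>\<omega>. cis (Z \<omega> + psum \<Xi> (jump_part h k) \<omega>) * ?K \<omega> \<partial>M)
      = cis (\<kappa> k) * (\<integral>\<omega>. cis (Z \<omega> + psum \<Xi> (jump_part h k) \<omega>) \<partial>M) * (\<integral>\<omega>. ?K \<omega> \<partial>M)" by simp
    moreover have "cis (?X k \<omega>) = cis (\<kappa> k) * cis (Z \<omega> + psum \<Xi> (jump_part h k) \<omega>)" for \<omega>
      by (simp add: cis_mult add_ac)
    ultimately show ?thesis by (simp only: integral_mult_right_zero mult.assoc)
  qed
  have "AE \<omega> in M. (\<lambda>k. cis (?X k \<omega>) * ?K \<omega>) \<longlonglongrightarrow> cis (D \<omega>) * ?K \<omega>"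
    using *(3) by eventually_elim (intro tendsto_intros)
  then have "(\<lambda>k. \<integral>\<omega>. cis (?X k \<omega>) * ?K \<omega> \<partial>M) \<longlonglongrightarrow> (\<integral>\<omega>. cis (D \<omega>) * ?K \<omega> \<partial>M)"
    by (intro expectation_bounded_tendsto[where c=1]) (auto simp: norm_mult)
  moreover have "(\<lambda>k. \<integral>\<omega>. cis (?X k \<omega>) * ?K \<omega> \<partial>M) \<longlonglongrightarrow> (\<integral>\<omega>. cis (D \<omega>) \<partial>M) * (\<integral>\<omega>. ?K \<omega> \<partial>M)"
    unfolding eq using *(3) by (intro tendsto_mult tendsto_const expectation_cis_tendsto) auto
  ultimately show ?thesis by (rule LIMSEQ_unique)
qed

section \<open>Removing sets that shrink to a null set\<close>

lemma emeasure_Inter_vanishing: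
  assumes "\<And>n. V n \<in> sets m" "(\<lambda>n. emeasure m (V n)) \<longlonglongrightarrow> 0"
  shows "emeasure m (\<Inter>n::nat. V n) = 0"
proof -
  have "emeasure m (\<Inter>n. V n) \<le> emeasure m (V n)" for n
    using assms(1) by (intro emeasure_mono) auto
  then have "emeasure m (\<Inter>n. V n) \<le> 0"
    by (intro LIMSEQ_le_const[OF assms(2)]) auto
  then show ?thesis by simp
qed

text \<open>Since \<open>V\<close> decreases to a null set, almost every \<open>t\<close> leaves it
  for good. The removed integrand thus tends to \<open>0\<close> almost everywhere, and its square
  is dominated by that of \<open>h\<close>; \<open>wiener_cis_dist\<close> converts the resulting L2
  convergence.\<close>

lemma wiener_restrict_tendsto:
  assumes V: "\<And>n. V n \<in> sets m" "decseq V" "(\<lambda>n. emeasure m (V n)) \<longlonglongrightarrow> 0"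
    and W: "wiener h Z" "\<And>n. wiener (\<lambda>t. h t * indicator (space m - V n) t) (W n)"
  shows "(\<lambda>n. \<integral>\<omega>. norm (cis (Z \<omega>) - cis (W n \<omega>)) \<partial>M) \<longlonglongrightarrow> 0"
proof -
  note [measurable] = V(1)
  have h: "sq_integrable m h" using W(1) by (rule wiener_sq_integrable)
  have [measurable]: "h \<in> borel_measurable m" using h by (simp add: sq_integrable_def)
  let ?d = "\<lambda>n t. (h t - h t * indicator (space m - V n) t)\<^sup>2"
  have "(\<lambda>n. \<integral>t. ?d n t \<partial>m) \<longlonglongrightarrow> (\<integral>t. 0 \<partial>m)"
  proof (rule integral_dominated_convergence[where w="\<lambda>t. (h t)\<^sup>2"])
    have "AE t in m. t \<notin> (\<Inter>n. V n)"
      using emeasure_Inter_vanishing[OF V(1,3)] by (intro AE_not_in) (auto simp: null_sets_def)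
    with AE_space show "AE t in m. (\<lambda>n. ?d n t) \<longlonglongrightarrow> 0"
    proof eventually_elim
      case (elim t)
      then obtain N where "t \<notin> V N" by auto
      then have "t \<notin> V n" if "n \<ge> N" for n using decseqD[OF V(2) that] by auto
      then have "\<forall>\<^sub>F n in sequentially. ?d n t = 0"
        using elim by (intro eventually_sequentiallyI[of N]) simp
      then show ?case by (rule tendsto_eventually)
    qed
    show "AE t in m. norm (?d n t) \<le> (h t)\<^sup>2" for n
      by (auto simp: indicator_def)
  qed (use h in \<open>auto simp: sq_integrable_def\<close>)
  then have "(\<lambda>n. \<integral>t. ?d n t \<partial>m) \<longlonglongrightarrow> 0" by simp
  then have "(\<lambda>n. sqrt (2 - 2 * exp (- (\<integral>t. ?d n t \<partial>m) / 2))) \<longlonglongrightarrow> sqrt (2 - 2 * exp (- 0 / 2))"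
    by (intro tendsto_intros) auto
  then have lim: "(\<lambda>n. sqrt (2 - 2 * exp (- (\<integral>t. ?d n t \<partial>m) / 2))) \<longlonglongrightarrow> 0" by simp
  show ?thesis
    by (rule tendsto_sandwich[OF _ _ tendsto_const lim])
      (use wiener_cis_dist[OF W(1) W(2)] in auto)
qed

text \<open>Almost surely no random point sits above the null set where all \<open>V n\<close> meet.
  Each of the finitely many points charged by \<open>\<phi>\<close> therefore lies outside
  \<open>V n\<close> from some \<open>n\<close> on, and the restricted sums are eventually
  constant.\<close>

lemma psum_restrict_tendsto:
  assumes V: "\<And>n. V n \<in> sets m" "decseq V" "(\<lambda>n. emeasure m (V n)) \<longlonglongrightarrow> 0"
    and \<phi>: "fin_supp (m \<Otimes>\<^sub>M \<nu>) \<phi>"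
  shows "AE \<omega> in M. (\<lambda>n. psum \<Xi> (\<lambda>p. \<phi> p * indicator (space m - V n) (fst p)) \<omega>) \<longlonglongrightarrow> psum \<Xi> \<phi> \<omega>"
proof -
  have I: "(\<Inter>n. V n) \<in> sets m" using V(1) by auto
  \<comment> \<open>The intensity of the strip is \<open>0 * emeasure \<nu> UNIV\<close>, which is
    \<open>0\<close> in \<open>ennreal\<close> even when \<open>\<nu>\<close> has infinite
    mass.\<close>
  have "AE \<omega> in M. \<Xi> \<omega> \<inter> (\<Inter>n. V n) \<times> UNIV = {}"
    using I emeasure_Times_nu[OF I, of UNIV] emeasure_Inter_vanishing[OF V(1,3)]
    by (intro AE_no_points) (auto intro!: pair_measureI)
  with AE_finite_supp[OF \<phi>] show ?thesis
  proof eventually_elim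
    case (elim \<omega>)
    let ?P = "{p \<in> \<Xi> \<omega>. \<phi> p \<noteq> 0}"
    have "(\<lambda>n. \<Sum>p\<in>?P. \<phi> p * indicator (space m - V n) (fst p)) \<longlonglongrightarrow> (\<Sum>p\<in>?P. \<phi> p)"
    proof (rule tendsto_sum)
      fix p assume p: "p \<in> ?P"
      have "fst p \<in> space m" using p elim Xi_subset[of \<omega>] by (auto simp: space_pair_measure)
      obtain N where "fst p \<notin> V N" using p elim by (cases p) auto
      then have "fst p \<notin> V n" if "n \<ge> N" for n using decseqD[OF V(2) that] by auto
      then have "\<forall>\<^sub>F n in sequentially. \<phi> p * indicator (space m - V n) (fst p) = \<phi> p"
        using \<open>fst p \<in> space m\<close> by (intro eventually_sequentiallyI[of N]) simp
      then show "(\<lambda>n. \<phi> p * indicator (space m - V n) (fst p)) \<longlonglongrightarrow> \<phi> p" by (rule tendsto_eventually)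
    qed
    moreover have "psum \<Xi> \<phi> \<omega> = (\<Sum>p\<in>?P. \<phi> p)"
      using elim by (intro psum_eq_sum) auto
    moreover have "psum \<Xi> (\<lambda>p. \<phi> p * indicator (space m - V n) (fst p)) \<omega>
        = (\<Sum>p\<in>?P. \<phi> p * indicator (space m - V n) (fst p))" for n
      using elim by (intro psum_eq_sum) auto
    ultimately show ?case by simp
  qed
qed

text \<open>Orthogonality to the noise off each \<open>V n\<close> extends to all noise, because
  what lies over \<open>V n\<close> disappears in the limit. The sum part converges almost surely
  and the Gaussian part only through its exponentials in mean, so the two are handled
  separately.\<close>

lemma noise_orthogonal:
  fixes H :: "'w \<Rightarrow> complex"
  assumes V: "\<And>n. V n \<in> sets m" "decseq V" "(\<lambda>n. emeasure m (V n)) \<longlonglongrightarrow> 0"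
    and H[measurable]: "H \<in> borel_measurable M" and bound: "\<And>\<omega>. \<omega> \<in> space M \<Longrightarrow> norm (H \<omega>) \<le> c"
    and zero: "\<And>n g Z \<phi>. wiener g Z \<Longrightarrow> fin_supp (m \<Otimes>\<^sub>M \<nu>) \<phi> \<Longrightarrow> (\<And>t. t \<in> V n \<Longrightarrow> g t = 0) \<Longrightarrow>
      (\<And>t x. t \<in> V n \<Longrightarrow> \<phi> (t, x) = 0) \<Longrightarrow> (\<integral>\<omega>. H \<omega> * cis (Z \<omega> + psum \<Xi> \<phi> \<omega>) \<partial>M) = 0"
    and D: "noise h D"
  shows "(\<integral>\<omega>. H \<omega> * cis (D \<omega>) \<partial>M) = 0"
proof -
  obtain Z \<kappa> where *: "fin_supp m h" "wiener (\<lambda>t. \<sigma> * h t) Z"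
    "AE \<omega> in M. (\<lambda>k. Z \<omega> + psum \<Xi> (jump_part h k) \<omega> + \<kappa> k) \<longlonglongrightarrow> D \<omega>"
    using D by (auto simp: noise_def)
  note [measurable] = wiener_measurable[OF *(2)] measurable_psum[OF fin_supp_jump_part[OF *(1)]]
    noise_measurable[OF D]
  have c0: "0 \<le> c" using bound not_empty order_trans[OF norm_ge_zero] by blast
  obtain W where W: "\<And>n. wiener (\<lambda>t. \<sigma> * h t * indicator (space m - V n) t) (W n)"
    using wiener_restrict[OF *(2), of "space m - V _"] V(1) by (metis sets.compl_sets)
  note [measurable] = wiener_measurable[OF W]
  have key: "(\<integral>\<omega>. H \<omega> * cis (Z \<omega> + psum \<Xi> (jump_part h k) \<omega>) \<partial>M) = 0" for k
  proof -
    let ?P = "psum \<Xi> (jump_part h k)"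
    define \<phi> where "\<phi> n p = jump_part h k p * indicator (space m - V n) (fst p)" for n p
    have \<phi>: "fin_supp (m \<Otimes>\<^sub>M \<nu>) (\<phi> n)" for n
    proof (rule fin_supp_mono[OF fin_supp_jump_part[OF *(1), of k]])
      note [measurable] = V(1)
      have [measurable]: "jump_part h k \<in> borel_measurable (m \<Otimes>\<^sub>M \<nu>)"
        using fin_supp_jump_part[OF *(1), of k] by (simp add: fin_supp_def)
      show "\<phi> n \<in> borel_measurable (m \<Otimes>\<^sub>M \<nu>)" unfolding \<phi>_def[abs_def] by measurable
    qed (simp add: \<phi>_def)
    note [measurable] = measurable_psum[OF \<phi>]
    have zero_n: "(\<integral>\<omega>. H \<omega> * cis (W n \<omega> + psum \<Xi> (\<phi> n) \<omega>) \<partial>M) = 0" for n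
      by (rule zero[OF W \<phi>, of n]) (auto simp: \<phi>_def)
    have P: "AE \<omega> in M. (\<lambda>n. psum \<Xi> (\<phi> n) \<omega>) \<longlonglongrightarrow> ?P \<omega>"
      using psum_restrict_tendsto[OF V fin_supp_jump_part[OF *(1), of k]] by (simp add: \<phi>_def[abs_def])
    \<comment> \<open>Only the sum is restricted here, while the Gaussian term \<open>Z\<close>
      stays whole.\<close>
    have 1: "(\<lambda>n. \<integral>\<omega>. H \<omega> * cis (Z \<omega> + psum \<Xi> (\<phi> n) \<omega>) \<partial>M) \<longlonglongrightarrow> (\<integral>\<omega>. H \<omega> * cis (Z \<omega> + ?P \<omega>) \<partial>M)"
    proof (rule expectation_bounded_tendsto[where c=c])
      show "AE \<omega> in M. (\<lambda>n. H \<omega> * cis (Z \<omega> + psum \<Xi> (\<phi> n) \<omega>)) \<longlonglongrightarrow> H \<omega> * cis (Z \<omega> + ?P \<omega>)"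
        using P by eventually_elim (intro tendsto_intros)
    qed (auto simp: norm_mult bound)
    \<comment> \<open>Replacing \<open>Z\<close> by its restriction \<open>W n\<close> gives an
      expectation that is zero by assumption, so the whole expectation is at most the cost of this
      replacement.\<close>
    have "(\<lambda>n. \<integral>\<omega>. H \<omega> * cis (Z \<omega> + psum \<Xi> (\<phi> n) \<omega>) \<partial>M) \<longlonglongrightarrow> 0"
    proof (rule Lim_null_comparison)
      have "norm (\<integral>\<omega>. H \<omega> * cis (Z \<omega> + psum \<Xi> (\<phi> n) \<omega>) \<partial>M)
          \<le> c * (\<integral>\<omega>. norm (cis (Z \<omega>) - cis (W n \<omega>)) \<partial>M)" for n
      proof -
        let ?Q = "psum \<Xi> (\<phi> n)"
        have i: "integrable M (\<lambda>\<omega>. H \<omega> * cis (Z \<omega> + ?Q \<omega>))" "integrable M (\<lambda>\<omega>. H \<omega> * cis (W n \<omega> + ?Q \<omega>))"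
          using c0 bound by (auto intro!: integrable_const_bound[where B=c] simp: norm_mult)
        have "(\<integral>\<omega>. H \<omega> * cis (Z \<omega> + ?Q \<omega>) \<partial>M)
          = (\<integral>\<omega>. H \<omega> * cis (Z \<omega> + ?Q \<omega>) - H \<omega> * cis (W n \<omega> + ?Q \<omega>) \<partial>M)"
          using i zero_n by simp
        also have "norm \<dots> \<le> (\<integral>\<omega>. norm (H \<omega> * cis (Z \<omega> + ?Q \<omega>) - H \<omega> * cis (W n \<omega> + ?Q \<omega>)) \<partial>M)"
          by (rule integral_norm_bound)
        also have "\<dots> \<le> (\<integral>\<omega>. c * norm (cis (Z \<omega>) - cis (W n \<omega>)) \<partial>M)"
        proof (rule integral_mono)
          show "integrable M (\<lambda>\<omega>. c * norm (cis (Z \<omega>) - cis (W n \<omega>)))"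
            by (intro integrable_mult_right integrable_norm Bochner_Integration.integrable_diff
                integrable_const_bound[where B=1]) auto
          fix \<omega> assume "\<omega> \<in> space M"
          \<comment> \<open>The exponential of the sum has modulus one and drops out of the
            norm.\<close>
          have "H \<omega> * cis (Z \<omega> + ?Q \<omega>) - H \<omega> * cis (W n \<omega> + ?Q \<omega>) = H \<omega> * (cis (Z \<omega>) - cis (W n \<omega>)) * cis (?Q \<omega>)"
            by (simp add: cis_mult[symmetric] algebra_simps)
          then show "norm (H \<omega> * cis (Z \<omega> + ?Q \<omega>) - H \<omega> * cis (W n \<omega> + ?Q \<omega>)) \<le> c * norm (cis (Z \<omega>) - cis (W n \<omega>))"
            using bound[OF \<open>\<omega> \<in> space M\<close>] by (simp add: norm_mult mult_right_mono)
        qed (use i in auto)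
        finally show ?thesis by simp
      qed
      then show "\<forall>\<^sub>F n in sequentially. norm (\<integral>\<omega>. H \<omega> * cis (Z \<omega> + psum \<Xi> (\<phi> n) \<omega>) \<partial>M)
          \<le> c * (\<integral>\<omega>. norm (cis (Z \<omega>) - cis (W n \<omega>)) \<partial>M)" by simp
      show "(\<lambda>n. c * (\<integral>\<omega>. norm (cis (Z \<omega>) - cis (W n \<omega>)) \<partial>M)) \<longlonglongrightarrow> 0"
        by (intro tendsto_mult_right_zero wiener_restrict_tendsto[OF V *(2) W])
    qed
    with 1 show ?thesis by (rule LIMSEQ_unique)
  qed
  have "(\<integral>\<omega>. H \<omega> * cis (Z \<omega> + psum \<Xi> (jump_part h k) \<omega> + \<kappa> k) \<partial>M) = 0" for k
  proof -
    have "H \<omega> * cis (Z \<omega> + psum \<Xi> (jump_part h k) \<omega> + \<kappa> k) = H \<omega> * cis (Z \<omega> + psum \<Xi> (jump_part h k) \<omega>) * cis (\<kappa> k)" for \<omega>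
      by (simp add: cis_mult)
    then show ?thesis using key[of k] by (simp only: integral_mult_left_zero mult_zero_left)
  qed
  moreover have "(\<lambda>k. \<integral>\<omega>. H \<omega> * cis (Z \<omega> + psum \<Xi> (jump_part h k) \<omega> + \<kappa> k) \<partial>M) \<longlonglongrightarrow> (\<integral>\<omega>. H \<omega> * cis (D \<omega>) \<partial>M)"
  proof (rule expectation_bounded_tendsto[where c=c])
    show "AE \<omega> in M. (\<lambda>k. H \<omega> * cis (Z \<omega> + psum \<Xi> (jump_part h k) \<omega> + \<kappa> k)) \<longlonglongrightarrow> H \<omega> * cis (D \<omega>)"
      using *(3) by eventually_elim (intro tendsto_intros)
  qed (auto simp: norm_mult bound)
  ultimately show ?thesis by (simp add: LIMSEQ_const_iff)
qed

text \<open>The totality criterion is used twice. At level \<open>n\<close> it passes from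
  increments carried by \<open>V n\<close> to the event \<open>E\<close>, which makes
  \<open>E\<close> independent of test variables off \<open>V n\<close>. At level \<open>0\<close>,
  with the centred indicator of \<open>E\<close> in the other role, it passes from increments to
  \<open>E\<close> once more and makes \<open>E\<close> independent of itself.\<close>

theorem noise_zero_one:
  assumes V: "\<And>n. V n \<in> sets m" "decseq V" "(\<lambda>n. emeasure m (V n)) \<longlonglongrightarrow> 0"
    and D: "\<And>n i. i \<in> I n \<Longrightarrow> noise (h i) (D i)"
    and supp: "\<And>n i t. i \<in> I n \<Longrightarrow> t \<in> space m \<Longrightarrow> t \<notin> V n \<Longrightarrow> h i t = 0"
    and E: "\<And>n. E \<in> sigma_gen M D (I n)"
  shows "prob E = 0 \<or> prob E = 1"
proof -
  have Dm: "D i \<in> borel_measurable M" if "i \<in> I n" for i n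
    using D[OF that] by (rule noise_measurable)
  have Em[measurable]: "E \<in> sets M"
    using sigma_gen_subset[of "I 0" D] Dm E[of 0] by blast
  \<comment> \<open>The centred indicator: its orthogonality to a variable is the factorisation of
    the expectation of that variable over \<open>E\<close>.\<close>
  define H :: "'w \<Rightarrow> complex" where "H \<omega> = indicator E \<omega> - of_real (prob E)" for \<omega>
  have Hm[measurable]: "H \<in> borel_measurable M" unfolding H_def[abs_def] by measurable
  have Hb: "norm (H \<omega>) \<le> 2" for \<omega>
    unfolding H_def by (rule order_trans[OF norm_triangle_ineq4]) (auto simp: indicator_def intro: order_trans[OF prob_le_1])
  have EE: "(\<integral>\<omega>. indicator E \<omega> \<partial>M) = complex_of_real (prob E)"
    using integral_complex_of_real[of M "indicator E"] by (simp add: of_real_indicator)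
  have comb: "noise (\<lambda>t. \<Sum>i\<in>F. t' i * h i t) (\<lambda>\<omega>. \<Sum>i\<in>F. t' i * D i \<omega>)"
    if "finite F" "F \<subseteq> I n" for F t' n
    using that D by (intro noise_sum noise_cmult) auto
  \<comment> \<open>Any one level would serve for the outer use, since \<open>E\<close> belongs to
    all the sigma-algebras; \<open>0\<close> is chosen. The inner level \<open>n\<close>
    varies.\<close>
  have "(\<integral>\<omega>. H \<omega> * indicator E \<omega> \<partial>M) = 0"
  proof (rule Fourier_total_sigma_gen[where I="I 0" and X=D and c=2])
    fix F :: "'b set" and s :: "'b \<Rightarrow> real" assume F: "finite F" "F \<subseteq> I 0"
    show "(\<integral>\<omega>. H \<omega> * cis (\<Sum>i\<in>F. s i * D i \<omega>) \<partial>M) = 0"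
    proof (rule noise_orthogonal[OF V Hm Hb _ comb[OF F]])
      fix n g Z \<phi> assume g: "wiener g Z" and \<phi>: "fin_supp (m \<Otimes>\<^sub>M \<nu>) \<phi>"
        and g0: "\<And>t. t \<in> V n \<Longrightarrow> g t = 0" and \<phi>0: "\<And>t x. t \<in> V n \<Longrightarrow> \<phi> (t, x) = 0"
      note [measurable] = wiener_measurable[OF g] measurable_psum[OF \<phi>]
      let ?C = "\<lambda>\<omega>. cis (Z \<omega> + psum \<Xi> \<phi> \<omega>)"
      define c where "c = (\<integral>\<omega>. ?C \<omega> \<partial>M)"
      have iC: "integrable M ?C" by (rule integrable_const_bound[where B=1]) auto
      have "norm c \<le> (\<integral>\<omega>. norm (?C \<omega>) \<partial>M)" unfolding c_def by (rule integral_norm_bound)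
      then have c1: "norm c \<le> 1" by (simp add: prob_space)
      \<comment> \<open>At level \<open>n\<close> all increments are carried by \<open>V n\<close>
        and \<open>?C\<close> by its complement, so the centred variable \<open>?C - c\<close> is
        orthogonal to their exponentials and hence to \<open>E\<close>.\<close>
      have "(\<integral>\<omega>. (?C \<omega> - c) * indicator E \<omega> \<partial>M) = 0"
      proof (rule Fourier_total_sigma_gen[where I="I n" and X=D and c=2])
        fix F :: "'b set" and s :: "'b \<Rightarrow> real" assume F: "finite F" "F \<subseteq> I n"
        let ?S = "\<lambda>\<omega>. \<Sum>i\<in>F. s i * D i \<omega>"
        have [measurable]: "?S \<in> borel_measurable M" by (rule noise_measurable[OF comb[OF F]])
        have nz: "t \<in> V n" if "t \<in> space m" "(\<Sum>i\<in>F. s i * h i t) \<noteq> 0" for t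
        proof (rule ccontr)
          assume "t \<notin> V n"
          then have "(\<Sum>i\<in>F. s i * h i t) = 0"
            using F supp[of _ n t] that(1) by (intro sum.neutral) auto
          with that(2) show False by simp
        qed
        have "(\<integral>\<omega>. cis (?S \<omega>) * ?C \<omega> \<partial>M) = (\<integral>\<omega>. cis (?S \<omega>) \<partial>M) * c"
          unfolding c_def by (rule noise_indep[OF comb[OF F] g \<phi>]) (use nz g0 \<phi>0 in auto)
        moreover have "integrable M (\<lambda>\<omega>. cis (?S \<omega>) * ?C \<omega>)" "integrable M (\<lambda>\<omega>. cis (?S \<omega>) * c)"
          by (rule integrable_const_bound[where B=1]; use c1 in \<open>auto simp: norm_mult\<close>)+
        ultimately have "(\<integral>\<omega>. cis (?S \<omega>) * ?C \<omega> - cis (?S \<omega>) * c \<partial>M) = 0"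
          by simp
        then show "(\<integral>\<omega>. (?C \<omega> - c) * cis (?S \<omega>) \<partial>M) = 0"
          by (simp add: left_diff_distrib mult.commute[of "cis (\<Sum>i\<in>F. s i * D i _)"])
      next
        show "norm (?C \<omega> - c) \<le> 2" for \<omega>
          by (rule order_trans[OF norm_triangle_ineq4]) (use c1 in simp)
      qed (use Dm E in auto)
      moreover have "integrable M (\<lambda>\<omega>. ?C \<omega> * indicator E \<omega>)" "integrable M (\<lambda>\<omega>. c * indicator E \<omega>)"
        by (rule integrable_const_bound[where B=1]; use c1 in \<open>auto simp: norm_mult indicator_def\<close>)+
      ultimately have "(\<integral>\<omega>. ?C \<omega> * indicator E \<omega> \<partial>M) = (\<integral>\<omega>. c * indicator E \<omega> \<partial>M)"
        by (simp add: left_diff_distrib)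
      then have "(\<integral>\<omega>. ?C \<omega> * indicator E \<omega> \<partial>M) = c * of_real (prob E)" by (simp add: EE)
      \<comment> \<open>The factorisation just obtained, rewritten as orthogonality of
        \<open>H\<close> and \<open>?C\<close>: the centring moves from \<open>?C\<close> to the
        indicator of \<open>E\<close>.\<close>
      then have "(\<integral>\<omega>. ?C \<omega> * indicator E \<omega> - ?C \<omega> * of_real (prob E) \<partial>M) = 0"
        using \<open>integrable M (\<lambda>\<omega>. ?C \<omega> * indicator E \<omega>)\<close> iC
        by (subst Bochner_Integration.integral_diff) (auto simp: c_def)
      then show "(\<integral>\<omega>. H \<omega> * cis (Z \<omega> + psum \<Xi> \<phi> \<omega>) \<partial>M) = 0"
        by (simp add: H_def right_diff_distrib mult.commute)
    qed
  qed (use Dm E Hb in auto)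
  \<comment> \<open>On \<open>E\<close> the variable \<open>H\<close> equals
    \<open>1 - prob E\<close>, so the vanishing expectation is
    \<open>(1 - prob E) * prob E\<close>.\<close>
  moreover have "(\<integral>\<omega>. H \<omega> * indicator E \<omega> \<partial>M) = (\<integral>\<omega>. of_real (1 - prob E) * indicator E \<omega> \<partial>M)"
    by (intro Bochner_Integration.integral_cong) (auto simp: H_def indicator_def)
  ultimately have "complex_of_real ((1 - prob E) * prob E) = 0" by (simp add: EE)
  then show ?thesis by (simp only: of_real_eq_0_iff) auto
qed

end

section \<open>Measurability of the vicinity and conclusion\<close>

text \<open>When no set of \<open>\<A>s n\<close> contains \<open>A\<close>, the intersection runs
  over \<open>{T}\<close> alone, and \<open>T\<close> need not belong to \<open>\<A>\<close>; this
  is why \<open>T\<close> appears as an exception.\<close>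

lemma (in indexing_collection) g_approx_mem:
  assumes "A \<in> \<A>"
  shows "g_approx T \<A>s n A \<in> insert T \<A>"
proof (cases "{A' \<in> \<A>s n. A \<subseteq> A'} = {}")
  case True
  then have "{A' \<in> \<A>s n \<union> {T}. A \<subseteq> A'} = {T}" using assms subsets by auto
  then show ?thesis by (simp add: g_approx_def)
next
  case False
  have "g_approx T \<A>s n A = \<Inter>{A' \<in> \<A>s n. A \<subseteq> A'}"
    unfolding g_approx_def using False approx_subset[of n] subsets by blast
  also have "\<dots> \<in> \<A>"
    using approx_subset[of n] False
    by (intro countable_Inter) (auto intro: countable_finite[OF finite_subset[OF _ approx_finite[of n]]])
  finally show ?thesis by simp
qed

lemma (in indexing_collection) decseq_g_approx: "decseq (\<lambda>n. g_approx T \<A>s n A)"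
proof (rule decseq_SucI)
  fix n
  have "\<A>s n \<subseteq> \<A>s (Suc n)" using approx_mono by (simp add: mono_iff_le_Suc)
  then show "g_approx T \<A>s (Suc n) A \<subseteq> g_approx T \<A>s n A" unfolding g_approx_def by blast
qed

text \<open>For each \<open>n\<close> an approximation is determined by a subfamily of the finite
  collection \<open>\<A>s n \<union> {T}\<close>.\<close>

lemma (in indexing_collection) countable_g_approx: "countable (\<Union>n. range (g_approx T \<A>s n))"
proof -
  have "range (g_approx T \<A>s n) \<subseteq> Inter ` Pow (\<A>s n \<union> {T})" for n
    unfolding g_approx_def by auto
  then have "finite (range (g_approx T \<A>s n))" for n
    using approx_finite[of n] by (meson finite.emptyI finite_Pow_iff finite_UnI finite_imageI finite_insert finite_subset)
  then show ?thesis by (intro countable_UN) (auto intro: countable_finite)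
qed

text \<open>Each \<open>A'\<close> in the ball is replaced by one of its outer approximations, close
  enough to stay in the ball and fine enough to keep a given point in the symmetric difference.
  Countably many sets then give the whole union.\<close>

lemma vicinity_sets:
  assumes ic: "indexing_collection T \<A> \<A>s" and cm: "compatible_metric T \<A> \<A>s d" and A: "A \<in> \<A>"
  shows "vicinity \<A> d A \<rho> \<in> sigma_sets T \<A>"
proof -
  interpret indexing_collection T \<A> \<A>s by fact
  interpret d: compatible_metric T \<A> \<A>s d by fact
  let ?g = "g_approx T \<A>s"
  let ?\<D> = "ball_ic \<A> d A \<rho> \<inter> (\<Union>n. range (?g n))"
  have "vicinity \<A> d A \<rho> = (\<Union>A'\<in>?\<D>. sym_diff A A')"
  proof
    show "vicinity \<A> d A \<rho> \<subseteq> (\<Union>A'\<in>?\<D>. sym_diff A A')"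
    proof
      fix t assume "t \<in> vicinity \<A> d A \<rho>"
      then obtain A' where A': "A' \<in> \<A>" "d A A' < \<rho>" "t \<in> sym_diff A A'"
        by (auto simp: vicinity_def ball_ic_def)
      have Int: "A' = (\<Inter>n. ?g n A')" by (rule approx[OF A'(1)])
      \<comment> \<open>If every approximation were \<open>T\<close> outside \<open>\<A>\<close>,
        their intersection \<open>A'\<close> would be \<open>T\<close>, although \<open>A'\<close>
        is in \<open>\<A>\<close>.\<close>
      have "\<exists>N. ?g N A' \<in> \<A>"
      proof (rule ccontr)
        assume *: "\<nexists>N. ?g N A' \<in> \<A>"
        then have "\<And>n. ?g n A' = T" using g_approx_mem[OF A'(1)] by blast
        with Int have "A' = T" by simp
        with * \<open>\<And>n. ?g n A' = T\<close> A'(1) show False by simp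
      qed
      then obtain N where N: "?g N A' \<in> \<A>" by blast
      \<comment> \<open>Starting at \<open>N\<close> keeps the sequence inside \<open>\<A>\<close>,
        as outer continuity requires: a later term equal to \<open>T\<close> would force the
        smaller-index set \<open>F 0\<close> to equal \<open>T\<close> as well.\<close>
      define F where "F k = ?g (N + k) A'" for k
      have F_dec: "decseq F"
        unfolding F_def using decseq_g_approx[of A'] by (auto simp: decseq_def)
      have FA: "F k \<in> \<A>" for k
      proof (rule ccontr)
        assume "F k \<notin> \<A>"
        then have "F k = T" using g_approx_mem[OF A'(1)] by (auto simp: F_def)
        moreover have "F k \<subseteq> F 0" using decseqD[OF F_dec] by simp
        moreover have F0: "F 0 \<in> \<A>" using N by (simp add: F_def)
        ultimately have "F 0 = F k" using subsets by blast
        with F0 \<open>F k \<notin> \<A>\<close> show False by simp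
      qed
      have sub: "A' \<subseteq> F k" for k unfolding F_def g_approx_def by blast
      have IntF: "(\<Inter>k. F k) = A'"
      proof
        have "F k \<subseteq> ?g k A'" for k
          unfolding F_def using decseqD[OF decseq_g_approx[of A'], of k "N + k"] by simp
        then have "(\<Inter>k. F k) \<subseteq> (\<Inter>k. ?g k A')" by (intro INF_mono) blast
        then show "(\<Inter>k. F k) \<subseteq> A'" using Int by simp
      qed (use sub in blast)
      have "(\<lambda>k. d (F k) A') \<longlonglongrightarrow> 0" using d.outer_continuous[OF FA F_dec] by (simp add: IntF)
      \<comment> \<open>The bound is the room left in the ball after reaching \<open>A'\<close>; the
        triangle inequality uses it up.\<close>
      then have "\<forall>\<^sub>F k in sequentially. d (F k) A' < \<rho> - d A A'"
        using A'(2) by (intro order_tendstoD(2)[of _ 0]) auto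
      \<comment> \<open>A point of \<open>A'\<close> lies in all outer approximations, and a point
        off \<open>A'\<close> is off all but finitely many of them.\<close>
      moreover have "\<forall>\<^sub>F k in sequentially. t \<in> sym_diff A (F k)"
      proof (cases "t \<in> A'")
        case True
        then show ?thesis using A'(3) sub by (intro always_eventually) blast
      next
        case False
        then obtain K where "t \<notin> F K" using IntF by blast
        then have "t \<notin> F k" if "k \<ge> K" for k using decseqD[OF F_dec that] by blast
        then show ?thesis using A'(3) False by (intro eventually_sequentiallyI[of K]) auto
      qed
      ultimately have "\<forall>\<^sub>F k in sequentially. d (F k) A' < \<rho> - d A A' \<and> t \<in> sym_diff A (F k)"
        by (rule eventually_conj)
      then obtain k where k: "d (F k) A' < \<rho> - d A A'" "t \<in> sym_diff A (F k)"
        by (auto simp: eventually_sequentially)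
      have "d A (F k) \<le> d A A' + d A' (F k)" using A A'(1) FA by (rule d.triangle)
      also have "d A' (F k) = d (F k) A'" using A'(1) FA by (rule d.sym)
      finally have "F k \<in> ball_ic \<A> d A \<rho>" using k(1) FA[of k] by (simp add: ball_ic_def)
      then show "t \<in> (\<Union>A'\<in>?\<D>. sym_diff A A')" using k(2) by (auto simp: F_def)
    qed
    show "(\<Union>A'\<in>?\<D>. sym_diff A A') \<subseteq> vicinity \<A> d A \<rho>" by (auto simp: vicinity_def)
  qed
  moreover have "(\<Union>A'\<in>?\<D>. sym_diff A A') \<in> sets (sigma T \<A>)"
  proof (rule sets.countable_UN')
    show "countable ?\<D>" using countable_g_approx by (rule countable_subset[rotated]) auto
    have "S \<in> sets (sigma T \<A>)" if "S \<in> \<A>" for S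
      using that subsets by (simp add: sets_measure_of)
    then show "sym_diff A ` ?\<D> \<subseteq> sets (sigma T \<A>)"
      using A by (auto simp: ball_ic_def)
  qed
  ultimately show ?thesis using subsets by (simp add: sets_measure_of)
qed

theorem theorem4p1:
  fixes T :: "'a set" and \<A> :: "'a set set" and \<A>s :: "nat \<Rightarrow> 'a set set"
    and d :: "'a set \<Rightarrow> 'a set \<Rightarrow> real" and m :: "'a measure"
    and M :: "'w measure" and \<sigma> :: real and \<nu> :: "real measure"
    and B X Y :: "'a set \<Rightarrow> 'w \<Rightarrow> real" and \<Xi> :: "'w \<Rightarrow> ('a \<times> real) set"
    and f :: "'a \<Rightarrow> real" and A :: "'a set" and E :: "'w set"
  assumes "indexing_collection T \<A> \<A>s"
    and "finite_dimension \<A> \<A>s"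
    and "compatible_metric T \<A> \<A>s d"
    and "reference_measure T \<A> \<A>s m"
    and "prob_space M" and "complete_measure M"
    and "0 \<le> \<sigma>" and "jump_measure \<nu>"
    and "set_indexed_brownian M \<A> m B"
    and "poisson_random_set M (m \<Otimes>\<^sub>M \<nu>) \<Xi>"
    and "prob_space.indep_set M (sigma_gen M B \<A>) (sigma_gen M (pt_count \<Xi>) (sets (m \<Otimes>\<^sub>M \<nu>)))"
    and "is_levy_process M \<A> m \<sigma> \<nu> B \<Xi> X"
    and "locally_X_integrable \<A> m \<sigma> \<nu> f"
    and "is_integral_process M \<A> m \<sigma> \<nu> B \<Xi> f Y"
    and "A \<in> \<A>"
    and "((\<lambda>\<rho>. emeasure m (vicinity \<A> d A \<rho>)) \<longlongrightarrow> 0) (at_right 0)"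
    and "E \<in> germ_sigma M \<A> d Y A"
  shows "measure M E = 0 \<or> measure M E = 1"
proof -
  interpret indexing_collection T \<A> \<A>s by fact
  have space_m: "space m = T" and sets_T: "sets m = sigma_sets T \<A>"
    and fin_m: "\<And>A. A \<in> \<A> \<Longrightarrow> emeasure m A < \<infinity>"
    using assms(4) by (auto simp: reference_measure_def)
  have Int: "S \<inter> S' \<in> \<A>" if "S \<in> \<A>" "S' \<in> \<A>" for S S'
    using countable_Inter[of "{S, S'}"] that by simp
  interpret brownian M \<A> m B
    by (intro brownian.intro brownian_axioms.intro assms(5,9) Int fin_m)
      (use subsets space_m sets_T in auto)
  interpret poisson_set M "m \<Otimes>\<^sub>M \<nu>" \<Xi>
    by (intro poisson_set.intro poisson_set_axioms.intro assms(5,6,10))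
  interpret levy_noise M \<A> m B \<nu> \<Xi> \<sigma>
    by (intro levy_noise.intro levy_noise_axioms.intro brownian_axioms poisson_set_axioms assms(8,11))
  have f[measurable]: "f \<in> borel_measurable m"
    using assms(13) by (simp add: locally_X_integrable_def)
  obtain W J where W: "\<sigma> \<noteq> 0 \<Longrightarrow> S \<in> \<A> \<Longrightarrow> is_wiener_integral M \<A> m B (\<lambda>t. f t * indicator S t) (W S)"
    and J: "is_jump_integral M \<A> m \<nu> \<Xi> f J"
    and Y: "S \<in> \<A> \<Longrightarrow> AE \<omega> in M. Y S \<omega> = \<sigma> * W S \<omega> + J S \<omega>" for S
    using assms(14) unfolding is_integral_process_def by blast
  \<comment> \<open>The integrand is \<open>f\<close> cut to \<open>S\<close>, whose support has
    finite measure because \<open>S\<close> does. Its square integrability, when the Gaussian term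
    is present, comes from the existence of the Wiener integral.\<close>
  have noise_Y: "noise (\<lambda>t. f t * indicator S t) (Y S)" if S: "S \<in> \<A>" for S
  proof -
    have [measurable]: "S \<in> sets m" using S by simp
    let ?h = "\<lambda>t. f t * indicator S t :: real"
    have "emeasure m {t \<in> space m. ?h t \<noteq> 0} \<le> emeasure m S"
      by (intro emeasure_mono) (auto simp: indicator_def)
    then have fs: "fin_supp m ?h" using fin_m[OF S] by (auto simp: fin_supp_def intro: le_less_trans)
    have w: "wiener (\<lambda>t. \<sigma> * ?h t) (\<lambda>\<omega>. \<sigma> * W S \<omega>)"
    \<comment> \<open>For \<open>\<sigma> = 0\<close> nothing is known about \<open>W S\<close>, but
      both the integrand and the variable are multiplied by zero.\<close>
    proof (cases "\<sigma> = 0")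
      case True
      then show ?thesis using wiener_0 by simp
    next
      case False
      have "wiener ?h (W S)" by (rule is_wiener_integral_wiener[OF _ W[OF False S]]) measurable
      then show ?thesis by (rule wiener_cmult)
    qed
    \<comment> \<open>Minus the compensator at level 1/(k+1), a number that does not depend on the
      outcome; zero when the jumps are not compensated.\<close>
    define \<kappa> where "\<kappa> k = (if summable_small_jumps \<nu> then 0 else
      - ((LINT t:S|m. f t) * (LINT x:{x. 1 / real (Suc k) \<le> \<bar>x\<bar> \<and> \<bar>x\<bar> \<le> 1}|\<nu>. x)))" for k
    have jump_sum_eq: "jump_sum \<Xi> f (1 / real (Suc k)) S \<omega> = psum \<Xi> (jump_part ?h k) \<omega>" for k \<omega>
      unfolding jump_sum_def psum_def by (intro infsum_cong_neutral) (auto simp: jump_part_def indicator_def)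
    have "filterlim (\<lambda>k. 1 / real (Suc k)) (at_right 0) sequentially"
      using LIMSEQ_inverse_real_of_nat by (intro tendsto_imp_filterlim_at_right) (auto simp: inverse_eq_divide)
    note lim0 = filterlim_compose[OF _ this]
    have "AE \<omega> in M. uniform_limit {A' \<in> \<A>. A' \<subseteq> S}
      (\<lambda>\<epsilon> A'. if summable_small_jumps \<nu> then jump_sum \<Xi> f \<epsilon> A' \<omega> else compensated_jump_sum m \<nu> \<Xi> f \<epsilon> A' \<omega>)
      (\<lambda>A'. J A' \<omega>) (at_right 0)"
      using J S by (simp add: is_jump_integral_def)
    with Y[OF S] have "AE \<omega> in M. (\<lambda>k. \<sigma> * W S \<omega> + psum \<Xi> (jump_part ?h k) \<omega> + \<kappa> k) \<longlonglongrightarrow> Y S \<omega>"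
    proof eventually_elim
      case (elim \<omega>)
      \<comment> \<open>The uniform limit over subsets of \<open>S\<close> is evaluated at
        \<open>S\<close> itself.\<close>
      have "((\<lambda>\<epsilon>. if summable_small_jumps \<nu> then jump_sum \<Xi> f \<epsilon> S \<omega> else compensated_jump_sum m \<nu> \<Xi> f \<epsilon> S \<omega>)
        \<longlongrightarrow> J S \<omega>) (at_right 0)"
        by (rule tendsto_uniform_limitI[OF elim(2)]) (use S in simp)
      from lim0[OF this] have "(\<lambda>k. psum \<Xi> (jump_part ?h k) \<omega> + \<kappa> k) \<longlonglongrightarrow> J S \<omega>"
        by (simp add: compensated_jump_sum_def jump_sum_eq \<kappa>_def if_distrib cong: if_cong del: of_nat_Suc split: if_splits)
      from tendsto_add[OF tendsto_const[of "\<sigma> * W S \<omega>"] this] show ?case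
        by (simp add: elim(1) add.assoc)
    qed
    then show ?thesis unfolding noise_def using fs w
      by (intro conjI exI[of _ "\<lambda>\<omega>. \<sigma> * W S \<omega>"] exI[of _ \<kappa>])
  qed
  \<comment> \<open>The germ sigma-algebra is tested along the radii 1/(n+1), which give a
    decreasing sequence of vicinities.\<close>
  define I where "I n = {A' \<in> \<A>. 0 < d A A' \<and> d A A' < 1 / real (Suc n)}" for n
  define V where "V n = vicinity \<A> d A (1 / real (Suc n))" for n
  show ?thesis
  proof (rule noise_zero_one[where V=V and I=I and h="\<lambda>A' t. f t * indicator A t - f t * indicator A' t"
        and D="\<lambda>A' \<omega>. Y A \<omega> - Y A' \<omega>"])
    show "V n \<in> sets m" for n
      unfolding V_def sets_T by (rule vicinity_sets[OF assms(1,3,15)])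
    have "1 / real (Suc (Suc n)) \<le> 1 / real (Suc n)" for n by (simp add: field_simps)
    then show "decseq V"
      unfolding V_def vicinity_def ball_ic_def by (intro decseq_SucI UN_mono) (auto intro: less_le_trans simp del: of_nat_Suc)
    have "filterlim (\<lambda>k. 1 / real (Suc k)) (at_right 0) sequentially"
      using LIMSEQ_inverse_real_of_nat by (intro tendsto_imp_filterlim_at_right) (auto simp: inverse_eq_divide)
    then show "(\<lambda>n. emeasure m (V n)) \<longlonglongrightarrow> 0"
      unfolding V_def by (rule filterlim_compose[OF assms(16)])
    show "noise (\<lambda>t. f t * indicator A t - f t * indicator A' t) (\<lambda>\<omega>. Y A \<omega> - Y A' \<omega>)" if "A' \<in> I n" for A' n
      using noise_add[OF noise_Y[OF assms(15)] noise_cmult[OF noise_Y[of A'], of "-1"]] that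
      by (simp add: I_def)
    \<comment> \<open>The integrand of the increment lives on the symmetric difference of
      \<open>A\<close> and \<open>A'\<close>, one of the sets whose union is
      \<open>V n\<close>.\<close>
    show "f t * indicator A t - f t * indicator A' t = 0" if "A' \<in> I n" "t \<notin> V n" for A' n t
      using that by (auto simp: I_def V_def vicinity_def ball_ic_def indicator_def)
    show "E \<in> sigma_gen M (\<lambda>A' \<omega>. Y A \<omega> - Y A' \<omega>) (I n)" for n
      using assms(17) unfolding germ_sigma_def local_sigma_def I_def by force
  qed
qed

end
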